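(* Let $0<\delta$ be a constant. There exists a hitting set $\mathcal H$ of size $|\mathcal H| = 2^{\tilde{O}(n^{2/3+4\delta/3})}$ for the class of multilinear $\Sigma\Pi\Sigma\Pi$ (depth-$4$) formulas in $n$ variables of size at most $2^{n^\delta}$, and $\mathcal H$ can be constructed in time $\mathrm{poly}(|\mathcal H|)$.
   Context: A depth-$4$ ($\Sigma\Pi\Sigma\Pi$) formula computes a polynomial of the form $f=\sum_{i=1}^{s}\prod_{j=1}^{d_i}Q_{i,j}$ where each $Q_{i,j}$ is a polynomial over a field $\mathbb F$ given as a sum of monomials (computed by the bottom $\Sigma\Pi$ layers); it is multilinear if every gate computes a multilinear polynomial (in particular, in each product gate the $Q_{i,j}$ are supported on pairwise disjoint sets of variables). The size is the number of gates. A hitting set for a class $\mathcal C$ of $n$-variate polynomials is a set $\mathcal H\subseteq\mathbb F^n$ such that every nonzero polynomial in $\mathcal C$ is nonzero at some point of $\mathcal H$. $\tilde O$ hides polylogarithmic factors in $n$. Standing assumption: for formulas of size $2^{n^\delta}$, $|\mathbb F|\ge 2^{n^{2\delta}\mathrm{polylog}(n)}$, or points may be taken from an extension field of that size. *)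

theory Defs
  imports "HOL-Algebra.Indexed_Polynomials" "HOL-Library.Landau_Symbols"
begin

section \<open>Multivariate polynomials\<close>

text \<open>
  As in \<^theory>\<open>HOL-Algebra.Indexed_Polynomials\<close>, a polynomial is its coefficient function on
  monomials, a monomial being a multiset of variable indices. That theory has constants,
  variables and addition, but neither multiplication nor evaluation in several variables.
\<close>

type_synonym 'a mpol = "nat multiset \<Rightarrow> 'a"

context ring
begin

definition mpol_mult :: "'a mpol \<Rightarrow> 'a mpol \<Rightarrow> 'a mpol" where
  "mpol_mult P Q = (\<lambda>m. \<Oplus>u\<in>{u. u \<subseteq># m}. P u \<otimes> Q (m - u))"

definition mpol_sum :: "'a mpol list \<Rightarrow> 'a mpol" where
  "mpol_sum Ps = foldr indexed_padd Ps (indexed_const \<zero>)"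

definition mpol_prod :: "'a mpol list \<Rightarrow> 'a mpol" where
  "mpol_prod Ps = foldr mpol_mult Ps (indexed_const \<one>)"

text \<open>The sum ranges over the support, which is finite for every polynomial used below.\<close>

definition mpol_eval :: "'a mpol \<Rightarrow> 'a list \<Rightarrow> 'a" where
  "mpol_eval P x = (\<Oplus>m\<in>{m. P m \<noteq> \<zero>}. P m \<otimes> finprod R (\<lambda>i. (x ! i) [^] count m i) (set_mset m))"

definition multilinear :: "'a mpol \<Rightarrow> bool" where
  "multilinear P \<longleftrightarrow> (\<forall>m. P m \<noteq> \<zero> \<longrightarrow> (\<forall>i. count m i \<le> 1))"

text \<open>Polynomials are compared with zero as formal objects, not as functions on points.\<close>

definition hitting_set :: "nat \<Rightarrow> 'a mpol set \<Rightarrow> 'a list set \<Rightarrow> bool" where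
  "hitting_set n C H \<longleftrightarrow>
     H \<subseteq> {x. length x = n \<and> set x \<subseteq> carrier R} \<and>
     (\<forall>P\<in>C. P \<noteq> indexed_const \<zero> \<longrightarrow> (\<exists>x\<in>H. mpol_eval P x \<noteq> \<zero>))"

end


section \<open>Depth-4 formulas\<close>

text \<open>
  Each list level is one layer of gates, from the output down: sum, product, sum, product.
  A bottom product gate multiplies input gates, so that it computes a monomial with a coefficient.
\<close>

datatype 'a input_gate = Var nat | Const 'a

type_synonym 'a p_gate = "'a input_gate list"
type_synonym 'a sp_gate = "'a p_gate list"
type_synonym 'a psp_gate = "'a sp_gate list"
type_synonym 'a spsp_formula = "'a psp_gate list"

fun wf_input :: "'a set \<Rightarrow> nat \<Rightarrow> 'a input_gate \<Rightarrow> bool" where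
  "wf_input K n (Var i) \<longleftrightarrow> i < n"
| "wf_input K n (Const c) \<longleftrightarrow> c \<in> K"

definition wf_spsp :: "'a set \<Rightarrow> nat \<Rightarrow> 'a spsp_formula \<Rightarrow> bool" where
  "wf_spsp K n f \<longleftrightarrow> (\<forall>T\<in>set f. \<forall>Q\<in>set T. \<forall>M\<in>set Q. \<forall>g\<in>set M. wf_input K n g)"

text \<open>All gates are counted, the input gates included.\<close>

definition spsp_size :: "'a spsp_formula \<Rightarrow> nat" where
  "spsp_size f = 1 + (\<Sum>T\<leftarrow>f. 1 + (\<Sum>Q\<leftarrow>T. 1 + (\<Sum>M\<leftarrow>Q. 1 + length M)))"

context ring
begin

fun input_poly :: "'a input_gate \<Rightarrow> 'a mpol" where
  "input_poly (Var i) = indexed_var i"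
| "input_poly (Const c) = indexed_const c"

definition p_poly :: "'a p_gate \<Rightarrow> 'a mpol" where
  "p_poly M = mpol_prod (map input_poly M)"

definition sp_poly :: "'a sp_gate \<Rightarrow> 'a mpol" where
  "sp_poly Q = mpol_sum (map p_poly Q)"

definition psp_poly :: "'a psp_gate \<Rightarrow> 'a mpol" where
  "psp_poly T = mpol_prod (map sp_poly T)"

definition spsp_poly :: "'a spsp_formula \<Rightarrow> 'a mpol" where
  "spsp_poly f = mpol_sum (map psp_poly f)"

text \<open>Input gates are multilinear and need no clause.\<close>

definition multilinear_spsp :: "'a spsp_formula \<Rightarrow> bool" where
  "multilinear_spsp f \<longleftrightarrow>
     multilinear (spsp_poly f) \<and>
     (\<forall>T\<in>set f. multilinear (psp_poly T) \<and>
       (\<forall>Q\<in>set T. multilinear (sp_poly Q) \<and>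
         (\<forall>M\<in>set Q. multilinear (p_poly M))))"

definition multilinear_spsp_class :: "'a set \<Rightarrow> nat \<Rightarrow> real \<Rightarrow> 'a mpol set" where
  "multilinear_spsp_class K n s =
     {spsp_poly f | f. wf_spsp K n f \<and> multilinear_spsp f \<and> real (spsp_size f) \<le> s}"

end


section \<open>Soft-O\<close>

definition soft_O :: "(nat \<Rightarrow> real) \<Rightarrow> (nat \<Rightarrow> real) set" where
  "soft_O f = {g. \<exists>k::nat. g \<in> O(\<lambda>n. f n * ln (real n) ^ k)}"


section \<open>Construction time\<close>

text \<open>
  Time is measured on a random access machine over a field: one memory of natural numbers, one
  memory of field elements, and structured control. Field operations and zero tests have unit cost.
  Arithmetic on natural numbers is restricted to constants, addition and truncated subtraction, so
  that \<open>t\<close> steps only produce numbers of \<open>O(t)\<close> bits and unit cost is polynomially equivalent to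
  bit cost.

  Over an abstract field the constants 0 and 1 do not suffice to produce many distinct elements,
  whereas every hitting set construction needs them. The machine therefore has access to an
  enumeration \<open>e\<close> of the field, which is part of the presentation of the field and
  which programs cannot choose.

  Field operands are addressed indirectly, through registers.
\<close>

definition field_enum :: "('a, 'b) ring_scheme \<Rightarrow> (nat \<Rightarrow> 'a) \<Rightarrow> bool" where
  "field_enum R e \<longleftrightarrow> range e \<subseteq> carrier R \<and>
     (if finite (carrier R) then bij_betw e {..<card (carrier R)} (carrier R) else inj e)"

datatype instr =
    SetN nat nat
  | AddN nat nat nat
  | SubN nat nat nat
  | LoadN nat nat
  | StoreN nat nat
  | ZeroF nat
  | OneF nat
  | EnumF nat nat
  | AddF nat nat nat
  | SubF nat nat nat
  | MulF nat nat nat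
  | InvF nat nat

datatype prog =
    Do instr
  | Then prog prog
  | IfN nat prog prog
  | IfF nat prog prog
  | WhileN nat prog

type_synonym 'a state = "(nat \<Rightarrow> nat) \<times> (nat \<Rightarrow> 'a)"

fun exec_instr :: "('a, 'b) ring_scheme \<Rightarrow> (nat \<Rightarrow> 'a) \<Rightarrow> instr \<Rightarrow> 'a state \<Rightarrow> 'a state" where
  "exec_instr R e (SetN r k) (\<nu>, \<phi>) = (\<nu>(r := k), \<phi>)"
| "exec_instr R e (AddN r a b) (\<nu>, \<phi>) = (\<nu>(r := \<nu> a + \<nu> b), \<phi>)"
| "exec_instr R e (SubN r a b) (\<nu>, \<phi>) = (\<nu>(r := \<nu> a - \<nu> b), \<phi>)"
| "exec_instr R e (LoadN r a) (\<nu>, \<phi>) = (\<nu>(r := \<nu> (\<nu> a)), \<phi>)"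
| "exec_instr R e (StoreN r a) (\<nu>, \<phi>) = (\<nu>(\<nu> r := \<nu> a), \<phi>)"
| "exec_instr R e (ZeroF r) (\<nu>, \<phi>) = (\<nu>, \<phi>(\<nu> r := \<zero>\<^bsub>R\<^esub>))"
| "exec_instr R e (OneF r) (\<nu>, \<phi>) = (\<nu>, \<phi>(\<nu> r := \<one>\<^bsub>R\<^esub>))"
| "exec_instr R e (EnumF r a) (\<nu>, \<phi>) = (\<nu>, \<phi>(\<nu> r := e (\<nu> a)))"
| "exec_instr R e (AddF r a b) (\<nu>, \<phi>) = (\<nu>, \<phi>(\<nu> r := \<phi> (\<nu> a) \<oplus>\<^bsub>R\<^esub> \<phi> (\<nu> b)))"
| "exec_instr R e (SubF r a b) (\<nu>, \<phi>) = (\<nu>, \<phi>(\<nu> r := \<phi> (\<nu> a) \<ominus>\<^bsub>R\<^esub> \<phi> (\<nu> b)))"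
| "exec_instr R e (MulF r a b) (\<nu>, \<phi>) = (\<nu>, \<phi>(\<nu> r := \<phi> (\<nu> a) \<otimes>\<^bsub>R\<^esub> \<phi> (\<nu> b)))"
| "exec_instr R e (InvF r a) (\<nu>, \<phi>) =
     (\<nu>, \<phi>(\<nu> r := (if \<phi> (\<nu> a) = \<zero>\<^bsub>R\<^esub> then \<zero>\<^bsub>R\<^esub> else inv\<^bsub>R\<^esub> \<phi> (\<nu> a))))"

text \<open>\<open>run R e p s t s'\<close>: started in state \<open>s\<close>, \<open>p\<close> halts in state \<open>s'\<close> after exactly \<open>t\<close> steps.\<close>

inductive run ::
    "('a, 'b) ring_scheme \<Rightarrow> (nat \<Rightarrow> 'a) \<Rightarrow> prog \<Rightarrow> 'a state \<Rightarrow> nat \<Rightarrow> 'a state \<Rightarrow> bool"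
  for R :: "('a, 'b) ring_scheme" and e :: "nat \<Rightarrow> 'a" where
  Do: "run R e (Do i) s 1 (exec_instr R e i s)"
| Then: "run R e p s t s' \<Longrightarrow> run R e p' s' t' s'' \<Longrightarrow> run R e (Then p p') s (t + t') s''"
| IfN_pos: "fst s r \<noteq> 0 \<Longrightarrow> run R e p s t s' \<Longrightarrow> run R e (IfN r p p') s (1 + t) s'"
| IfN_zero: "fst s r = 0 \<Longrightarrow> run R e p' s t s' \<Longrightarrow> run R e (IfN r p p') s (1 + t) s'"
| IfF_nonzero: "snd s (fst s r) \<noteq> \<zero>\<^bsub>R\<^esub> \<Longrightarrow> run R e p s t s' \<Longrightarrow> run R e (IfF r p p') s (1 + t) s'"
| IfF_zero: "snd s (fst s r) = \<zero>\<^bsub>R\<^esub> \<Longrightarrow> run R e p' s t s' \<Longrightarrow> run R e (IfF r p p') s (1 + t) s'"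
| WhileN_stop: "fst s r = 0 \<Longrightarrow> run R e (WhileN r p) s 1 s"
| WhileN_loop: "fst s r \<noteq> 0 \<Longrightarrow> run R e p s t s' \<Longrightarrow> run R e (WhileN r p) s' t' s'' \<Longrightarrow>
    run R e (WhileN r p) s (1 + t + t') s''"

inductive_cases run_DoE: "run R e (Do i) s t s'"
inductive_cases run_ThenE: "run R e (Then p p') s t s'"
inductive_cases run_IfNE: "run R e (IfN r p p') s t s'"
inductive_cases run_IfFE: "run R e (IfF r p p') s t s'"
inductive_cases run_WhileNE: "run R e (WhileN r p) s t s'"

lemma run_deterministic:
  assumes "run R e p s t s'" "run R e p s u s''"
  shows "u = t \<and> s'' = s'"
  using assms
proof (induction arbitrary: u s'' rule: run.induct)
  case (Do i s)
  then show ?case by - (erule run_DoE, simp)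
next
  case (Then p s t s' p' t' s'')
  from Then.prems show ?case by - (erule run_ThenE, metis Then.IH)
next
  case (IfN_pos s r p t s' p')
  from IfN_pos.prems show ?case 
    by - (erule run_IfNE, simp_all add: IfN_pos.hyps(1), drule IfN_pos.IH, simp)
next
  case (IfN_zero s r p' t s' p)
  from IfN_zero.prems show ?case 
    by - (erule run_IfNE, simp_all add: IfN_zero.hyps(1), drule IfN_zero.IH, simp)
next
  case (IfF_nonzero s r p t s' p')
  from IfF_nonzero.prems show ?case 
    by - (erule run_IfFE, simp_all add: IfF_nonzero.hyps(1), drule IfF_nonzero.IH, simp)
next
  case (IfF_zero s r p' t s' p)
  from IfF_zero.prems show ?case 
    by - (erule run_IfFE, simp_all add: IfF_zero.hyps(1), drule IfF_zero.IH, simp)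
next
  case (WhileN_stop s r p)
  from WhileN_stop.prems show ?case by - (erule run_WhileNE, simp_all add: WhileN_stop.hyps)
next
  case (WhileN_loop s r p t s' t' s'')
  from WhileN_loop.prems show ?case
    by - (erule run_WhileNE, simp add: WhileN_loop.hyps, drule WhileN_loop.IH(1), erule conjE,
        simp, drule WhileN_loop.IH(2), simp)
qed

text \<open>
  The inputs \<open>n\<close> and \<open>k\<close> are placed in registers 0 and 1. On halting, register 0 holds the number of
  points, and these are stored one after the other in the field memory, with \<open>n\<close> cells each.
\<close>

definition initial_state :: "('a, 'b) ring_scheme \<Rightarrow> nat \<Rightarrow> nat \<Rightarrow> 'a state" where
  "initial_state R n k = ((\<lambda>_. 0)(0 := n, 1 := k), \<lambda>_. \<zero>\<^bsub>R\<^esub>)"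

definition output_points :: "nat \<Rightarrow> 'a state \<Rightarrow> 'a list set" where
  "output_points n s = (\<lambda>i. map (\<lambda>j. snd s (i * n + j)) [0..<n]) ` {..<fst s 0}"

definition constructs ::
    "('a, 'b) ring_scheme \<Rightarrow> (nat \<Rightarrow> 'a) \<Rightarrow> prog \<Rightarrow> nat \<Rightarrow> nat \<Rightarrow> 'a list set \<Rightarrow> nat \<Rightarrow> bool" where
  "constructs R e p n k H t \<longleftrightarrow> (\<exists>s. run R e p (initial_state R n k) t s \<and> H = output_points n s)"

end

theory Submission
  imports Defs "HOL-Analysis.Poly_Roots" "HOL-Computational_Algebra.Primes" "HOL-Library.Nat_Bijection"
begin

text \<open>
  Setting a variable to zero or differentiating with respect to it shrinks the sums of many variables,
  and after about \<open>n ^ (2/3) * K\<close> steps, \<open>2 ^ K\<close> bounding the size, a nonzero formula has become one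
  whose sums have at most \<open>n ^ (1/3)\<close> variables each. A polynomial hash function then partitions the
  variables into \<open>3 * n ^ (2/3)\<close> parts such that in every product gate few variables share a sum with
  another variable of their part. On the variables of one part the formula therefore has small rank,
  and rank concentration applies: after a generic shift it has a nonzero coefficient on a monomial of
  few variables. A polynomial curve of degree proportional to \<open>K + log n\<close> provides the shift, since it
  interpolates arbitrary values on the few variables that matter at a time. Guessing the hash
  function, the curves and the variables that are shifted by 1 takes about \<open>n ^ (2/3 + \<delta>)\<close> digits of
  size polynomial in \<open>n\<close>.
\<close>

section \<open>Rings with a distinguished prime ideal\<close>

text \<open>The exponent 2/3 balances two costs. With sums of at most \<open>u\<close> variables the
  reduction takes about \<open>n / u * K\<close> steps, while collisions become rare once the number
  of parts is of order \<open>sqrt (n * u)\<close>; up to \<open>K\<close> the two agree for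
  \<open>u\<close> near the cube root of \<open>n\<close>.

  The curves are the delicate point. A curve of \<open>L\<close> coefficients has to satisfy one
  condition for each of up to \<open>n ^ L\<close> sets of variables, and avoiding the zeros of all
  of them takes more than \<open>L * n ^ L\<close> field elements. This is an existence argument
  only: once one good point is known, the formula has degree at most \<open>n\<close> in each
  coefficient, so the coefficients can be moved one at a time into a fixed set of more than
  \<open>n\<close> elements. Hence the field must be large although every digit ranges over
  polynomially many values.

  The variables shifted by 1 in the reduction and those selecting a nonzero vertex within the parts
  merge into a single set of positions. Throughout, \<open>nz\<close> means being nonzero in the
  field under consideration, expressed in a ring as lying outside a prime ideal.\<close>

locale prime_compl =
  fixes nz :: "'r::comm_ring_1 \<Rightarrow> bool"
  assumes nz_1: "nz 1"
    and nz_0: "\<not> nz 0"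
    and nz_mult: "nz (x * y) \<longleftrightarrow> nz x \<and> nz y"
    and nz_add: "\<not> nz x \<Longrightarrow> \<not> nz y \<Longrightarrow> \<not> nz (x + y)"
begin

lemma nz_minus: "nz (- x) \<longleftrightarrow> nz x"
proof -
  have "nz ((- 1) * (- 1))" using nz_1 by simp
  then have "nz (- 1)" using nz_mult by blast
  then show ?thesis using nz_mult[of "- 1" x] by simp
qed

lemma nz_diff: "\<not> nz x \<Longrightarrow> \<not> nz y \<Longrightarrow> \<not> nz (x - y)"
  using nz_add[of x "- y"] by (simp add: nz_minus)

lemma nz_add_iff: "\<not> nz y \<Longrightarrow> nz (x + y) \<longleftrightarrow> nz x"
  using nz_add[of x y] nz_diff[of "x + y" y] by auto

lemma nz_sum: "(\<And>i. i \<in> A \<Longrightarrow> \<not> nz (f i)) \<Longrightarrow> \<not> nz (sum f A)"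
  by (induction A rule: infinite_finite_induct) (auto simp: nz_0 nz_add)

lemma nz_prod: "finite A \<Longrightarrow> nz (prod f A) \<longleftrightarrow> (\<forall>i\<in>A. nz (f i))"
  by (induction A rule: finite_induct) (auto simp: nz_1 nz_mult)

lemma nz_sum_list: "(\<And>x. x \<in> set xs \<Longrightarrow> \<not> nz (f x)) \<Longrightarrow> \<not> nz (sum_list (map f xs))"
  by (induction xs) (auto simp: nz_0 nz_add)

text \<open>Pairwise incongruent modulo the prime ideal, which takes the place of distinctness when
  roots are counted.\<close>

definition separated :: "'r set \<Rightarrow> bool" where
  "separated S \<longleftrightarrow> (\<forall>x\<in>S. \<forall>y\<in>S. x \<noteq> y \<longrightarrow> nz (x - y))"

end

text \<open>Polynomial functions of degree at most \<open>d\<close>, in the form of iterated divided differences: over a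
  ring a function does not determine coefficients, and this form is all that root counting needs.\<close>

primrec polyfun :: "nat \<Rightarrow> ('r::comm_ring_1 \<Rightarrow> 'r) set" where
  "polyfun 0 = {\<phi>. \<exists>c. \<phi> = (\<lambda>_. c)}"
| "polyfun (Suc d) = {\<phi>. \<forall>a. \<exists>\<psi>\<in>polyfun d. \<forall>z. \<phi> z = \<phi> a + (z - a) * \<psi> z}"

lemma polyfun_SucI:
  assumes "\<And>a. \<psi> a \<in> polyfun d" "\<And>a z. \<phi> z = \<phi> a + (z - a) * \<psi> a z"
  shows "\<phi> \<in> polyfun (Suc d)"
  unfolding polyfun.simps using assms by blast

lemma polyfun_SucD:
  assumes "\<phi> \<in> polyfun (Suc d)"
  shows "\<exists>\<psi>. (\<forall>a. \<psi> a \<in> polyfun d) \<and> (\<forall>a z. \<phi> z = \<phi> a + (z - a) * \<psi> a z)"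
proof -
  have "\<forall>a. \<exists>\<psi>. \<psi> \<in> polyfun d \<and> (\<forall>z. \<phi> z = \<phi> a + (z - a) * \<psi> z)"
    using assms by auto
  from choice[OF this] show ?thesis by blast
qed

lemma polyfun_const: "(\<lambda>_. c) \<in> polyfun d"
proof (induction d arbitrary: c)
  case (Suc d)
  show ?case using Suc[of 0] by (auto intro!: bexI[of _ "\<lambda>_. 0"])
qed auto

lemma polyfun_add: "\<phi> \<in> polyfun d \<Longrightarrow> \<psi> \<in> polyfun d \<Longrightarrow> (\<lambda>z. \<phi> z + \<psi> z) \<in> polyfun d"
proof (induction d arbitrary: \<phi> \<psi>)
  case (Suc d)
  obtain \<phi>' where 1: "\<And>a. \<phi>' a \<in> polyfun d" "\<And>a z. \<phi> z = \<phi> a + (z - a) * \<phi>' a z"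
    using polyfun_SucD Suc.prems(1) by blast
  obtain \<psi>' where 2: "\<And>a. \<psi>' a \<in> polyfun d" "\<And>a z. \<psi> z = \<psi> a + (z - a) * \<psi>' a z"
    using polyfun_SucD Suc.prems(2) by blast
  show ?case
  proof (rule polyfun_SucI)
    show "(\<lambda>z. \<phi>' a z + \<psi>' a z) \<in> polyfun d" for a
      using Suc.IH[OF 1(1) 2(1)] .
    show "\<phi> z + \<psi> z = \<phi> a + \<psi> a + (z - a) * (\<phi>' a z + \<psi>' a z)" for a z
      using 1(2)[of z a] 2(2)[of z a] by (simp add: distrib_left)
  qed
qed auto

lemma polyfun_cmult: "\<phi> \<in> polyfun d \<Longrightarrow> (\<lambda>z. c * \<phi> z) \<in> polyfun d"
proof (induction d arbitrary: \<phi>)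
  case (Suc d)
  obtain \<phi>' where 1: "\<And>a. \<phi>' a \<in> polyfun d" "\<And>a z. \<phi> z = \<phi> a + (z - a) * \<phi>' a z"
    using polyfun_SucD Suc.prems by blast
  show ?case
  proof (rule polyfun_SucI)
    show "(\<lambda>z. c * \<phi>' a z) \<in> polyfun d" for a
      using Suc.IH[OF 1(1)] .
    have "c * (\<phi> a + (z - a) * \<phi>' a z) = c * \<phi> a + (z - a) * (c * \<phi>' a z)" for a z
      by (simp add: algebra_simps)
    then show "c * \<phi> z = c * \<phi> a + (z - a) * (c * \<phi>' a z)" for a z
      using 1(2)[of z a] by metis
  qed
qed auto

lemma polyfun_sum:
  "(\<And>i. i \<in> A \<Longrightarrow> \<phi> i \<in> polyfun d) \<Longrightarrow> (\<lambda>z. \<Sum>i\<in>A. \<phi> i z) \<in> polyfun d"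
proof (induction A rule: infinite_finite_induct)
  case (insert x A)
  then show ?case using polyfun_add[of "\<phi> x" d "\<lambda>z. \<Sum>i\<in>A. \<phi> i z"] by simp
qed (auto simp: polyfun_const)

lemma polyfun_affine_mult: "\<phi> \<in> polyfun d \<Longrightarrow> (\<lambda>z. (a + b * z) * \<phi> z) \<in> polyfun (Suc d)"
proof (induction d arbitrary: \<phi>)
  case 0
  then obtain c where c: "\<phi> = (\<lambda>_. c)" by auto
  show ?case
    by (rule polyfun_SucI[of "\<lambda>_ _. b * c"]) (auto simp: c algebra_simps)
next
  case (Suc d)
  obtain \<psi> where 1: "\<And>w. \<psi> w \<in> polyfun d" "\<And>w z. \<phi> z = \<phi> w + (z - w) * \<psi> w z"
    using polyfun_SucD Suc.prems by blast
  show ?case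
  proof (rule polyfun_SucI)
    \<comment> \<open>The product rule for divided differences at \<open>w\<close>.\<close>
    show "(\<lambda>z. (a + b * z) * \<psi> w z + b * \<phi> w) \<in> polyfun (Suc d)" for w
      by (intro polyfun_add Suc.IH 1(1) polyfun_const)
    have "(a + b * z) * (\<phi> w + (z - w) * \<psi> w z) =
        (a + b * w) * \<phi> w + (z - w) * ((a + b * z) * \<psi> w z + b * \<phi> w)" for w z
      by (simp add: algebra_simps)
    then show "(a + b * z) * \<phi> z =
        (a + b * w) * \<phi> w + (z - w) * ((a + b * z) * \<psi> w z + b * \<phi> w)" for w z
      using 1(2)[of z w] by metis
  qed
qed

lemma polyfun_prod_affine:
  "finite A \<Longrightarrow> (\<lambda>z. \<Prod>j\<in>A. a j + b j * z) \<in> polyfun (card A)"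
proof (induction A rule: finite_induct)
  case (insert x A)
  then show ?case using polyfun_affine_mult[of "\<lambda>z. \<Prod>j\<in>A. a j + b j * z" "card A" "a x" "b x"]
    by simp
qed (auto simp: polyfun_const)

section \<open>Root counting and elimination modulo the prime ideal\<close>

context prime_compl
begin

text \<open>Splitting off a root \<open>a\<close> in \<open>S\<close> leaves a divided difference of
  smaller degree; primality makes every other root in \<open>S\<close> a root of it, because
  differences within \<open>S\<close> lie outside the ideal. The witness \<open>w\<close> may lie
  outside \<open>S\<close>.\<close>

lemma polyfun_roots:
  assumes "\<phi> \<in> polyfun d" "nz (\<phi> w)" "finite S" "separated S"
  shows "card {z\<in>S. \<not> nz (\<phi> z)} \<le> d"
  using assms(1,2)
proof (induction d arbitrary: \<phi>)
  case 0
  then have "{z\<in>S. \<not> nz (\<phi> z)} = {}" by auto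
  then show ?case by (metis card.empty le_refl)
next
  case (Suc d)
  show ?case
  proof (cases "\<exists>a\<in>S. \<not> nz (\<phi> a)")
    case True
    then obtain a where a: "a \<in> S" "\<not> nz (\<phi> a)" by blast
    obtain \<psi> where *: "\<psi> \<in> polyfun d" "\<And>z. \<phi> z = \<phi> a + (z - a) * \<psi> z"
      using polyfun_SucD Suc.prems(1) by blast
    have eq: "nz (\<phi> z) \<longleftrightarrow> nz (z - a) \<and> nz (\<psi> z)" for z
      using nz_add_iff[OF a(2), of "(z - a) * \<psi> z"] *(2)[of z] by (simp add: nz_mult add.commute)
    have "{z\<in>S. \<not> nz (\<phi> z)} \<subseteq> insert a {z\<in>S. \<not> nz (\<psi> z)}"
      using eq assms(4) a(1) unfolding separated_def by auto
    then have "card {z\<in>S. \<not> nz (\<phi> z)} \<le> card (insert a {z\<in>S. \<not> nz (\<psi> z)})"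
      using assms(3) by (intro card_mono) auto
    also have "\<dots> \<le> Suc (card {z\<in>S. \<not> nz (\<psi> z)})" by (rule card_insert_le_m1) auto
    also have "card {z\<in>S. \<not> nz (\<psi> z)} \<le> d"
      using Suc.IH[OF *(1)] Suc.prems(2) eq by blast
    finally show ?thesis by simp
  next
    case False
    then have "{z\<in>S. \<not> nz (\<phi> z)} = {}" by auto
    then show ?thesis by (metis card.empty le0)
  qed
qed

text \<open>Gaussian elimination without division. A pivot in row \<open>i\<close> outside the ideal
  removes one unknown and one row by cross-multiplication; without such a pivot every
  \<open>\<kappa>\<close> satisfies row \<open>i\<close>.\<close>

lemma linear_dependence:
  assumes "finite I" "finite E" "card I < card E"
  shows "\<exists>\<kappa>. (\<exists>\<epsilon>\<in>E. nz (\<kappa> \<epsilon>)) \<and> (\<forall>i\<in>I. \<not> nz (\<Sum>\<epsilon>\<in>E. A i \<epsilon> * \<kappa> \<epsilon>))"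
  using assms
proof (induction I arbitrary: E A rule: finite_induct)
  case empty
  then have "E \<noteq> {}" by auto
  then show ?case using nz_1 by (intro exI[of _ "\<lambda>_. 1"]) auto
next
  case (insert i I)
  show ?case
  proof (cases "\<exists>p\<in>E. nz (A i p)")
    case True
    then obtain p where p: "p \<in> E" "nz (A i p)" by blast
    define E' where "E' = E - {p}"
    have E': "E = insert p E'" "p \<notin> E'" "finite E'" using p insert.prems by (auto simp: E'_def)
    have "card I < card E'" using insert E' by simp
    then obtain \<mu> where \<mu>: "\<exists>\<epsilon>\<in>E'. nz (\<mu> \<epsilon>)"
      "\<forall>k\<in>I. \<not> nz (\<Sum>\<epsilon>\<in>E'. (A k \<epsilon> * A i p - A k p * A i \<epsilon>) * \<mu> \<epsilon>)"
      using insert.IH[OF E'(3), of "\<lambda>k \<epsilon>. A k \<epsilon> * A i p - A k p * A i \<epsilon>"] by auto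
    \<comment> \<open>Scaling the other unknowns by the pivot allows solving row \<open>i\<close>
      for the unknown at \<open>p\<close>. Scaling by \<open>A i p\<close> keeps a nonzero unknown
      nonzero.\<close>
    define \<kappa> where "\<kappa> \<epsilon> = (if \<epsilon> = p then - (\<Sum>\<epsilon>\<in>E'. A i \<epsilon> * \<mu> \<epsilon>) else A i p * \<mu> \<epsilon>)" for \<epsilon>
    have S: "(\<Sum>\<epsilon>\<in>E. A k \<epsilon> * \<kappa> \<epsilon>) = (\<Sum>\<epsilon>\<in>E'. (A k \<epsilon> * A i p - A k p * A i \<epsilon>) * \<mu> \<epsilon>)" for k
    proof -
      have "(\<Sum>\<epsilon>\<in>E. A k \<epsilon> * \<kappa> \<epsilon>) = A k p * \<kappa> p + (\<Sum>\<epsilon>\<in>E'. A k \<epsilon> * \<kappa> \<epsilon>)"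
        using E' by simp
      also have "(\<Sum>\<epsilon>\<in>E'. A k \<epsilon> * \<kappa> \<epsilon>) = (\<Sum>\<epsilon>\<in>E'. A k \<epsilon> * (A i p * \<mu> \<epsilon>))"
        using E'(2) by (intro sum.cong) (auto simp: \<kappa>_def)
      finally show ?thesis
        by (simp add: \<kappa>_def sum_distrib_left sum_subtractf sum_distrib_right sum_negf algebra_simps)
    qed
    have "\<not> nz (\<Sum>\<epsilon>\<in>E. A i \<epsilon> * \<kappa> \<epsilon>)"
      unfolding S by (rule nz_sum) (simp add: algebra_simps nz_0)
    moreover have "\<exists>\<epsilon>\<in>E. nz (\<kappa> \<epsilon>)"
      using \<mu>(1) E' p(2) by (auto simp: \<kappa>_def nz_mult)
    ultimately show ?thesis using \<mu>(2) S by (intro exI[of _ \<kappa>]) auto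
  next
    case False
    have "card I < card E" using insert by simp
    then obtain \<kappa> where \<kappa>: "\<exists>\<epsilon>\<in>E. nz (\<kappa> \<epsilon>)" "\<forall>k\<in>I. \<not> nz (\<Sum>\<epsilon>\<in>E. A k \<epsilon> * \<kappa> \<epsilon>)"
      using insert.IH[OF insert.prems(1), of A] by auto
    moreover have "\<not> nz (\<Sum>\<epsilon>\<in>E. A i \<epsilon> * \<kappa> \<epsilon>)"
      using False by (intro nz_sum) (auto simp: nz_mult)
    ultimately show ?thesis by (intro exI[of _ \<kappa>]) auto
  qed
qed

end

section \<open>Functions affine in each variable\<close>

definition override :: "nat set \<Rightarrow> (nat \<Rightarrow> 'r) \<Rightarrow> (nat \<Rightarrow> 'r) \<Rightarrow> nat \<Rightarrow> 'r" where
  "override T z x = (\<lambda>i. if i \<in> T then z i else x i)"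

abbreviation ind :: "nat set \<Rightarrow> nat \<Rightarrow> 'r::comm_ring_1" where
  "ind U \<equiv> (\<lambda>i. if i \<in> U then 1 else 0)"

abbreviation shift :: "(nat \<Rightarrow> 'r::comm_ring_1) \<Rightarrow> nat set \<Rightarrow> nat \<Rightarrow> 'r" where
  "shift x B \<equiv> (\<lambda>i. x i + ind B i)"

definition multiaffine :: "nat set \<Rightarrow> ((nat \<Rightarrow> 'r) \<Rightarrow> 'r::comm_ring_1) \<Rightarrow> bool" where
  "multiaffine V f \<longleftrightarrow>
     (\<forall>x. \<forall>v\<in>V. \<forall>z. f (x(v := z)) = f (x(v := 0)) + z * (f (x(v := 1)) - f (x(v := 0))))"

lemma multiaffine_subset: "multiaffine V f \<Longrightarrow> U \<subseteq> V \<Longrightarrow> multiaffine U f"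
  by (auto simp: multiaffine_def)

lemma sum_Pow_insert:
  assumes "finite T" "v \<notin> T"
  shows "(\<Sum>W\<in>Pow (insert v T). h W) = (\<Sum>W\<in>Pow T. h W + h (insert v W))"
proof -
  have "(\<Sum>W\<in>Pow (insert v T). h W) = (\<Sum>W\<in>Pow T. h W) + (\<Sum>W\<in>insert v ` Pow T. h W)"
    unfolding Pow_insert using assms by (intro sum.union_disjoint) auto
  also have "(\<Sum>W\<in>insert v ` Pow T. h W) = (\<Sum>W\<in>Pow T. h (insert v W))"
    using assms by (subst sum.reindex) (auto simp: inj_on_def insert_ident)
  finally show ?thesis by (simp add: sum.distrib)
qed

text \<open>Interpolation on the vertices of the cube from \<open>\<alpha>\<close> to
  \<open>\<alpha> + 1\<close>. The two nodes of each coordinate differ by 1, so the basis functions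
  \<open>1 - (z j - \<alpha> j)\<close> and \<open>z j - \<alpha> j\<close> need no
  division.\<close>

lemma multiaffine_interpolation:
  fixes f :: "(nat \<Rightarrow> 'r) \<Rightarrow> 'r::comm_ring_1"
  assumes "finite T" "multiaffine T f"
  shows "f (override T z x) = (\<Sum>W\<in>Pow T. f (override T (shift \<alpha> W) x) *
           (\<Prod>j\<in>T. if j \<in> W then z j - \<alpha> j else 1 - (z j - \<alpha> j)))"
  using assms
proof (induction T arbitrary: x rule: finite_induct)
  case empty
  then show ?case by (simp add: override_def)
next
  case (insert v T)
  have aff: "f (y(v := c)) = f (y(v := a)) * (1 - (c - a)) + f (y(v := a + 1)) * (c - a)" for y a c
  proof -
    have 1: "f (y(v := u)) = f (y(v := 0)) + u * (f (y(v := 1)) - f (y(v := 0)))" for u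
      using insert.prems unfolding multiaffine_def by blast
    show ?thesis by (subst (1 2 3) 1) (simp add: algebra_simps)
  qed
  have upd: "override (insert v T) s x = (override T s x)(v := s v)" for s :: "nat \<Rightarrow> 'r"
    by (auto simp: override_def)
  have upd': "(override T s x)(v := c) = override T s (x(v := c))" for s :: "nat \<Rightarrow> 'r" and c
    using insert.hyps by (auto simp: override_def)
  have IH: "f (override T z y) = (\<Sum>W\<in>Pow T. f (override T (shift \<alpha> W) y) *
           (\<Prod>j\<in>T. if j \<in> W then z j - \<alpha> j else 1 - (z j - \<alpha> j)))" for y
    using insert.IH insert.prems multiaffine_subset by blast
  let ?P = "\<lambda>W. \<Prod>j\<in>T. if j \<in> W then z j - \<alpha> j else 1 - (z j - \<alpha> j)"
  have P: "?P (insert v W) = ?P W" for W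
    using insert.hyps by (intro prod.cong) auto
  have ov: "override (insert v T) (shift \<alpha> W) x = override T (shift \<alpha> W) (x(v := \<alpha> v))"
    "override (insert v T) (shift \<alpha> (insert v W)) x = override T (shift \<alpha> W) (x(v := \<alpha> v + 1))"
    if "W \<in> Pow T" for W
    using that insert.hyps by (auto simp: override_def fun_eq_iff)
  have vW: "v \<notin> W" if "W \<in> Pow T" for W using that insert.hyps by auto
  have "f (override (insert v T) z x) =
      f (override T z (x(v := \<alpha> v))) * (1 - (z v - \<alpha> v)) +
      f (override T z (x(v := \<alpha> v + 1))) * (z v - \<alpha> v)"
    unfolding upd by (subst aff[of _ _ "\<alpha> v"]) (simp add: upd')
  also have "\<dots> = (\<Sum>W\<in>Pow T.
      f (override (insert v T) (shift \<alpha> W) x) * ((1 - (z v - \<alpha> v)) * ?P W) +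
      f (override (insert v T) (shift \<alpha> (insert v W)) x) * ((z v - \<alpha> v) * ?P (insert v W)))"
    unfolding IH P sum_distrib_right sum.distrib[symmetric]
    by (rule sum.cong[OF refl]) (simp only: ov, simp add: algebra_simps)
  also have "\<dots> = (\<Sum>W\<in>Pow (insert v T). f (override (insert v T) (shift \<alpha> W) x) *
           (\<Prod>j\<in>insert v T. if j \<in> W then z j - \<alpha> j else 1 - (z j - \<alpha> j)))"
    unfolding sum_Pow_insert[OF insert.hyps]
    using insert.hyps vW by (intro sum.cong) (auto simp: mult_ac)
  finally show ?case .
qed

text \<open>Interpolation at the corner 0 turns \<open>f\<close> along a line into a combination of
  products of \<open>card V\<close> affine functions of the line parameter.\<close>

lemma polyfun_multiaffine:
  fixes f :: "(nat \<Rightarrow> 'r) \<Rightarrow> 'r::comm_ring_1"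
  assumes "finite V" "multiaffine V f" "\<And>j z. j \<in> V \<Longrightarrow> x z j = a j + b j * z"
    "\<And>j z. j \<notin> V \<Longrightarrow> x z j = y j"
  shows "(\<lambda>z. f (x z)) \<in> polyfun (card V)"
proof -
  have "x z = override V (x z) y" for z using assms(4) by (auto simp: override_def)
  then have "f (x z) = (\<Sum>W\<in>Pow V. f (override V (shift (\<lambda>_. 0) W) y) *
      (\<Prod>j\<in>V. if j \<in> W then x z j - 0 else 1 - (x z j - 0)))" for z
    using multiaffine_interpolation[OF assms(1,2), of "x z" y "\<lambda>_. 0"] by simp
  also have "\<dots> z = (\<Sum>W\<in>Pow V. f (override V (shift (\<lambda>_. 0) W) y) *
      (\<Prod>j\<in>V. (if j \<in> W then a j else 1 - a j) + (if j \<in> W then b j else - b j) * z))" for z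
    by (intro sum.cong arg_cong2[of _ _ _ _ "(*)"] prod.cong refl) (auto simp: assms(3))
  finally have eq: "(\<lambda>z. f (x z)) = (\<lambda>z. \<Sum>W\<in>Pow V. f (override V (shift (\<lambda>_. 0) W) y) *
      (\<Prod>j\<in>V. (if j \<in> W then a j else 1 - a j) + (if j \<in> W then b j else - b j) * z))"
    by blast
  show ?thesis unfolding eq
    by (intro polyfun_sum polyfun_cmult polyfun_prod_affine assms(1))
qed

section \<open>Nonzero values on a shifted cube\<close>

context prime_compl
begin

lemma multiaffine_grid:
  assumes "finite V" "multiaffine V f" "nz (f (override V z x))"
  shows "\<exists>B\<subseteq>V. nz (f (override V (shift \<alpha> B) x))"
proof (rule ccontr)
  assume "\<not> ?thesis"
  then have "\<not> nz (f (override V z x))"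
    unfolding multiaffine_interpolation[OF assms(1,2), of z x \<alpha>]
    by (intro nz_sum) (auto simp: nz_mult)
  then show False using assms(3) by simp
qed

text \<open>A relation between the restrictions of \<open>f\<close> to the cube over \<open>T\<close> transforms into one between
  its restrictions to the translate by \<open>\<alpha>\<close>; this is the coefficient of the vertex \<open>\<alpha> + 1\<close>.\<close>

definition top_coeff :: "nat set \<Rightarrow> (nat set \<Rightarrow> 'r) \<Rightarrow> (nat \<Rightarrow> 'r) \<Rightarrow> 'r" where
  "top_coeff T \<kappa> \<alpha> = (\<Sum>U\<in>Pow T. \<kappa> U * (\<Prod>j\<in>T. ind U j - \<alpha> j))"

text \<open>At this \<open>\<alpha>\<close> the factor \<open>ind W j - \<alpha> j\<close> is 1 or
  -1 where \<open>W\<close> and \<open>U\<close> agree and 0 where they differ, so only the summand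
  of \<open>U\<close> survives.\<close>

lemma top_coeff_nonzero:
  assumes "finite T" "U \<subseteq> T" "nz (\<kappa> U)"
  shows "nz (top_coeff T \<kappa> (\<lambda>j. 1 - ind U j))"
proof -
  have z: "(\<Prod>j\<in>T. ind W j - (1 - ind U j)) = (0::'r)" if "W \<in> Pow T" "W \<noteq> U" for W
  proof -
    obtain j where "j \<in> T" "j \<in> W \<longleftrightarrow> j \<notin> U" using \<open>W \<noteq> U\<close> \<open>W \<in> Pow T\<close> assms(2) by blast
    then have "\<exists>j\<in>T. ind W j - (1 - ind U j) = (0::'r)" by (intro bexI[of _ j]) auto
    then show ?thesis by (rule prod_zero[OF assms(1)])
  qed
  have "top_coeff T \<kappa> (\<lambda>j. 1 - ind U j) = \<kappa> U * (\<Prod>j\<in>T. ind U j - (1 - ind U j))"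
    unfolding top_coeff_def
    using assms z by (subst sum.remove[of _ U]) (auto intro!: sum.neutral)
  moreover have "nz (\<Prod>j\<in>T. ind U j - (1 - ind U j))"
    using assms(1) by (simp add: nz_prod nz_1 nz_minus)
  ultimately show ?thesis using assms(3) by (simp add: nz_mult)
qed

lemma multiaffine_top_coeff: "finite T \<Longrightarrow> multiaffine T (top_coeff T \<kappa>)"
  unfolding multiaffine_def
proof (intro allI ballI)
  fix x :: "nat \<Rightarrow> 'r" and v z assume T: "finite T" "v \<in> T"
  have eq: "top_coeff T \<kappa> (x(v := u)) =
     (\<Sum>U\<in>Pow T. \<kappa> U * ((ind U v - u) * (\<Prod>j\<in>T-{v}. ind U j - x j)))" for u
    unfolding top_coeff_def
  proof (intro sum.cong refl arg_cong2[of _ _ _ _ "(*)"])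
    fix U
    have "(\<Prod>j\<in>T. ind U j - (x(v := u)) j) =
        (ind U v - u) * (\<Prod>j\<in>T-{v}. ind U j - (x(v := u)) j)"
      using prod.remove[OF T, of "\<lambda>j. ind U j - (x(v := u)) j"] by simp
    also have "(\<Prod>j\<in>T-{v}. ind U j - (x(v := u)) j) = (\<Prod>j\<in>T-{v}. ind U j - x j)"
      by (intro prod.cong) auto
    finally show "(\<Prod>j\<in>T. ind U j - (x(v := u)) j) =
        (ind U v - u) * (\<Prod>j\<in>T-{v}. ind U j - x j)" .
  qed
  show "top_coeff T \<kappa> (x(v := z)) = top_coeff T \<kappa> (x(v := 0)) +
      z * (top_coeff T \<kappa> (x(v := 1)) - top_coeff T \<kappa> (x(v := 0)))"
    unfolding eq sum_subtractf[symmetric] sum_distrib_left sum.distrib[symmetric]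
    by (intro sum.cong) (simp_all add: algebra_simps)
qed

text \<open>Rank concentration. Suppose all vertices with fewer than \<open>L\<close> shifted
  coordinates give zero. A larger vertex \<open>B\<close> contains a set \<open>T\<close> of size
  \<open>L\<close>, and the relation for \<open>T\<close> expresses \<open>top_coeff\<close> times
  the value at \<open>B\<close> by values at smaller vertices. By induction on \<open>card B\<close>
  the whole cube gives zero, contrary to \<open>multiaffine_grid\<close>.\<close>

lemma low_support_nonzero:
  assumes fin: "finite Y" and aff: "multiaffine Y f"
    and rel: "\<And>T x. T \<subseteq> Y \<Longrightarrow> card T = L \<Longrightarrow> (\<And>i. i \<notin> Y \<Longrightarrow> x i = z i) \<Longrightarrow>
      \<not> nz (\<Sum>U\<in>Pow T. \<kappa> T U * f (override T (ind U) x))"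
    and top: "\<And>T. T \<subseteq> Y \<Longrightarrow> card T = L \<Longrightarrow> nz (top_coeff T (\<kappa> T) \<alpha>)"
    and nonzero: "nz (f z)"
  shows "\<exists>B\<subseteq>Y. card B < L \<and> nz (f (override Y (shift \<alpha> B) z))"
proof (rule ccontr)
  assume "\<not> ?thesis"
  then have low: "\<not> nz (f (override Y (shift \<alpha> B) z))" if "B \<subseteq> Y" "card B < L" for B
    using that by blast
  have "\<not> nz (f (override Y (shift \<alpha> B) z))" if "B \<subseteq> Y" for B
    using that
  proof (induction "card B" arbitrary: B rule: less_induct)
    case less
    show ?case
    proof (cases "card B < L")
      case False
      then obtain T where T: "T \<subseteq> B" "card T = L" using obtain_subset_with_card_n by (metis not_less)
      have finB: "finite B" using less.prems fin finite_subset by blast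
      have finT: "finite T" using T finB finite_subset by blast
      define x where "x = override Y (shift \<alpha> B) z"
      have TX: "T \<subseteq> Y" using T less.prems by blast
      have affT: "multiaffine T f" using aff TX multiaffine_subset by blast
      define w where "w U W = (\<Prod>j\<in>T. if j \<in> W then ind U j - \<alpha> j else 1 - (ind U j - \<alpha> j))" for U W
      \<comment> \<open>Switching off the coordinates in \<open>T - W\<close> leads from the vertex
        \<open>B\<close> to the vertex \<open>B - (T - W)\<close>, which is smaller unless
        \<open>W = T\<close>.\<close>
      have ovx: "override T (shift \<alpha> W) x = override Y (shift \<alpha> (B - (T - W))) z" if "W \<in> Pow T" for W
        using that T TX unfolding x_def override_def by (auto simp: fun_eq_iff)
      have small: "\<not> nz (f (override T (shift \<alpha> W) x))" if W: "W \<in> Pow T" "W \<noteq> T" for W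
      proof -
        have "B - (T - W) \<subset> B" using W T by blast
        then have "card (B - (T - W)) < card B" using finB by (rule psubset_card_mono[rotated])
        then show ?thesis using less unfolding ovx[OF W(1)] by blast
      qed
      have xT: "override T (shift \<alpha> T) x = x" using ovx[of T] by (simp add: x_def)
      have TP: "T \<in> Pow T" "finite (Pow T)" using finT by auto
      \<comment> \<open>The relation in the basis belonging to \<open>\<alpha>\<close>: the part of
        \<open>W = T\<close> is \<open>f x\<close> times \<open>top_coeff\<close>, and all the
        others carry a value that vanishes by induction.\<close>
      have "(\<Sum>U\<in>Pow T. \<kappa> T U * f (override T (ind U) x)) =
          (\<Sum>U\<in>Pow T. \<kappa> T U * (\<Sum>W\<in>Pow T. f (override T (shift \<alpha> W) x) * w U W))"
        unfolding w_def
        by (intro sum.cong refl arg_cong2[of _ _ _ _ "(*)"] multiaffine_interpolation finT affT)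
      also have "\<dots> = (\<Sum>U\<in>Pow T. \<kappa> T U * (f x * w U T)) +
         (\<Sum>U\<in>Pow T. \<Sum>W\<in>Pow T-{T}. \<kappa> T U * (f (override T (shift \<alpha> W) x) * w U W))"
        by (simp only: sum.remove[OF TP(2,1)] xT distrib_left sum.distrib sum_distrib_left)
      also have "(\<Sum>U\<in>Pow T. \<kappa> T U * (f x * w U T)) = f x * top_coeff T (\<kappa> T) \<alpha>"
        unfolding top_coeff_def sum_distrib_left w_def by (intro sum.cong refl) (simp add: mult_ac)
      finally have eq: "(\<Sum>U\<in>Pow T. \<kappa> T U * f (override T (ind U) x)) = f x * top_coeff T (\<kappa> T) \<alpha> +
         (\<Sum>U\<in>Pow T. \<Sum>W\<in>Pow T-{T}. \<kappa> T U * (f (override T (shift \<alpha> W) x) * w U W))" .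
      have "\<not> nz (\<Sum>U\<in>Pow T. \<Sum>W\<in>Pow T-{T}. \<kappa> T U * (f (override T (shift \<alpha> W) x) * w U W))"
        using small by (intro nz_sum) (auto simp: nz_mult)
      moreover have "\<not> nz (\<Sum>U\<in>Pow T. \<kappa> T U * f (override T (ind U) x))"
        by (rule rel[OF TX T(2)]) (simp add: x_def override_def)
      ultimately have "\<not> nz (f x * top_coeff T (\<kappa> T) \<alpha>)"
        unfolding eq using nz_add_iff by blast
      then show ?thesis using top[OF TX T(2)] by (simp add: nz_mult x_def)
    qed (use low less.prems in blast)
  qed
  moreover have "nz (f (override Y z z))" using nonzero by (simp add: override_def)
  ultimately show False using multiaffine_grid[OF fin aff] by blast
qed

end

section \<open>Depth-4 formulas as nested lists\<close>

text \<open>A term is a squarefree monomial, given by its set of variables, with its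
  coefficient.\<close>

type_synonym 'r sparse = "(nat set \<times> 'r) list"

definition sparse_eval :: "'r::comm_ring_1 sparse \<Rightarrow> (nat \<Rightarrow> 'r) \<Rightarrow> 'r" where
  "sparse_eval Q x = (\<Sum>(S, c)\<leftarrow>Q. c * prod x S)"

definition sparse_vars :: "'r sparse \<Rightarrow> nat set" where
  "sparse_vars Q = \<Union> (fst ` set Q)"

definition gate_eval :: "'r::comm_ring_1 sparse list \<Rightarrow> (nat \<Rightarrow> 'r) \<Rightarrow> 'r" where
  "gate_eval G x = prod_list (map (\<lambda>Q. sparse_eval Q x) G)"

definition gate_vars :: "'r sparse list \<Rightarrow> nat set" where
  "gate_vars G = \<Union> (sparse_vars ` set G)"

definition form_eval :: "'r::comm_ring_1 sparse list list \<Rightarrow> (nat \<Rightarrow> 'r) \<Rightarrow> 'r" where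
  "form_eval f x = sum_list (map (\<lambda>G. gate_eval G x) f)"

definition form_vars :: "'r sparse list list \<Rightarrow> nat set" where
  "form_vars f = \<Union> (gate_vars ` set f)"

definition disjoint_gate :: "'r sparse list \<Rightarrow> bool" where
  "disjoint_gate = sorted_wrt (\<lambda>Q Q'. sparse_vars Q \<inter> sparse_vars Q' = {})"

lemma sparse_eval_Nil [simp]: "sparse_eval [] x = 0"
  and sparse_eval_Cons [simp]: "sparse_eval (t # Q) x = snd t * prod x (fst t) + sparse_eval Q x"
  by (auto simp: sparse_eval_def split: prod.split)

lemma sparse_vars_Nil [simp]: "sparse_vars [] = {}"
  and sparse_vars_Cons [simp]: "sparse_vars (t # Q) = fst t \<union> sparse_vars Q"
  by (auto simp: sparse_vars_def)

lemma gate_eval_simps [simp]: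
  "gate_eval [] x = 1" "gate_eval (Q # G) x = sparse_eval Q x * gate_eval G x"
  by (auto simp: gate_eval_def)

lemma gate_vars_simps [simp]:
  "gate_vars [] = {}" "gate_vars (Q # G) = sparse_vars Q \<union> gate_vars G"
  by (auto simp: gate_vars_def)

lemma disjoint_gate_simps [simp]:
  "disjoint_gate []"
  "disjoint_gate (Q # G) \<longleftrightarrow> sparse_vars Q \<inter> gate_vars G = {} \<and> disjoint_gate G"
  by (auto simp: gate_vars_def disjoint_gate_def)

lemma form_eval_simps [simp]:
  "form_eval [] x = 0" "form_eval (G # f) x = gate_eval G x + form_eval f x"
  by (auto simp: form_eval_def)

lemma form_vars_simps [simp]:
  "form_vars [] = {}" "form_vars (G # f) = gate_vars G \<union> form_vars f"
  by (auto simp: form_vars_def)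

lemma sparse_eval_cong: "(\<And>i. i \<in> sparse_vars Q \<Longrightarrow> x i = y i) \<Longrightarrow> sparse_eval Q x = sparse_eval Q y"
  by (induction Q) (auto intro!: arg_cong2[of _ _ _ _ "(+)"] arg_cong2[of _ _ _ _ "(*)"] prod.cong)

lemma gate_eval_cong: "(\<And>i. i \<in> gate_vars G \<Longrightarrow> x i = y i) \<Longrightarrow> gate_eval G x = gate_eval G y"
  by (induction G) (auto intro!: arg_cong2[of _ _ _ _ "(*)"] sparse_eval_cong)

lemma form_eval_cong: "(\<And>i. i \<in> form_vars f \<Longrightarrow> x i = y i) \<Longrightarrow> form_eval f x = form_eval f y"
  by (induction f) (auto intro!: arg_cong2[of _ _ _ _ "(+)"] gate_eval_cong)

subsection \<open>Restriction and derivative\<close>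

definition sparse_restrict :: "nat \<Rightarrow> 'r sparse \<Rightarrow> 'r sparse" where
  "sparse_restrict v Q = filter (\<lambda>t. v \<notin> fst t) Q"

definition sparse_deriv :: "nat \<Rightarrow> 'r sparse \<Rightarrow> 'r sparse" where
  "sparse_deriv v Q = map (\<lambda>t. (fst t - {v}, snd t)) (filter (\<lambda>t. v \<in> fst t) Q)"

definition gate_restrict :: "nat \<Rightarrow> 'r sparse list \<Rightarrow> 'r sparse list" where
  "gate_restrict v G = map (sparse_restrict v) G"

text \<open>In a disjoint gate at most one sum contains \<open>v\<close>, so the product rule has a
  single term. A gate without \<open>v\<close> is returned unchanged instead of becoming zero, which
  is why \<open>form_deriv\<close> filters the gates.\<close>

definition gate_deriv :: "nat \<Rightarrow> 'r sparse list \<Rightarrow> 'r sparse list" where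
  "gate_deriv v G = map (\<lambda>Q. if v \<in> sparse_vars Q then sparse_deriv v Q else Q) G"

definition form_restrict :: "nat \<Rightarrow> 'r sparse list list \<Rightarrow> 'r sparse list list" where
  "form_restrict v f = map (gate_restrict v) f"

definition form_deriv :: "nat \<Rightarrow> 'r sparse list list \<Rightarrow> 'r sparse list list" where
  "form_deriv v f = map (gate_deriv v) (filter (\<lambda>G. v \<in> gate_vars G) f)"

lemma sparse_split:
  assumes "finite (sparse_vars Q)"
  shows "sparse_eval Q x = sparse_eval (sparse_restrict v Q) x + x v * sparse_eval (sparse_deriv v Q) x"
  using assms
proof (induction Q)
  case (Cons t Q)
  have "prod x (fst t) = x v * prod x (fst t - {v})" if "v \<in> fst t"
    using Cons.prems that by (simp add: prod.remove)
  with Cons show ?case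
    by (auto simp: sparse_restrict_def sparse_deriv_def algebra_simps)
qed (auto simp: sparse_restrict_def sparse_deriv_def)

lemma sparse_restrict_id: "v \<notin> sparse_vars Q \<Longrightarrow> sparse_restrict v Q = Q"
  by (auto simp: sparse_restrict_def sparse_vars_def filter_id_conv)

lemma sparse_vars_restrict: "sparse_vars (sparse_restrict v Q) \<subseteq> sparse_vars Q - {v}"
  and sparse_vars_deriv: "sparse_vars (sparse_deriv v Q) \<subseteq> sparse_vars Q - {v}"
  by (auto simp: sparse_restrict_def sparse_deriv_def sparse_vars_def)

lemma length_restrict_deriv:
  "length (sparse_restrict v Q) + length (sparse_deriv v Q) = length Q"
  unfolding sparse_restrict_def sparse_deriv_def
  using sum_length_filter_compl[of "\<lambda>t. v \<in> fst t" Q] by simp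

lemma gate_vars_restrict: "gate_vars (gate_restrict v G) \<subseteq> gate_vars G - {v}"
  using sparse_vars_restrict by (fastforce simp: gate_restrict_def gate_vars_def)

lemma gate_vars_deriv: "gate_vars (gate_deriv v G) \<subseteq> gate_vars G - {v}"
  using sparse_vars_deriv by (fastforce simp: gate_deriv_def gate_vars_def)

lemma disjoint_gate_restrict: "disjoint_gate G \<Longrightarrow> disjoint_gate (gate_restrict v G)"
proof (induction G)
  case (Cons Q G)
  have "sparse_vars (sparse_restrict v Q) \<inter> gate_vars (gate_restrict v G) = {}"
    using Cons.prems sparse_vars_restrict[of v Q] gate_vars_restrict[of v G] by auto
  then show ?case using Cons by (simp add: gate_restrict_def)
qed (simp add: gate_restrict_def)

lemma disjoint_gate_deriv: "disjoint_gate G \<Longrightarrow> disjoint_gate (gate_deriv v G)"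
proof (induction G)
  case (Cons Q G)
  have "(if v \<in> sparse_vars Q then sparse_vars (sparse_deriv v Q) else sparse_vars Q)
      \<inter> gate_vars (gate_deriv v G) = {}"
    using Cons.prems sparse_vars_deriv[of v Q] gate_vars_deriv[of v G] by auto
  then show ?case using Cons by (auto simp: gate_deriv_def split: if_splits)
qed (simp add: gate_deriv_def)

lemma gate_restrict_id: "v \<notin> gate_vars G \<Longrightarrow> gate_restrict v G = G"
  by (induction G) (auto simp: gate_restrict_def sparse_restrict_id)

lemma gate_deriv_id: "v \<notin> gate_vars G \<Longrightarrow> gate_deriv v G = G"
  by (induction G) (auto simp: gate_deriv_def)

lemma gate_split:
  assumes "finite (gate_vars G)" "disjoint_gate G"
  shows "gate_eval G x = gate_eval (gate_restrict v G) x +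
    (if v \<in> gate_vars G then x v * gate_eval (gate_deriv v G) x else 0)"
  using assms
proof (induction G)
  case (Cons Q G)
  show ?case
  proof (cases "v \<in> sparse_vars Q")
    case True
    then have "v \<notin> gate_vars G" using Cons.prems by auto
    then have "gate_restrict v (Q # G) = sparse_restrict v Q # G"
      "gate_deriv v (Q # G) = sparse_deriv v Q # G"
      using True gate_restrict_id[of v G] gate_deriv_id[of v G]
      by (auto simp: gate_restrict_def gate_deriv_def)
    then show ?thesis using True Cons.prems sparse_split[of Q x v] by (simp add: algebra_simps)
  next
    case False
    then have "gate_restrict v (Q # G) = Q # gate_restrict v G"
      "gate_deriv v (Q # G) = Q # gate_deriv v G"
      by (auto simp: gate_restrict_def gate_deriv_def sparse_restrict_id)
    then show ?thesis using False Cons by (simp add: algebra_simps)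
  qed
qed (simp add: gate_restrict_def)

lemma form_split:
  assumes "finite (form_vars f)" "\<forall>G\<in>set f. disjoint_gate G"
  shows "form_eval f x = form_eval (form_restrict v f) x + x v * form_eval (form_deriv v f) x"
  using assms
proof (induction f)
  case (Cons G f)
  then show ?case using gate_split[of G x v]
    by (simp add: form_restrict_def form_deriv_def algebra_simps)
qed (simp_all add: form_restrict_def form_deriv_def)

lemma form_vars_restrict: "form_vars (form_restrict v f) \<subseteq> form_vars f - {v}"
  using gate_vars_restrict by (fastforce simp: form_restrict_def form_vars_def)

lemma form_vars_deriv: "form_vars (form_deriv v f) \<subseteq> form_vars f - {v}"
  using gate_vars_deriv by (fastforce simp: form_deriv_def form_vars_def)

lemma multiaffine_form:
  assumes "finite (form_vars f)" "\<forall>G\<in>set f. disjoint_gate G"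
  shows "multiaffine V (form_eval f)"
  unfolding multiaffine_def
proof (intro allI ballI)
  fix x :: "nat \<Rightarrow> 'a" and v z
  have c: "form_eval (form_restrict v f) (x(v := u)) = form_eval (form_restrict v f) x"
    "form_eval (form_deriv v f) (x(v := u)) = form_eval (form_deriv v f) x" for u
    using form_vars_restrict[of v f] form_vars_deriv[of v f] by (auto intro!: form_eval_cong)
  have s: "form_eval f (x(v := u)) = form_eval (form_restrict v f) x + u * form_eval (form_deriv v f) x" for u
    using form_split[OF assms, of "x(v := u)" v] by (simp add: c)
  show "form_eval f (x(v := z)) = form_eval f (x(v := 0)) +
      z * (form_eval f (x(v := 1)) - form_eval f (x(v := 0)))"
    unfolding s by simp
qed

subsection \<open>The potential\<close>

definition big :: "nat \<Rightarrow> 'r sparse \<Rightarrow> bool" where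
  "big k Q \<longleftrightarrow> k < card (sparse_vars Q)"

text \<open>Restriction and derivative divide the terms of a sum between them, so the number of
  terms is a cost that splits additively; sums that are already small are free.\<close>

definition weight :: "nat \<Rightarrow> 'r sparse \<Rightarrow> nat" where
  "weight k Q = (if big k Q then length Q else 0)"

definition potential :: "nat \<Rightarrow> 'r sparse list list \<Rightarrow> nat" where
  "potential k f = (\<Sum>G\<leftarrow>f. \<Sum>Q\<leftarrow>G. weight k Q)"

definition potential_at :: "nat \<Rightarrow> nat \<Rightarrow> 'r sparse list list \<Rightarrow> nat" where
  "potential_at v k f = (\<Sum>G\<leftarrow>f. \<Sum>Q\<leftarrow>G. if v \<in> sparse_vars Q then weight k Q else 0)"

lemma weight_split:
  assumes "finite (sparse_vars Q)"
  shows "weight k (sparse_restrict v Q) + weight k (sparse_deriv v Q) \<le> weight k Q"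
proof -
  have "card (sparse_vars (sparse_restrict v Q)) \<le> card (sparse_vars Q)"
    "card (sparse_vars (sparse_deriv v Q)) \<le> card (sparse_vars Q)"
    using assms sparse_vars_restrict[of v Q] sparse_vars_deriv[of v Q] by (auto intro!: card_mono)
  then show ?thesis using length_restrict_deriv[of v Q] by (auto simp: weight_def big_def)
qed

text \<open>A sum containing \<open>v\<close> is divided between the two formulas and counted once
  more in \<open>potential_at\<close>; a sum without \<open>v\<close> is at worst copied into both.
  Either way it is charged at most twice.\<close>

lemma potential_split:
  assumes "finite (form_vars f)"
  shows "potential k (form_restrict v f) + potential k (form_deriv v f) + potential_at v k f
    \<le> 2 * potential k f"
  using assms
proof (induction f)
  case (Cons G f)
  let ?w = "\<lambda>G. \<Sum>Q\<leftarrow>G. weight k Q"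
  have "?w (gate_restrict v G) + ?w (gate_deriv v G) +
      (\<Sum>Q\<leftarrow>G. if v \<in> sparse_vars Q then weight k Q else 0) \<le> 2 * ?w G"
    if "finite (gate_vars G)"
    using that
  proof (induction G)
    case (Cons Q G)
    then show ?case using weight_split[of Q k v]
      by (auto simp: gate_restrict_def gate_deriv_def sparse_restrict_id)
  qed (auto simp: gate_restrict_def gate_deriv_def)
  moreover have "gate_restrict v G = G"
      "(\<Sum>Q\<leftarrow>G. if v \<in> sparse_vars Q then weight k Q else 0) = 0" if "v \<notin> gate_vars G"
    using that gate_restrict_id[of v G] by (auto simp: gate_vars_def intro!: sum_list_0 cong: map_cong)
  ultimately show ?case using Cons
    by (auto simp: potential_def potential_at_def form_restrict_def form_deriv_def)
qed (simp add: potential_def potential_at_def form_restrict_def form_deriv_def)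

lemma sum_sum_list_swap:
  fixes h :: "'b \<Rightarrow> 'c \<Rightarrow> nat"
  shows "(\<Sum>v\<in>V. \<Sum>Q\<leftarrow>G. h v Q) = (\<Sum>Q\<leftarrow>G. \<Sum>v\<in>V. h v Q)"
  by (induction G) (simp_all add: sum.distrib)

lemma sum_list_mono_const:
  fixes h h' :: "'c \<Rightarrow> nat"
  shows "(\<And>Q. Q \<in> set G \<Longrightarrow> k * h Q \<le> h' Q) \<Longrightarrow> k * (\<Sum>Q\<leftarrow>G. h Q) \<le> (\<Sum>Q\<leftarrow>G. h' Q)"
  by (induction G) (auto simp: distrib_left add_mono)

text \<open>Double counting: a big sum contributes its weight once for each of its more than
  \<open>k\<close> variables.\<close>

lemma potential_sum:
  assumes "finite V" "form_vars f \<subseteq> V"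
  shows "k * potential k f \<le> (\<Sum>v\<in>V. potential_at v k f)"
  unfolding potential_def potential_at_def sum_sum_list_swap
proof (intro sum_list_mono_const)
  fix G Q assume "G \<in> set f" "Q \<in> set G"
  then have "sparse_vars Q \<subseteq> V" using assms by (auto simp: form_vars_def gate_vars_def)
  then have "V \<inter> {v. v \<in> sparse_vars Q} = sparse_vars Q" by auto
  then have "(\<Sum>v\<in>V. if v \<in> sparse_vars Q then weight k Q else 0) = card (sparse_vars Q) * weight k Q"
    using assms(1) by (simp add: sum.If_cases)
  then show "k * weight k Q \<le> (\<Sum>v\<in>V. if v \<in> sparse_vars Q then weight k Q else 0)"
    by (auto simp: weight_def big_def)
qed

lemma potential_mono_vars:
  assumes "finite (form_vars f)"
  shows "potential k (form_restrict v f) \<le> potential k f" "potential k (form_deriv v f) \<le> potential k f"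
proof -
  have *: "finite (gate_vars G)" "finite (sparse_vars Q)" if "G \<in> set f" "Q \<in> set G" for G Q
    using assms that by (auto simp: form_vars_def gate_vars_def intro: finite_subset)
  have 1: "weight k (sparse_restrict v Q) \<le> weight k Q" "weight k (sparse_deriv v Q) \<le> weight k Q"
    if "G \<in> set f" "Q \<in> set G" for G Q
    using weight_split[OF *(2)[OF that], of k v] by auto
  show "potential k (form_restrict v f) \<le> potential k f"
    unfolding potential_def form_restrict_def gate_restrict_def map_map o_def
    by (intro sum_list_mono) (simp add: 1)
  have "potential k (form_deriv v f) \<le> (\<Sum>G\<leftarrow>filter (\<lambda>G. v \<in> gate_vars G) f. \<Sum>Q\<leftarrow>G. weight k Q)"
    unfolding potential_def form_deriv_def gate_deriv_def map_map o_def
    by (intro sum_list_mono) (auto simp: 1)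
  also have "\<dots> \<le> potential k f"
    unfolding potential_def by (induction f) auto
  finally show "potential k (form_deriv v f) \<le> potential k f" .
qed

definition small_form :: "nat \<Rightarrow> 'r sparse list list \<Rightarrow> bool" where
  "small_form k f \<longleftrightarrow> (\<forall>G\<in>set f. disjoint_gate G \<and> (\<forall>Q\<in>set G. card (sparse_vars Q) \<le> k))"

lemma form_restrict_deriv_disjoint:
  assumes "\<forall>G\<in>set f. disjoint_gate G"
  shows "\<forall>G\<in>set (form_restrict v f). disjoint_gate G" "\<forall>G\<in>set (form_deriv v f). disjoint_gate G"
  using assms by (auto simp: form_restrict_def form_deriv_def disjoint_gate_restrict disjoint_gate_deriv)

definition collisions :: "'a sparse list \<Rightarrow> nat set \<Rightarrow> nat set" where
  "collisions G Y = \<Union> {sparse_vars Q \<inter> Y | Q. Q \<in> set G \<and> 2 \<le> card (sparse_vars Q \<inter> Y)}"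

context prime_compl
begin

lemma nz_add_iff': "\<not> nz x \<Longrightarrow> nz (x + y) \<longleftrightarrow> nz y"
  using nz_add_iff[of x y] by (simp add: add.commute)

text \<open>Restriction and derivative with respect to \<open>v\<close> together lose \<open>potential_at v\<close>, which for some \<open>v\<close>
  is a fraction \<open>k / n\<close> of the potential because each big sum contains more than \<open>k\<close> variables.
  If both are nonzero, the one of smaller potential is kept, at the cost of putting \<open>v\<close> into \<open>A\<close>;
  \<open>x v\<close> or \<open>x v + 1\<close> then preserves nonzeroness.\<close>

theorem reduce_to_small:
  fixes f :: "'r sparse list list" and n k :: nat
  assumes "finite V" "form_vars f \<subseteq> V" "card V \<le> n" "\<forall>G\<in>set f. disjoint_gate G"
    and "\<exists>x. nz (form_eval f x)" "0 < k" "k \<le> 2 * n"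
    and "real (potential k f) * (1 - real k / (2 * real n)) ^ D < 1"
  shows "\<exists>A g. A \<subseteq> V \<and> card A \<le> D \<and> form_vars g \<subseteq> V - A \<and> small_form k g \<and> length g \<le> length f \<and>
     (\<exists>x. nz (form_eval g x)) \<and>
     (\<forall>x. (\<forall>v\<in>V. nz (x v)) \<longrightarrow> nz (form_eval g x) \<longrightarrow> (\<exists>B\<subseteq>A. nz (form_eval f (shift x B))))"
  using assms(1-5,8)
proof (induction "card V" arbitrary: V f D rule: less_induct)
  case less
  note fin = finite_subset[OF less.prems(2,1)]
  show ?case
  proof (cases "\<forall>G\<in>set f. \<forall>Q\<in>set G. \<not> big k Q")
    case True
    then show ?thesis using less.prems
      by (intro exI[of _ "{}"] exI[of _ f]) (auto simp: small_form_def big_def not_less)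
  next
    case False
    then obtain G Q where GQ: "G \<in> set f" "Q \<in> set G" "big k Q" by blast
    have "Q \<noteq> []" using GQ(3) by (auto simp: big_def)
    then have "1 \<le> weight k Q" using GQ(3) by (cases Q) (auto simp: weight_def)
    also have "\<dots> \<le> (\<Sum>Q\<leftarrow>G. weight k Q)" using GQ(2) by (simp add: member_le_sum_list)
    also have "\<dots> \<le> potential k f"
      unfolding potential_def using GQ(1) by (simp add: member_le_sum_list)
    finally have pos: "1 \<le> potential k f" .
    \<comment> \<open>A positive potential leaves at least one step: for \<open>D = 0\<close> the
      assumption would put the potential below 1.\<close>
    obtain D' where D: "D = Suc D'" using less.prems(6) pos by (cases D) auto
    have "V \<noteq> {}" using GQ less.prems(2) by (auto simp: big_def form_vars_def gate_vars_def)
    have ex: "\<exists>v\<in>V. k * potential k f \<le> n * potential_at v k f"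
    proof (rule ccontr)
      assume "\<not> ?thesis"
      then have lt: "\<And>v. v \<in> V \<Longrightarrow> n * potential_at v k f < k * potential k f" by (auto simp: not_le)
      have "n * (\<Sum>v\<in>V. potential_at v k f) = (\<Sum>v\<in>V. n * potential_at v k f)" by (rule sum_distrib_left)
      also have "\<dots> < (\<Sum>v\<in>V. k * potential k f)"
        using lt \<open>V \<noteq> {}\<close> less.prems(1) by (intro sum_strict_mono) auto
      also have "\<dots> = card V * (k * potential k f)" by simp
      also have "\<dots> \<le> n * (k * potential k f)" using less.prems(3) by (intro mult_right_mono) auto
      finally have "(\<Sum>v\<in>V. potential_at v k f) < k * potential k f" by simp
      then show False using potential_sum[OF less.prems(1,2), of k] by simp
    qed
    then obtain v where v: "v \<in> V" "k * potential k f \<le> n * potential_at v k f" by blast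
    define f0 f1 where "f0 = form_restrict v f" and "f1 = form_deriv v f"
    define V' where "V' = V - {v}"
    have V': "finite V'" "card V' < card V" "card V' \<le> n"
      using less.prems(1,3) v(1) card_gt_0_iff[of V] by (auto simp: V'_def)
    have vars: "form_vars f0 \<subseteq> V'" "form_vars f1 \<subseteq> V'"
      using form_vars_restrict[of v f] form_vars_deriv[of v f] less.prems(2)
      by (auto simp: f0_def f1_def V'_def)
    have dis: "\<forall>G\<in>set f0. disjoint_gate G" "\<forall>G\<in>set f1. disjoint_gate G"
      using form_restrict_deriv_disjoint[OF less.prems(4)] by (auto simp: f0_def f1_def)
    have len: "length f0 \<le> length f" "length f1 \<le> length f"
      by (auto simp: f0_def f1_def form_restrict_def form_deriv_def)
    have split: "form_eval f x = form_eval f0 x + x v * form_eval f1 x" for x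
      using form_split[OF fin less.prems(4)] by (simp add: f0_def f1_def)
    have np: "potential k f0 \<le> potential k f" "potential k f1 \<le> potential k f"
      using potential_mono_vars[OF fin] by (auto simp: f0_def f1_def)
    have n: "0 < n" using \<open>V \<noteq> {}\<close> less.prems(1,3) card_gt_0_iff[of V] by auto
    define \<theta> where "\<theta> = 1 - real k / (2 * real n)"
    have \<theta>: "0 \<le> \<theta>" using assms(7) n by (simp add: \<theta>_def field_simps)
    have small: "real (potential k g) * \<theta> ^ D < 1" if "potential k g \<le> potential k f" for g :: "'r sparse list list"
      using less.prems(6) that \<theta> le_less_trans[OF mult_right_mono[of "real (potential k g)" "real (potential k f)"]]
      by (auto simp: \<theta>_def)
    consider "\<nexists>x. nz (form_eval f0 x)" | "\<nexists>x. nz (form_eval f1 x)"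
      | "\<exists>x. nz (form_eval f0 x)" "\<exists>x. nz (form_eval f1 x)" by blast
    then show ?thesis
    proof cases
      \<comment> \<open>Modulo the ideal the formula is \<open>x v\<close> times the derivative, and
        \<open>x v\<close> is nonzero by assumption. So \<open>v\<close> stays out of
        \<open>A\<close>, and no step of \<open>D\<close> is spent.\<close>
      case 1
      then have "\<exists>x. nz (form_eval f1 x)"
        using less.prems(5) split nz_add nz_mult by metis
      from less.hyps[OF V'(2,1) vars(2) V'(3) dis(2) this small[OF np(2), unfolded \<theta>_def]]
      obtain A g where Ag: "A \<subseteq> V'" "card A \<le> D" "form_vars g \<subseteq> V' - A" "small_form k g"
        "length g \<le> length f1" "\<exists>x. nz (form_eval g x)"
        "\<And>x. (\<forall>v\<in>V'. nz (x v)) \<Longrightarrow> nz (form_eval g x) \<Longrightarrow> \<exists>B\<subseteq>A. nz (form_eval f1 (shift x B))"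
        by blast
      have "\<exists>B\<subseteq>A. nz (form_eval f (shift x B))" if x: "\<forall>v\<in>V. nz (x v)" "nz (form_eval g x)" for x
      proof -
        obtain B where B: "B \<subseteq> A" "nz (form_eval f1 (shift x B))"
          using Ag(7)[of x] x by (auto simp: V'_def)
        have "v \<notin> B" using B(1) Ag(1) by (auto simp: V'_def)
        then have "nz (shift x B v)" using x(1) v(1) by simp
        then have "nz (shift x B v * form_eval f1 (shift x B))"
          using B(2) nz_mult by blast
        moreover have "\<not> nz (form_eval f0 (shift x B))" using 1 by blast
        ultimately have "nz (form_eval f (shift x B))"
          unfolding split[of "shift x B"] using nz_add_iff' by blast
        then show ?thesis using B(1) by blast
      qed
      then show ?thesis using Ag len(2) by (intro exI[of _ A] exI[of _ g]) (auto simp: V'_def)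
    next
      case 2
      then have "\<exists>x. nz (form_eval f0 x)"
        using less.prems(5) split nz_add nz_mult by metis
      from less.hyps[OF V'(2,1) vars(1) V'(3) dis(1) this small[OF np(1), unfolded \<theta>_def]]
      obtain A g where Ag: "A \<subseteq> V'" "card A \<le> D" "form_vars g \<subseteq> V' - A" "small_form k g"
        "length g \<le> length f0" "\<exists>x. nz (form_eval g x)"
        "\<And>x. (\<forall>v\<in>V'. nz (x v)) \<Longrightarrow> nz (form_eval g x) \<Longrightarrow> \<exists>B\<subseteq>A. nz (form_eval f0 (shift x B))"
        by blast
      have "\<exists>B\<subseteq>A. nz (form_eval f (shift x B))" if x: "\<forall>v\<in>V. nz (x v)" "nz (form_eval g x)" for x
      proof -
        obtain B where B: "B \<subseteq> A" "nz (form_eval f0 (shift x B))"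
          using Ag(7)[of x] x by (auto simp: V'_def)
        have "\<not> nz (shift x B v * form_eval f1 (shift x B))"
          using 2 by (simp add: nz_mult)
        then have "nz (form_eval f (shift x B))"
          unfolding split[of "shift x B"] using nz_add_iff B(2) by blast
        then show ?thesis using B(1) by blast
      qed
      then show ?thesis using Ag len(1) by (intro exI[of _ A] exI[of _ g]) (auto simp: V'_def)
    next
      case 3
      have "real (k * potential k f) \<le> real (n * potential_at v k f)"
        using v(2) of_nat_le_iff by blast
      then have pv: "real k * real (potential k f) / real n \<le> real (potential_at v k f)"
        using n by (simp add: field_simps)
      have ps: "real (potential k f0) + real (potential k f1) + real (potential_at v k f) \<le> 2 * real (potential k f)"
        using potential_split[OF fin, of k v] unfolding f0_def f1_def by linarith
      \<comment> \<open>Together the two potentials are at most \<open>2 - k / n\<close> times the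
        old one, so the smaller is at most \<open>\<theta>\<close> times it; this is the origin of
        the 2 in \<open>\<theta>\<close>.\<close>
      have th: "2 * (\<theta> * real (potential k f)) = 2 * real (potential k f) - real k * real (potential k f) / real n"
        using n by (simp add: \<theta>_def field_simps)
      have "real (potential k f0) + real (potential k f1) \<le> 2 * (\<theta> * real (potential k f))"
        using ps pv th by linarith
      then have "\<exists>h. (h = f0 \<or> h = f1) \<and> real (potential k h) \<le> \<theta> * real (potential k f)"
      proof (cases "real (potential k f0) \<le> \<theta> * real (potential k f)")
        case False
        with \<open>_ \<le> 2 * (\<theta> * real (potential k f))\<close>
        have "real (potential k f1) \<le> \<theta> * real (potential k f)" by linarith
        then show ?thesis by blast
      qed blast
      then obtain h where h: "h = f0 \<or> h = f1" "real (potential k h) \<le> \<theta> * real (potential k f)" by blast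
      have "real (potential k h) * \<theta> ^ D' \<le> \<theta> * real (potential k f) * \<theta> ^ D'"
        using h(2) \<theta> by (intro mult_right_mono) auto
      also have "\<dots> < 1" using less.prems(6) by (simp add: D \<theta>_def mult_ac)
      finally have small': "real (potential k h) * (1 - real k / (2 * real n)) ^ D' < 1" by (simp add: \<theta>_def)
      have "form_vars h \<subseteq> V'" "\<forall>G\<in>set h. disjoint_gate G" "\<exists>x. nz (form_eval h x)"
        and lh: "length h \<le> length f"
        using h(1) vars dis 3 len by auto
      from less.hyps[OF V'(2,1) this(1) V'(3) this(2,3) small']
      obtain A g where Ag: "A \<subseteq> V'" "card A \<le> D'" "form_vars g \<subseteq> V' - A" "small_form k g"
        "length g \<le> length h" "\<exists>x. nz (form_eval g x)"
        "\<And>x. (\<forall>v\<in>V'. nz (x v)) \<Longrightarrow> nz (form_eval g x) \<Longrightarrow> \<exists>B\<subseteq>A. nz (form_eval h (shift x B))"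
        by blast
      have "\<exists>B\<subseteq>insert v A. nz (form_eval f (shift x B))"
        if x: "\<forall>v\<in>V. nz (x v)" "nz (form_eval g x)" for x
      proof -
        obtain B where B: "B \<subseteq> A" "nz (form_eval h (shift x B))"
          using Ag(7)[of x] x by (auto simp: V'_def)
        have vB': "v \<notin> B" using B(1) Ag(1) by (auto simp: V'_def)
        let ?y = "shift x B"
        have "form_eval f0 (shift x (insert v B)) = form_eval f0 ?y"
          "form_eval f1 (shift x (insert v B)) = form_eval f1 ?y"
          using vars by (auto intro!: form_eval_cong simp: V'_def)
        then have e: "form_eval f (shift x (insert v B)) = form_eval f0 ?y + (x v + 1) * form_eval f1 ?y"
          "form_eval f ?y = form_eval f0 ?y + x v * form_eval f1 ?y"
          using split[of ?y] split[of "shift x (insert v B)"] vB' by auto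
        \<comment> \<open>The values at \<open>x v\<close> and \<open>x v + 1\<close> differ by the
          derivative, so one of them is nonzero if the derivative is. Otherwise \<open>h\<close> is
          \<open>f0\<close>, and the derivative term disappears from the formula.\<close>
        have "nz (form_eval f ?y) \<or> nz (form_eval f (shift x (insert v B)))"
        proof (cases "nz (form_eval f1 ?y)")
          case True
          have "form_eval f (shift x (insert v B)) - form_eval f ?y = form_eval f1 ?y"
            unfolding e by (simp add: algebra_simps)
          then have "nz (form_eval f (shift x (insert v B)) - form_eval f ?y)"
            using True by (simp only:)
          then show ?thesis using nz_diff by blast
        next
          case False
          then have "nz (form_eval f0 ?y)" using B(2) h(1) by auto
          then have "nz (form_eval f ?y)" unfolding e using False nz_add_iff nz_mult by blast
          then show ?thesis ..
        qed
        then show ?thesis using B(1) insert_mono[of B A v] subset_insertI2[of B A v] by blast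
      qed
      moreover have "card (insert v A) \<le> D"
        using card_insert_le_m1[of "Suc (card A)" A v] Ag(2) D by simp
      moreover have "insert v A \<subseteq> V" "form_vars g \<subseteq> V - insert v A"
        using Ag(1,3) v(1) by (auto simp: V'_def)
      ultimately show ?thesis using Ag lh by (intro exI[of _ "insert v A"] exI[of _ g]) auto
    qed
  qed
qed

subsection \<open>Relations between the restrictions to a cube\<close>

text \<open>A sum that meets \<open>Y\<close> in at most one variable splits off from the values outside \<open>T\<close>, so that the
  restriction of a gate to the cube over \<open>T\<close> has rank at most \<open>2 ^ c\<close>.\<close>

lemma cube_relation:
  fixes f :: "'r sparse list list" and z :: "nat \<Rightarrow> 'r"
  assumes fin: "finite Y" "T \<subseteq> Y"
    and coll: "\<And>G. G \<in> set f \<Longrightarrow> card (collisions G Y \<inter> T) \<le> c"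
    and L: "length f * 2 ^ c < 2 ^ card T"
  shows "\<exists>\<kappa>. (\<exists>U\<in>Pow T. nz (\<kappa> U)) \<and>
    (\<forall>x. (\<forall>i. i \<notin> Y \<longrightarrow> x i = z i) \<longrightarrow> \<not> nz (\<Sum>U\<in>Pow T. \<kappa> U * form_eval f (override T (ind U) x)))"
proof -
  have finT: "finite T" using fin finite_subset by blast
  define C where "C G = collisions G Y \<inter> T" for G :: "'r sparse list"
  have finC: "finite (C G)" for G using finT by (simp add: C_def)
  \<comment> \<open>The unique variable of such a sum in \<open>Y\<close> lies in \<open>T\<close>,
    so the sum sees \<open>x\<close> only outside \<open>Y\<close>, where it agrees with
    \<open>z\<close>. Its value thus depends on \<open>U\<close> but not on
    \<open>x\<close>.\<close>
  define single where "single Q \<longleftrightarrow> card (sparse_vars Q \<inter> Y) < 2 \<and> sparse_vars Q \<inter> T \<noteq> {}" for Q :: "'r sparse"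
  define a where "a G U = prod_list (map (\<lambda>Q. sparse_eval Q (override T (ind U) z)) (filter single G))" for G U
  \<comment> \<open>One equation per gate and trace of \<open>U\<close> on its collisions: at most
    \<open>length f * 2 ^ c\<close> equations for \<open>2 ^ card T\<close> unknowns.\<close>
  define I where "I = (SIGMA i:{..<length f}. Pow (C (f ! i)))"
  have "card I = (\<Sum>i<length f. 2 ^ card (C (f ! i)))"
    unfolding I_def using finC by (simp add: card_Pow)
  also have "\<dots> \<le> (\<Sum>i<length f. 2 ^ c)"
    using coll by (intro sum_mono power_increasing) (auto simp: C_def)
  also have "\<dots> < card (Pow T)" using L finT by (simp add: card_Pow)
  finally have "card I < card (Pow T)" .
  moreover have "finite I" unfolding I_def using finC by auto
  ultimately obtain \<kappa> where \<kappa>: "\<exists>U\<in>Pow T. nz (\<kappa> U)"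
    "\<forall>i\<in>I. \<not> nz (\<Sum>U\<in>Pow T. (if U \<inter> C (f ! fst i) = snd i then a (f ! fst i) U else 0) * \<kappa> U)"
    using linear_dependence[of I "Pow T" "\<lambda>i U. if U \<inter> C (f ! fst i) = snd i then a (f ! fst i) U else 0"] finT
    by auto
  have gate: "\<not> nz (\<Sum>U\<in>Pow T. \<kappa> U * gate_eval G (override T (ind U) x))"
    if G: "G \<in> set f" and x: "\<forall>i. i \<notin> Y \<longrightarrow> x i = z i" for G x
  proof -
    obtain i where i: "i < length f" "f ! i = G" using G by (auto simp: in_set_conv_nth)
    define b where "b \<eta> = prod_list (map (\<lambda>Q. sparse_eval Q (override T (ind \<eta>) x)) (filter (\<lambda>Q. \<not> single Q) G))" for \<eta>
    \<comment> \<open>The gate factors into a part independent of \<open>x\<close> and a part that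
      depends on \<open>U\<close> only through its trace on the collisions. Grouping the
      \<open>U\<close> by trace makes the equations of \<open>I\<close> kill the gate for all
      \<open>x\<close> at once.\<close>
    have ev: "gate_eval G (override T (ind U) x) = a G U * b (U \<inter> C G)" if U: "U \<subseteq> T" for U
    proof -
      have e1: "sparse_eval Q (override T (ind U) x) = sparse_eval Q (override T (ind U) z)"
        if Q: "single Q" for Q
      proof (rule sparse_eval_cong)
        fix j assume j: "j \<in> sparse_vars Q"
        obtain j' where j': "j' \<in> sparse_vars Q" "j' \<in> T" using Q by (auto simp: single_def)
        have "finite (sparse_vars Q \<inter> Y)" using fin by blast
        then have "\<forall>a\<in>sparse_vars Q \<inter> Y. \<forall>b\<in>sparse_vars Q \<inter> Y. a = b"
          using Q by (subst card_le_Suc0_iff_eq[symmetric]) (auto simp: single_def)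
        then have "j = j'" if "j \<in> Y"
          using j j' that fin(2) by blast
        then show "override T (ind U) x j = override T (ind U) z j"
          using x j' by (cases "j \<in> Y") (auto simp: override_def)
      qed
      have e2: "sparse_eval Q (override T (ind U) x) = sparse_eval Q (override T (ind (U \<inter> C G)) x)"
        if Q: "\<not> single Q" "Q \<in> set G" for Q
      proof (rule sparse_eval_cong)
        fix j assume j: "j \<in> sparse_vars Q"
        have "j \<in> C G" if "j \<in> T"
        proof -
          have "2 \<le> card (sparse_vars Q \<inter> Y)" using Q(1) j that by (auto simp: single_def)
          then have "j \<in> collisions G Y" using Q(2) j that fin(2) unfolding collisions_def by blast
          then show ?thesis using that by (simp add: C_def)
        qed
        then show "override T (ind U) x j = override T (ind (U \<inter> C G)) x j"
          by (auto simp: override_def)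
      qed
      have part: "gate_eval H y = prod_list (map (\<lambda>Q. sparse_eval Q y) (filter single H)) *
          prod_list (map (\<lambda>Q. sparse_eval Q y) (filter (\<lambda>Q. \<not> single Q) H))" for H y
        by (induction H) (auto simp: mult_ac)
      show ?thesis unfolding part a_def b_def
        using e1 e2 by (intro arg_cong2[of _ _ _ _ "(*)"] arg_cong[of _ _ prod_list] map_cong) auto
    qed
    have "(\<Sum>U\<in>Pow T. \<kappa> U * gate_eval G (override T (ind U) x)) =
        (\<Sum>U\<in>Pow T. \<Sum>\<eta>\<in>Pow (C G). if U \<inter> C G = \<eta> then b \<eta> * (a G U * \<kappa> U) else 0)"
      using finC by (intro sum.cong) (auto simp: ev mult_ac)
    also have "\<dots> = (\<Sum>\<eta>\<in>Pow (C G). \<Sum>U\<in>Pow T. if U \<inter> C G = \<eta> then b \<eta> * (a G U * \<kappa> U) else 0)"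
      by (rule sum.swap)
    also have "\<dots> = (\<Sum>\<eta>\<in>Pow (C G). b \<eta> * (\<Sum>U\<in>Pow T. (if U \<inter> C G = \<eta> then a G U else 0) * \<kappa> U))"
      unfolding sum_distrib_left by (intro sum.cong) auto
    finally have eq: "(\<Sum>U\<in>Pow T. \<kappa> U * gate_eval G (override T (ind U) x)) = \<dots>" .
    show ?thesis unfolding eq
    proof (rule nz_sum)
      fix \<eta> assume "\<eta> \<in> Pow (C G)"
      then have "(i, \<eta>) \<in> I" using i by (simp add: I_def)
      from bspec[OF \<kappa>(2) this]
      have "\<not> nz (\<Sum>U\<in>Pow T. (if U \<inter> C G = \<eta> then a G U else 0) * \<kappa> U)"
        unfolding fst_conv snd_conv i(2) .
      then show "\<not> nz (b \<eta> * (\<Sum>U\<in>Pow T. (if U \<inter> C G = \<eta> then a G U else 0) * \<kappa> U))"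
        by (simp add: nz_mult)
    qed
  qed
  have "\<not> nz (\<Sum>U\<in>Pow T. \<kappa> U * form_eval f (override T (ind U) x))"
    if x: "\<forall>i. i \<notin> Y \<longrightarrow> x i = z i" for x
  proof -
    have "(\<Sum>U\<in>Pow T. \<kappa> U * form_eval f (override T (ind U) x)) =
        (\<Sum>G\<leftarrow>f. \<Sum>U\<in>Pow T. \<kappa> U * gate_eval G (override T (ind U) x))"
      by (induction f) (simp_all add: distrib_left sum.distrib)
    then show ?thesis using nz_sum_list[of f] gate x by simp
  qed
  then show ?thesis using \<kappa>(1) by blast
qed

end

section \<open>Primes in polynomially long intervals\<close>

text \<open>The entries \<open>1 / (k * (n choose k))\<close> of the Leibniz harmonic triangle are differences of the
  entries above them, hence integral combinations of the \<open>1 / j\<close>.\<close>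

lemma leibniz_triangle:
  assumes "\<And>j. 1 \<le> j \<Longrightarrow> j \<le> n \<Longrightarrow> j dvd d" "1 \<le> k" "k \<le> n"
  shows "k * (n choose k) dvd d"
proof -
  have "of_nat d / (of_nat (k * (n choose k)) :: real) \<in> \<int>"
    using assms(2,1,3)
  proof (induction k arbitrary: n rule: dec_induct)
    case base
    then obtain c where "d = n * c" by fastforce
    then show ?case using base by auto
  next
    case (step k)
    obtain k' n' where kn: "k = Suc k'" "n = Suc n'"
      using step by (cases k; cases n) auto
    have n: "k \<le> n'" using step.prems kn by simp
    define A B where "A = real (n' choose k')" and "B = real (n' choose k)"
    have pos: "0 < A" "0 < B" using n by (simp_all add: A_def B_def kn)
    have rat: "real (n choose k) = A + B" by (simp add: A_def B_def kn)
    have "real (Suc k' * (Suc n' choose Suc k')) = real (Suc n' * (n' choose k'))"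
      by (simp only: Suc_times_binomial)
    then have "real k * real (n choose k) = real n * A"
      unfolding A_def kn by (simp only: of_nat_mult)
    then have e1: "real k * (A + B) = real n * A" by (simp only: rat)
    have "real (Suc k * (Suc n' choose Suc k)) = real (Suc n' * (n' choose k))"
      by (simp only: Suc_times_binomial)
    then have e2: "real (Suc k) * real (n choose Suc k) = real n * B"
      unfolding B_def kn by (simp only: of_nat_mult)
    \<comment> \<open>The rule of the triangle, \<open>1 / ((k + 1) * (n choose (k + 1)))\<close> is
      \<open>1 / (k * ((n - 1) choose k))\<close> minus \<open>1 / (k * (n choose k))\<close>, so
      both terms on the right are integral after multiplication by \<open>d\<close>.\<close>
    have "real d / (real (Suc k) * real (n choose Suc k)) =
        real d / (real k * B) - real d / (real n * A)"
    proof -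
      have k: "real k = real n * A / (A + B)" using e1 pos by (simp add: field_simps)
      have "real n > 0" by (simp add: kn)
      then show ?thesis unfolding e2 k using pos by (simp add: field_simps)
    qed
    also have "real n * A = real k * (A + B)" using e1 by simp
    also have "real d / (real k * B) - real d / (real k * (A + B)) =
        real d / real (k * (n' choose k)) - real d / real (k * (n choose k))"
      by (simp add: rat B_def)
    also have "\<dots> \<in> \<int>"
      using step.IH[of n'] step.IH[of n] step.prems n kn by (intro Ints_diff) auto
    finally show ?case by (simp only: of_nat_mult)
  qed
  then obtain z :: int where z: "real d / real (k * (n choose k)) = of_int z" by (auto elim: Ints_cases)
  have "0 < k * (n choose k)" using assms by simp
  then have "real d = of_int z * real (k * (n choose k))" using z by (simp add: field_simps)
  then have "int d = z * int (k * (n choose k))" by (metis of_int_eq_iff of_int_mult of_int_of_nat_eq)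
  then have "int (k * (n choose k)) dvd int d" by simp
  then show ?thesis using int_dvd_int_iff by blast
qed

text \<open>If there were no such prime, the numbers up to \<open>N = 4 * x\<^sup>2\<close> would
  have a common multiple \<open>d\<close> built from at most \<open>x\<close> primes, each with a
  power at most \<open>N\<close>, so \<open>d \<le> N ^ x\<close>. But
  \<open>leibniz_triangle\<close> makes \<open>d\<close> a multiple of
  \<open>M * (2 * M choose M)\<close> with \<open>2 * M = N\<close>, which is at least
  \<open>4 ^ M / 2\<close>.\<close>

lemma prime_between:
  fixes x :: nat
  assumes "4 \<le> x"
  shows "\<exists>p. Factorial_Ring.prime p \<and> x < p \<and> p \<le> 4 * x\<^sup>2"
proof (rule ccontr)
  assume no: "\<not> ?thesis"
  define N where "N = 4 * x\<^sup>2"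
  define P where "P = {p. Factorial_Ring.prime p \<and> p \<le> x}"
  have "P \<subseteq> {1..x}" by (auto simp: P_def dest: prime_gt_0_nat)
  then have P: "finite P" "card P \<le> x" using finite_subset card_mono[of "{1..x}" P] by auto
  have N: "x \<le> N" "0 < N" using assms by (auto simp: N_def power2_eq_square)
  define E where "E p = Max {e. p ^ e \<le> N}" for p :: nat
  have fin: "finite {e. p ^ e \<le> N}" if "p \<in> P" for p
  proof -
    have "2 \<le> p" using that prime_ge_2_nat by (auto simp: P_def)
    then have "e < p ^ e" for e
      by (metis less_exp order_less_le_trans power_mono zero_le_numeral)
    then have "{e. p ^ e \<le> N} \<subseteq> {..<N}" using less_le_trans by blast
    then show ?thesis using finite_subset by blast
  qed
  define d where "d = (\<Prod>p\<in>P. p ^ E p)"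
  have dvd: "j dvd d" if "1 \<le> j" "j \<le> N" for j
  proof -
    have pf: "prime_factors j \<subseteq> P"
    proof
      fix p assume p: "p \<in> prime_factors j"
      then have "p dvd j" by auto
      then have "p \<le> j" using that by (intro dvd_imp_le) auto
      then have "p \<le> N" using that by simp
      then show "p \<in> P" using p no by (auto simp: P_def N_def not_less)
    qed
    have "p ^ multiplicity p j dvd p ^ E p" if p: "p \<in> prime_factors j" for p
    proof -
      have "p ^ multiplicity p j \<le> j" using that \<open>1 \<le> j\<close> by (intro dvd_imp_le multiplicity_dvd) auto
      then have "multiplicity p j \<in> {e. p ^ e \<le> N}" using \<open>j \<le> N\<close> by simp
      then have "multiplicity p j \<le> E p" unfolding E_def using fin pf p by (intro Max_ge) auto
      then show ?thesis by (rule le_imp_power_dvd)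
    qed
    then have "(\<Prod>p\<in>prime_factors j. p ^ multiplicity p j) dvd d"
      unfolding d_def using P(1) pf by (intro prod_dvd_prod_subset2) auto
    then show ?thesis using prime_factorization_nat[of j] that by simp
  qed
  have "p ^ E p \<le> N" if "p \<in> P" for p
  proof -
    have "{e. p ^ e \<le> N} \<noteq> {}" using N by (auto intro!: exI[of _ 0])
    then have "E p \<in> {e. p ^ e \<le> N}" unfolding E_def using fin[OF that] by (intro Max_in)
    then show ?thesis by simp
  qed
  then have "d \<le> (\<Prod>p\<in>P. N)" unfolding d_def by (intro prod_mono) auto
  also have "\<dots> \<le> N ^ x" using P(2) N by (simp add: power_increasing)
  finally have dN: "d \<le> N ^ x" .
  define M where "M = 2 * x\<^sup>2"
  have M: "2 * M = N" "0 < M" using assms by (auto simp: M_def N_def)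
  have "M * (2 * M choose M) dvd d"
    using dvd M by (intro leibniz_triangle) auto
  moreover have "0 < d" unfolding d_def
    by (intro prod_pos) (auto simp: P_def prime_gt_0_nat)
  ultimately have le: "M * (2 * M choose M) \<le> d" by (rule dvd_imp_le)
  have "real (4 ^ M) \<le> real (2 * M choose M) * (2 * real M)"
    using central_binomial_lower_bound[OF M(2)] M(2) by (simp add: field_simps)
  also have "\<dots> = real (2 * (M * (2 * M choose M)))" by simp
  finally have "(4::nat) ^ M \<le> 2 * (M * (2 * M choose M))" by (simp only: of_nat_le_iff)
  then have 1: "(4::nat) ^ M \<le> 2 * N ^ x" using le dN by linarith
  \<comment> \<open>The hypothesis \<open>4 \<le> x\<close> enters here:
    \<open>x \<le> 2 ^ (x - 2)\<close> gives \<open>N \<le> 2 ^ (2 * x)\<close>, so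
    \<open>2 * N ^ x\<close> is at most \<open>2 ^ (2 * x * x + 1)\<close>, which is below
    \<open>4 ^ M = 2 ^ (4 * x * x)\<close>.\<close>
  obtain y where y: "x = y + 4" using assms le_Suc_ex add.commute by metis
  have "y + 4 \<le> 2 ^ (y + 2)" by (induction y) auto
  then have "x \<le> 2 ^ (x - 2)" unfolding y by simp
  then have "x * x \<le> 2 ^ (x - 2) * 2 ^ (x - 2)" using mult_le_mono by blast
  also have "\<dots> = 2 ^ (2 * x - 4)" using assms by (simp flip: power_add add: mult_2)
  finally have "4 * (x * x) \<le> 2 ^ 2 * 2 ^ (2 * x - 4)" by simp
  also have "\<dots> = 2 ^ (2 + (2 * x - 4))" by (rule power_add[symmetric])
  also have "\<dots> \<le> 2 ^ (2 * x)" using assms by (intro power_increasing) auto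
  finally have "N \<le> 2 ^ (2 * x)" by (simp add: N_def power2_eq_square)
  then have "2 * N ^ x \<le> 2 * (2 ^ (2 * x)) ^ x" by (intro mult_left_mono power_mono) auto
  also have "\<dots> = 2 ^ Suc (2 * x * x)" by (simp add: power_mult)
  also have "\<dots> < 2 ^ (2 * M)"
    using mult_le_mono[OF assms assms]
    by (intro power_strict_increasing) (auto simp: M_def power2_eq_square)
  also have "\<dots> = 4 ^ M" by (simp add: power_mult)
  finally show False using 1 by simp
qed

section \<open>Polynomial hashing\<close>

text \<open>Dividing out one root \<open>w\<close> leaves a polynomial with one coefficient fewer
  that vanishes modulo \<open>p\<close> at the other points of \<open>W\<close>.\<close>

lemma prime_dvd_coefficients:
  fixes c :: "nat \<Rightarrow> int"
  assumes p: "Factorial_Ring.prime p" and "finite W" "card W = s"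
    and "\<And>x y. x \<in> W \<Longrightarrow> y \<in> W \<Longrightarrow> x \<noteq> y \<Longrightarrow> \<not> p dvd x - y"
    and "\<And>z. z \<in> W \<Longrightarrow> p dvd (\<Sum>i<s. c i * z ^ i)" "i < s"
  shows "p dvd c i"
  using assms(2-)
proof (induction s arbitrary: W c i)
  case (Suc s)
  obtain w where w: "w \<in> W" using Suc.prems(2) by fastforce
  \<comment> \<open>The coefficients of the quotient on division by \<open>z - w\<close>.\<close>
  define b where "b j = (\<Sum>k=Suc j..s. c k * w ^ (k - Suc j))" for j
  have diff: "(\<Sum>i<Suc s. c i * z ^ i) - (\<Sum>i<Suc s. c i * w ^ i) = (z - w) * (\<Sum>j<s. b j * z ^ j)" for z
    unfolding b_def lessThan_Suc_atMost sum_distrib_right by (rule sub_polyfun)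
  have b: "p dvd b j" if "j < s" for j
  proof (rule Suc.IH[of "W - {w}"])
    fix z assume z: "z \<in> W - {w}"
    have "p dvd (z - w) * (\<Sum>j<s. b j * z ^ j)"
      using Suc.prems(4)[of z] Suc.prems(4)[of w] z w unfolding diff[symmetric] by (intro dvd_diff) auto
    moreover have "\<not> p dvd z - w" using Suc.prems(3) z w by auto
    ultimately show "p dvd (\<Sum>j<s. b j * z ^ j)" using p prime_dvd_multD by blast
  qed (use Suc.prems w that in auto)
  then have b': "p dvd b j" for j by (cases "j < s") (auto simp: b_def)
  \<comment> \<open>The division read backwards: \<open>c (Suc j) = b j - w * b (Suc j)\<close>.
    Only \<open>c 0\<close> remains, and the root \<open>w\<close> itself takes care of it.\<close>
  have pos: "p dvd c (Suc j)" if "j < s" for j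
  proof -
    have "b j = c (Suc j) + (\<Sum>k=Suc (Suc j)..s. c k * w ^ (k - Suc j))"
      unfolding b_def using that by (subst sum.atLeast_Suc_atMost) auto
    also have "(\<Sum>k=Suc (Suc j)..s. c k * w ^ (k - Suc j)) = w * b (Suc j)"
      unfolding b_def sum_distrib_left
      by (intro sum.cong) (auto simp: Suc_diff_Suc simp flip: power_Suc)
    finally show ?thesis using b'[of j] b'[of "Suc j"] by (metis dvd_add_left_iff dvd_mult)
  qed
  show ?case
  proof (cases i)
    case 0
    have "(\<Sum>i<Suc s. c i * w ^ i) = c 0 + (\<Sum>i<s. c (Suc i) * w ^ Suc i)"
      by (subst sum.lessThan_Suc_shift) simp
    moreover have "p dvd (\<Sum>i<s. c (Suc i) * w ^ Suc i)" using pos by (intro dvd_sum) auto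
    ultimately show ?thesis using Suc.prems(4)[OF w] 0 by (simp only: dvd_add_left_iff)
  qed (use pos Suc.prems in auto)
qed simp

definition hash :: "nat \<Rightarrow> nat \<Rightarrow> nat \<Rightarrow> (nat \<Rightarrow> nat) \<Rightarrow> nat \<Rightarrow> nat" where
  "hash p m s a j = (\<Sum>i<s. a i * j ^ i) mod p mod m"

text \<open>\<open>s\<close>-wise independence as a counting bound. Modulo \<open>p\<close> the
  \<open>s\<close> coefficients are determined by the values at \<open>s\<close> points, so
  \<open>a\<close> embeds into the tuples of values, each of which lies in the residue class of
  \<open>b\<close> modulo \<open>m\<close>.\<close>

lemma card_hash_preimage:
  assumes p: "Factorial_Ring.prime p" and W: "W \<subseteq> {..<p}" "card W = s"
  shows "card {a \<in> {..<s} \<rightarrow>\<^sub>E {..<p}. \<forall>j\<in>W. hash p m s a j = b} \<le> card {y\<in>{..<p}. y mod m = b} ^ s"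
proof -
  define \<Phi> where "\<Phi> a = restrict (\<lambda>j. (\<Sum>i<s. a i * j ^ i) mod p) W" for a :: "nat \<Rightarrow> nat"
  let ?S = "{a \<in> {..<s} \<rightarrow>\<^sub>E {..<p}. \<forall>j\<in>W. hash p m s a j = b}"
  have finW: "finite W" using W finite_subset by blast
  have p0: "0 < p" using p prime_gt_0_nat by blast
  have "inj_on \<Phi> ?S"
  proof (rule inj_onI)
    fix a a' assume a: "a \<in> ?S" "a' \<in> ?S" "\<Phi> a = \<Phi> a'"
    have "int p dvd int (a i) - int (a' i)" if "i < s" for i
    proof (rule prime_dvd_coefficients[where c = "\<lambda>i. int (a i) - int (a' i)" and W = "int ` W" and s = s])
      fix z assume "z \<in> int ` W"
      then obtain j where j: "j \<in> W" "z = int j" by blast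
      have "(\<Sum>i<s. a i * j ^ i) mod p = (\<Sum>i<s. a' i * j ^ i) mod p"
        using fun_cong[OF a(3), of j] j by (simp add: \<Phi>_def)
      then have "int (\<Sum>i<s. a i * j ^ i) mod int p = int (\<Sum>i<s. a' i * j ^ i) mod int p"
        by (metis zmod_int)
      then have "int p dvd int (\<Sum>i<s. a i * j ^ i) - int (\<Sum>i<s. a' i * j ^ i)"
        by (rule mod_eq_dvd_iff[THEN iffD1])
      then show "int p dvd (\<Sum>i<s. (int (a i) - int (a' i)) * z ^ i)"
        by (simp add: j left_diff_distrib sum_subtractf)
    next
      fix x y assume "x \<in> int ` W" "y \<in> int ` W" "x \<noteq> y"
      then obtain j j' where j: "x = int j" "y = int j'" "j \<noteq> j'" "j < p" "j' < p" using W by auto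
      then have "0 < \<bar>x - y\<bar>" "\<bar>x - y\<bar> < int p" by auto
      then show "\<not> int p dvd x - y" using zdvd_not_zless by (metis dvd_abs_iff)
    qed (use p finW W(2) that in \<open>auto simp: card_image\<close>)
    then have "a i = a' i" if "i < s" for i
    proof -
      have "int (a i) mod int p = int (a' i) mod int p"
        using \<open>\<And>i. i < s \<Longrightarrow> int p dvd int (a i) - int (a' i)\<close>[OF that] by (rule mod_eq_dvd_iff[THEN iffD2])
      moreover have "a i < p" "a' i < p" using a(1,2) that by auto
      ultimately show ?thesis by simp
    qed
    then show "a = a'" using a(1,2) by (intro PiE_ext[of a "{..<s}" "\<lambda>_. {..<p}" a']) auto
  qed
  moreover have "\<Phi> ` ?S \<subseteq> W \<rightarrow>\<^sub>E {y\<in>{..<p}. y mod m = b}"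
    using p0 by (auto simp: \<Phi>_def hash_def)
  moreover have "finite (W \<rightarrow>\<^sub>E {y\<in>{..<p}. y mod m = b})" using finW by (intro finite_PiE) auto
  ultimately have "card ?S \<le> card (W \<rightarrow>\<^sub>E {y\<in>{..<p}. y mod m = b})" by (rule card_inj_on_le)
  also have "\<dots> = card {y\<in>{..<p}. y mod m = b} ^ s" using finW W(2) by (simp add: card_PiE)
  finally show ?thesis .
qed

text \<open>A class has at most \<open>p div m + 1\<close> elements; \<open>m \<le> p\<close>
  absorbs the rounding into a factor 2.\<close>

lemma card_residue_class:
  fixes p m b :: nat
  assumes "0 < m" "m \<le> p"
  shows "m * card {y\<in>{..<p}. y mod m = b} \<le> 2 * p"
proof -
  have "inj_on (\<lambda>y. y div m) {y\<in>{..<p}. y mod m = b}"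
    by (intro inj_onI) (metis (mono_tags, lifting) div_mult_mod_eq mem_Collect_eq)
  moreover have "(\<lambda>y. y div m) ` {y\<in>{..<p}. y mod m = b} \<subseteq> {..p div m}"
    by (auto intro!: div_le_mono)
  ultimately have "card {y\<in>{..<p}. y mod m = b} \<le> card {..p div m}"
    using card_inj_on_le[of _ _ "{..p div m}"] by blast
  then have "m * card {y\<in>{..<p}. y mod m = b} \<le> m * Suc (p div m)" by (intro mult_le_mono2) simp
  also have "\<dots> \<le> m + p" by simp
  finally show ?thesis using assms by simp
qed

section \<open>Disjoint pairs of colliding variables\<close>

abbreviation flat :: "('b \<times> 'b) list \<Rightarrow> 'b list" where
  "flat ps \<equiv> concat (map (\<lambda>(i, j). [i, j]) ps)"

lemma length_flat: "length (flat ps) = 2 * length ps"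
  by (induction ps) auto

lemma obtain_pairs:
  assumes "finite S"
  shows "\<exists>ps. distinct (flat ps) \<and> set (flat ps) \<subseteq> S \<and> length ps = card S div 2"
  using assms
proof (induction "card S" arbitrary: S rule: less_induct)
  case less
  show ?case
  proof (cases "card S < 2")
    case False
    then obtain i where i: "i \<in> S" by fastforce
    then have "card (S - {i}) \<noteq> 0" using False less.prems by simp
    then have "S - {i} \<noteq> {}" by force
    then obtain j where j: "j \<in> S" "j \<noteq> i" by blast
    define S' where "S' = S - {i, j}"
    have c: "card S' = card S - 2" using i j less.prems by (simp add: S'_def card_Diff_insert)
    then obtain ps where "distinct (flat ps)" "set (flat ps) \<subseteq> S'" "length ps = card S' div 2"
      using less.hyps[of S'] False less.prems by (auto simp: S'_def)
    then show ?thesis using i j c False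
      by (intro exI[of _ "(i, j) # ps"]) (auto simp: S'_def)
  qed (auto intro!: exI[of _ "[]"])
qed

definition partners :: "'r sparse list \<Rightarrow> (nat \<times> nat) set" where
  "partners G = \<Union> ((\<lambda>Q. sparse_vars Q \<times> sparse_vars Q) ` set G)"

lemma partners_simps [simp]:
  "partners [] = {}" "partners (Q # G) = sparse_vars Q \<times> sparse_vars Q \<union> partners G"
  by (auto simp: partners_def)

text \<open>Each sum has at most \<open>k\<close> times as many pairs as variables, and by
  disjointness these numbers of variables add up to that of the gate.\<close>

lemma card_partners:
  assumes "finite (gate_vars G)" "disjoint_gate G" "\<forall>Q\<in>set G. card (sparse_vars Q) \<le> k"
  shows "card (partners G) \<le> card (gate_vars G) * k"
  using assms
proof (induction G)
  case (Cons Q G)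
  have "card (partners (Q # G)) \<le> card (sparse_vars Q \<times> sparse_vars Q) + card (partners G)"
    by (simp add: card_Un_le)
  also have "\<dots> \<le> card (sparse_vars Q) * k + card (gate_vars G) * k"
    using Cons by (intro add_mono) (auto simp: card_cartesian_product)
  also have "\<dots> = card (gate_vars (Q # G)) * k"
    using Cons.prems by (simp add: card_Un_disjoint distrib_right)
  finally show ?case .
qed simp

lemma collisions_simps [simp]:
  "collisions [] Y = {}"
  "collisions (Q # G) Y =
     (if 2 \<le> card (sparse_vars Q \<inter> Y) then sparse_vars Q \<inter> Y else {}) \<union> collisions G Y"
  by (auto simp: collisions_def)

lemma collisions_subset: "collisions G Y \<subseteq> gate_vars G \<inter> Y"
  by (auto simp: collisions_def gate_vars_def)

text \<open>A group of \<open>s \<ge> 2\<close> colliding variables of one sum contains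
  \<open>s div 2\<close> disjoint pairs, which is at least \<open>s / 3\<close>; the worst case is
  \<open>s = 3\<close>.\<close>

lemma collisions_pairs:
  assumes "finite (gate_vars G)" "disjoint_gate G"
  shows "\<exists>ps. distinct (flat ps) \<and> set (flat ps) \<subseteq> collisions G Y \<and> set ps \<subseteq> partners G \<and>
    card (collisions G Y) \<le> 3 * length ps"
  using assms
proof (induction G)
  case (Cons Q G)
  then obtain ps where ps: "distinct (flat ps)" "set (flat ps) \<subseteq> collisions G Y" "set ps \<subseteq> partners G"
    "card (collisions G Y) \<le> 3 * length ps" by auto
  show ?case
  proof (cases "2 \<le> card (sparse_vars Q \<inter> Y)")
    case True
    define S where "S = sparse_vars Q \<inter> Y"
    have S: "finite S" "2 \<le> card S" using True Cons.prems by (auto simp: S_def)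
    obtain qs where qs: "distinct (flat qs)" "set (flat qs) \<subseteq> S" "length qs = card S div 2"
      using obtain_pairs[OF S(1)] by blast
    have "S \<inter> collisions G Y = {}"
      using Cons.prems(2) collisions_subset[of G Y] by (auto simp: S_def)
    then have "set (flat qs) \<inter> set (flat ps) = {}" using qs(2) ps(2) by blast
    then have "distinct (flat (qs @ ps))"
      using qs(1) ps(1) by (simp only: map_append concat_append distinct_append)
    moreover have "set qs \<subseteq> sparse_vars Q \<times> sparse_vars Q" using qs(2) by (force simp: S_def)
    moreover have "card (collisions (Q # G) Y) \<le> 3 * length (qs @ ps)"
    proof -
      have "card (collisions (Q # G) Y) \<le> card S + card (collisions G Y)"
        using True by (simp add: S_def card_Un_le)
      also have "card S \<le> 3 * (card S div 2)" using S(2) by presburger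
      finally show ?thesis using ps qs(3) by simp
    qed
    moreover have "set (flat (qs @ ps)) \<subseteq> collisions (Q # G) Y"
      using qs(2) ps(2) True unfolding S_def
      by (simp only: map_append concat_append set_append collisions_simps if_True) blast
    moreover have "set (qs @ ps) \<subseteq> partners (Q # G)"
      using \<open>set qs \<subseteq> _\<close> ps(3) by auto
    ultimately show ?thesis by blast
  qed (use ps in \<open>auto intro!: exI[of _ ps]\<close>)
qed (auto intro!: exI[of _ "[]"])

text \<open>More than \<open>3 * t\<close> collisions in a part yield \<open>t\<close> disjoint pairs of partners in that part, and
  \<open>2 * t\<close>-wise independence allows a union bound over all choices of pairs.\<close>

lemma hash_few_collisions:
  fixes f :: "'r sparse list list"
  assumes p: "Factorial_Ring.prime p" "n \<le> p" "m \<le> p" and pos: "0 < m" "0 < n * k" "8 * (n * k) \<le> m\<^sup>2"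
    and f: "small_form k f" "form_vars f \<subseteq> {..<n}" and t: "length f * m < 2 ^ t"
  shows "\<exists>a \<in> {..<2 * t} \<rightarrow>\<^sub>E {..<p}. \<forall>G\<in>set f. \<forall>b<m.
    card (collisions G {j. j < n \<and> hash p m (2 * t) a j = b}) \<le> 3 * t"
proof -
  let ?A = "{..<2 * t} \<rightarrow>\<^sub>E {..<p}"
  \<comment> \<open>Disjointness of the \<open>t\<close> pairs yields \<open>2 * t\<close> distinct
    arguments, exactly as many as the hash function has coefficients.\<close>
  define PS where "PS G = {ps. set ps \<subseteq> partners G \<and> length ps = t \<and> distinct (flat ps)}" for G :: "'r sparse list"
  define bad where "bad G b ps = {a \<in> ?A. \<forall>j\<in>set (flat ps). hash p m (2 * t) a j = b}" for G :: "'r sparse list" and b ps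
  define Bad where "Bad = (\<Union>G\<in>set f. \<Union>b\<in>{..<m}. \<Union>ps\<in>PS G. bad G b ps)"
  have G: "gate_vars G \<subseteq> {..<n}" "finite (gate_vars G)" "disjoint_gate G"
    "\<forall>Q\<in>set G. card (sparse_vars Q) \<le> k" if "G \<in> set f" for G
    using that f by (auto simp: form_vars_def small_form_def intro!: finite_subset[of _ "{..<n}"])
  have partn: "partners G \<subseteq> {..<n} \<times> {..<n}" if "G \<in> set f" for G
    using G(1)[OF that] by (fastforce simp: partners_def gate_vars_def)
  have finpart: "finite (partners G)" if "G \<in> set f" for G
    using partn[OF that] finite_subset by blast
  have "PS G \<subseteq> {ps. set ps \<subseteq> partners G \<and> length ps = t}" for G by (auto simp: PS_def)
  then have finPS: "finite (PS G)" and cardPS: "card (PS G) \<le> (n * k) ^ t" if "G \<in> set f" for G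
  proof -
    assume sub: "\<And>G. PS G \<subseteq> {ps. set ps \<subseteq> partners G \<and> length ps = t}"
    have fin: "finite {ps. set ps \<subseteq> partners G \<and> length ps = t}"
      using finpart[OF that] by (rule finite_lists_length_eq)
    show "finite (PS G)" using sub fin finite_subset by blast
    have "card (PS G) \<le> card (partners G) ^ t"
      using card_mono[OF fin sub] card_lists_length_eq[OF finpart[OF that]] by simp
    also have "card (partners G) \<le> card (gate_vars G) * k"
      using G[OF that] by (intro card_partners)
    also have "card (gate_vars G) \<le> n" using G(1)[OF that] card_mono[of "{..<n}"] by fastforce
    finally show "card (PS G) \<le> (n * k) ^ t" by (simp add: power_mono)
  qed
  have cardbad: "m ^ (2 * t) * card (bad G b ps) \<le> (2 * p) ^ (2 * t)"
    if "G \<in> set f" "ps \<in> PS G" for G b ps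
  proof -
    have ps: "length ps = t" "distinct (flat ps)" "set ps \<subseteq> {..<n} \<times> {..<n}"
      using that partn by (auto simp: PS_def)
    have "set (flat ps) \<subseteq> {..<p}" using ps(3) p(2) by fastforce
    moreover have "card (set (flat ps)) = 2 * t" using ps distinct_card length_flat by metis
    ultimately have "card (bad G b ps) \<le> card {y\<in>{..<p}. y mod m = b} ^ (2 * t)"
      unfolding bad_def by (intro card_hash_preimage p)
    then have "m ^ (2 * t) * card (bad G b ps) \<le> (m * card {y\<in>{..<p}. y mod m = b}) ^ (2 * t)"
      by (simp add: power_mult_distrib)
    also have "\<dots> \<le> (2 * p) ^ (2 * t)" using card_residue_class[OF pos(1) p(3)] by (intro power_mono) auto
    finally show ?thesis .
  qed
  have p0: "0 < p" using p prime_gt_0_nat by blast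
  \<comment> \<open>The union bound without fractions. There are at most
    \<open>length f * m * (n * k) ^ t\<close> events, each of probability at most
    \<open>(2 / m) ^ (2 * t)\<close>; as \<open>8 * (n * k) \<le> m\<^sup>2\<close>, their sum is at
    most \<open>length f * m / 2 ^ t < 1\<close>.\<close>
  have "m ^ (2 * t) * card Bad \<le> (\<Sum>G\<in>set f. \<Sum>b<m. \<Sum>ps\<in>PS G. m ^ (2 * t) * card (bad G b ps))"
  proof -
    have "card Bad \<le> (\<Sum>G\<in>set f. card (\<Union>b\<in>{..<m}. \<Union>ps\<in>PS G. bad G b ps))"
      unfolding Bad_def by (rule card_UN_le) simp
    also have "\<dots> \<le> (\<Sum>G\<in>set f. \<Sum>b<m. card (\<Union>ps\<in>PS G. bad G b ps))"
      by (intro sum_mono card_UN_le) simp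
    also have "\<dots> \<le> (\<Sum>G\<in>set f. \<Sum>b<m. \<Sum>ps\<in>PS G. card (bad G b ps))"
      by (intro sum_mono card_UN_le finPS)
    finally have "m ^ (2 * t) * card Bad \<le>
        m ^ (2 * t) * (\<Sum>G\<in>set f. \<Sum>b<m. \<Sum>ps\<in>PS G. card (bad G b ps))"
      by (rule mult_left_mono) simp
    then show ?thesis by (simp only: sum_distrib_left)
  qed
  also have "\<dots> \<le> (\<Sum>G\<in>set f. \<Sum>b<m. \<Sum>ps\<in>PS G. (2 * p) ^ (2 * t))"
    by (intro sum_mono cardbad)
  also have "\<dots> \<le> (\<Sum>G\<in>set f. \<Sum>b<m. (n * k) ^ t * (2 * p) ^ (2 * t))"
    using cardPS by (intro sum_mono) (simp add: mult_right_mono)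
  also have "\<dots> = card (set f) * m * ((n * k) ^ t * (2 * p) ^ (2 * t))" by simp
  also have "\<dots> \<le> length f * m * ((n * k) ^ t * (2 * p) ^ (2 * t))"
    using card_length[of f] by (intro mult_right_mono) auto
  also have "\<dots> < 2 ^ t * ((n * k) ^ t * (2 * p) ^ (2 * t))"
    using t pos p0 by (intro mult_strict_right_mono) auto
  also have "\<dots> = (8 * (n * k)) ^ t * p ^ (2 * t)"
  proof -
    have "(2 * p) ^ (2 * t) = (4 ^ t) * p ^ (2 * t)"
      by (simp add: power_mult_distrib power_mult)
    moreover have "(8 * (n * k)) ^ t = 2 ^ t * 4 ^ t * (n * k) ^ t"
    proof -
      have "8 * (n * k) = 2 * 4 * (n * k)" by simp
      then show ?thesis by (simp only: power_mult_distrib)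
    qed
    ultimately show ?thesis by (simp only: mult_ac)
  qed
  also have "\<dots> \<le> (m\<^sup>2) ^ t * p ^ (2 * t)" using pos by (intro mult_right_mono power_mono) auto
  also have "\<dots> = m ^ (2 * t) * card ?A" by (simp add: power_mult card_PiE)
  finally have "card Bad < card ?A" by (simp add: mult_less_cancel1)
  moreover have "Bad \<subseteq> ?A" by (auto simp: Bad_def bad_def)
  ultimately obtain a where a: "a \<in> ?A" "a \<notin> Bad" by (metis less_irrefl subsetI subset_antisym)
  have "card (collisions G {j. j < n \<and> hash p m (2 * t) a j = b}) \<le> 3 * t" if Gb: "G \<in> set f" "b < m" for G b
  proof (rule ccontr)
    let ?Y = "{j. j < n \<and> hash p m (2 * t) a j = b}"
    assume c: "\<not> ?thesis"
    obtain ps where ps: "distinct (flat ps)" "set (flat ps) \<subseteq> collisions G ?Y" "set ps \<subseteq> partners G"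
      "card (collisions G ?Y) \<le> 3 * length ps"
      using collisions_pairs[OF G(2)[OF Gb(1)] G(3)[OF Gb(1)]] by blast
    have len: "t \<le> length ps" using c ps(4) by simp
    have "ps = take t ps @ drop t ps" by simp
    then have "flat ps = flat (take t ps) @ flat (drop t ps)" by (metis concat_append map_append)
    then have tk: "distinct (flat (take t ps))" "set (flat (take t ps)) \<subseteq> collisions G ?Y"
      using ps(1,2) by auto
    have "take t ps \<in> PS G" unfolding PS_def using tk(1) ps(3) len set_take_subset[of t ps] by auto
    moreover have "a \<in> bad G b (take t ps)"
      unfolding bad_def using a(1) tk(2) collisions_subset[of G ?Y] by blast
    ultimately show False using a(2) Gb unfolding Bad_def by blast
  qed
  then show ?thesis using a(1) by blast
qed

section \<open>Shifts by polynomial curves\<close>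

text \<open>The leading coefficient comes first, so that Horner's scheme reads the coefficients by
  increasing index, as in \<open>curve_Suc\<close>.\<close>

definition curve :: "nat \<Rightarrow> (nat \<Rightarrow> 'r) \<Rightarrow> 'r::comm_ring_1 \<Rightarrow> 'r" where
  "curve L c z = (\<Sum>i<L. c i * z ^ (L - Suc i))"

lemma curve_cong: "(\<And>i. i < L \<Longrightarrow> c i = c' i) \<Longrightarrow> curve L c z = curve L c' z"
  by (auto simp: curve_def intro!: sum.cong)

lemma curve_update:
  assumes "i < L"
  shows "curve L (c(i := x)) z = curve L (c(i := 0)) z + z ^ (L - Suc i) * x"
  unfolding curve_def using assms by (simp add: sum.remove[of _ i] mult.commute)

lemma monic_product_coeffs:
  assumes "finite T"
  shows "\<exists>d. \<forall>z. (\<Prod>j\<in>T. z - e j) = (\<Sum>i<Suc (card T). d i * z ^ i :: 'r::comm_ring_1)"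
  using assms
proof (induction T rule: finite_induct)
  case empty
  then show ?case by (intro exI[of _ "\<lambda>_. 1"]) auto
next
  case (insert w T)
  let ?n = "Suc (card T)"
  obtain d where d: "\<And>z. (\<Prod>j\<in>T. z - e j) = (\<Sum>i<?n. d i * z ^ i)" using insert by blast
  define d' where "d' i = (if i = 0 then 0 else d (i - 1)) - e w * (if i < ?n then d i else 0)" for i
  have "(\<Prod>j\<in>insert w T. z - e j) = (\<Sum>i<Suc ?n. d' i * z ^ i)" for z
  proof -
    have "(\<Sum>i<Suc ?n. d' i * z ^ i) = (\<Sum>i<Suc ?n. (if i = 0 then 0 else d (i - 1)) * z ^ i) -
        (\<Sum>i<Suc ?n. e w * (if i < ?n then d i else 0) * z ^ i)"
      by (simp only: d'_def left_diff_distrib sum_subtractf)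
    also have "(\<Sum>i<Suc ?n. (if i = 0 then 0 else d (i - 1)) * z ^ i) = (\<Sum>i<?n. d i * z ^ Suc i)"
      by (subst sum.lessThan_Suc_shift) simp
    also have "\<dots> = z * (\<Sum>i<?n. d i * z ^ i)" by (simp only: sum_distrib_left power_Suc mult_ac)
    also have "(\<Sum>i<Suc ?n. e w * (if i < ?n then d i else 0) * z ^ i) = (\<Sum>i<?n. e w * (d i * z ^ i))"
      by (subst sum.lessThan_Suc) (simp add: mult.assoc)
    also have "\<dots> = e w * (\<Sum>i<?n. d i * z ^ i)" by (rule sum_distrib_left[symmetric])
    finally show ?thesis using insert d[of z] by (simp add: left_diff_distrib)
  qed
  then show ?case using insert by auto
qed

text \<open>The ideal is now maximal: interpolation needs inverses modulo it.\<close>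

locale maximal_compl = prime_compl +
  assumes nz_inverse: "nz x \<Longrightarrow> \<exists>y. \<not> nz (x * y - 1)"
begin

text \<open>Newton's scheme: a multiple of the product over \<open>T\<close> corrects the value at
  the new node \<open>w\<close> without changing the values at the old nodes.\<close>

lemma interpolation:
  assumes "finite T" "\<And>i j. i \<in> T \<Longrightarrow> j \<in> T \<Longrightarrow> i \<noteq> j \<Longrightarrow> nz (e i - e j)"
  shows "\<exists>c. \<forall>j\<in>T. \<not> nz ((\<Sum>i<card T. c i * e j ^ i) - v j)"
  using assms
proof (induction T rule: finite_induct)
  case (insert w T)
  then obtain c where c: "\<And>j. j \<in> T \<Longrightarrow> \<not> nz ((\<Sum>i<card T. c i * e j ^ i) - v j)" by auto
  obtain d where d: "\<And>z. (\<Prod>j\<in>T. z - e j) = (\<Sum>i<Suc (card T). d i * z ^ i)"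
    using monic_product_coeffs[OF insert.hyps(1), of e] by blast
  have "nz (\<Prod>j\<in>T. e w - e j)" using insert by (auto simp: nz_prod)
  then obtain y where y: "\<not> nz ((\<Prod>j\<in>T. e w - e j) * y - 1)" using nz_inverse by blast
  define a where "a = (v w - (\<Sum>i<card T. c i * e w ^ i))"
  define c' where "c' i = (if i < card T then c i else 0) + y * a * d i" for i
  have ev: "(\<Sum>i<Suc (card T). c' i * z ^ i) =
      (\<Sum>i<card T. c i * z ^ i) + y * a * (\<Prod>j\<in>T. z - e j)" for z
  proof -
    have "(\<Sum>i<Suc (card T). c' i * z ^ i) =
        (\<Sum>i<Suc (card T). (if i < card T then c i else 0) * z ^ i) + (\<Sum>i<Suc (card T). y * a * (d i * z ^ i))"
      by (simp only: c'_def distrib_right sum.distrib mult.assoc)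
    also have "(\<Sum>i<Suc (card T). (if i < card T then c i else 0) * z ^ i) = (\<Sum>i<card T. c i * z ^ i)"
      by (subst sum.lessThan_Suc) simp
    finally show ?thesis by (simp only: d sum_distrib_left)
  qed
  have "\<not> nz ((\<Sum>i<Suc (card T). c' i * e j ^ i) - v j)" if j: "j \<in> insert w T" for j
  proof (cases "j = w")
    case True
    have "(\<Sum>i<card T. c i * e w ^ i) + y * a * (\<Prod>j\<in>T. e w - e j) - v w =
        ((\<Prod>j\<in>T. e w - e j) * y - 1) * a"
      by (simp add: a_def algebra_simps)
    then show ?thesis unfolding ev True using y by (simp add: nz_mult)
  next
    case False
    then have "(\<Prod>j'\<in>T. e j - e j') = 0" using j insert.hyps(1) by (intro prod_zero) auto
    then show ?thesis unfolding ev using c[of j] j False by simp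
  qed
  then show ?case using insert.hyps by (intro exI[of _ c']) simp
qed simp

lemma curve_interpolation:
  fixes e v :: "'b \<Rightarrow> 'a"
  assumes "finite T" "card T = L" "\<And>i j. i \<in> T \<Longrightarrow> j \<in> T \<Longrightarrow> i \<noteq> j \<Longrightarrow> nz (e i - e j)"
  shows "\<exists>c. \<forall>j\<in>T. \<not> nz (curve L c (e j) - v j)"
proof -
  obtain c where c: "\<And>j. j \<in> T \<Longrightarrow> \<not> nz ((\<Sum>i<L. c i * e j ^ i) - v j)"
    using interpolation[OF assms(1), where e = e and v = v] assms(2,3) by auto
  have "curve L (\<lambda>i. c (L - Suc i)) z = (\<Sum>i<L. c i * z ^ i)" for z
    unfolding curve_def by (rule sum.nat_diff_reindex)
  then show ?thesis using c by (intro exI[of _ "\<lambda>i. c (L - Suc i)"]) simp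
qed

text \<open>Interpolation attains prescribed values only modulo the ideal. Since a multiaffine
  function changes by a multiple of the change of the coordinate, it is insensitive to that.\<close>

lemma nz_multiaffine_cong:
  assumes "finite V" "multiaffine V f" "\<And>j. j \<in> V \<Longrightarrow> \<not> nz (x j - y j)" "\<And>j. j \<notin> V \<Longrightarrow> x j = y j"
  shows "nz (f x) \<longleftrightarrow> nz (f y)"
proof -
  have "\<not> nz (f x - f y)"
    using assms
  proof (induction V arbitrary: x rule: finite_induct)
    case empty
    then have "x = y" by auto
    then show ?case by (simp add: nz_0)
  next
    case (insert v V)
    have "\<not> nz (f (x(v := y v)) - f y)"
    proof (rule insert.IH)
      show "multiaffine V f" using insert.prems(1) multiaffine_subset by blast
      show "\<not> nz ((x(v := y v)) j - y j)" if "j \<in> V" for j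
        using insert.prems(2)[of j] that by (cases "j = v") (auto simp: nz_0)
      show "(x(v := y v)) j = y j" if "j \<notin> V" for j
        using insert.prems(3)[of j] that by (cases "j = v") auto
    qed
    moreover have "f (x(v := x v)) - f (x(v := y v)) =
        (x v - y v) * (f (x(v := 1)) - f (x(v := 0)))"
    proof -
      have *: "f (x(v := u)) = f (x(v := 0)) + u * (f (x(v := 1)) - f (x(v := 0)))" for u
        using insert.prems(1) unfolding multiaffine_def by blast
      show ?thesis
        by (simp only: *[of "x v"] *[of "y v"]) (simp add: algebra_simps)
    qed
    then have "\<not> nz (f x - f (x(v := y v)))" using insert.prems(2)[of v] by (simp add: nz_mult)
    ultimately show ?case using nz_add[of "f x - f (x(v := y v))" "f (x(v := y v)) - f y"] by simp
  qed
  then show ?thesis using nz_add_iff[of "f x - f y" "f y"] by (simp add: add.commute)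
qed

text \<open>The coefficients are fixed one after the other for all of \<open>J\<close> at once. The
  invariant is that every \<open>g\<close> is still nonzero at some extension of the prefix; each
  \<open>g\<close> forbids at most \<open>d\<close> values for the next coefficient, and
  \<open>S\<close> has more than \<open>d * card J\<close>.\<close>

lemma avoid_roots:
  fixes J :: "((nat \<Rightarrow> 'a) \<Rightarrow> 'a) set"
  assumes J: "finite J" and S: "finite S" "separated S" "d * card J < card S"
    and poly: "\<And>g c i. g \<in> J \<Longrightarrow> i < L \<Longrightarrow> (\<lambda>z. g (c(i := z))) \<in> polyfun d"
    and dep: "\<And>g c c'. g \<in> J \<Longrightarrow> (\<And>i. i < L \<Longrightarrow> c i = c' i) \<Longrightarrow> g c = g c'"
    and nonzero: "\<And>g. g \<in> J \<Longrightarrow> \<exists>c. nz (g c)"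
  shows "\<exists>c. \<forall>g\<in>J. nz (g c)"
proof -
  have "\<exists>c. \<forall>g\<in>J. \<exists>w. (\<forall>i<l. w i = c i) \<and> nz (g w)" if "l \<le> L" for l
    using that
  proof (induction l)
    case (Suc l)
    then obtain c where c: "\<forall>g\<in>J. \<exists>w. (\<forall>i<l. w i = c i) \<and> nz (g w)" by auto
    then obtain w where w: "\<And>g. g \<in> J \<Longrightarrow> (\<forall>i<l. w g i = c i) \<and> nz (g (w g))" by metis
    define bad where "bad g = {z\<in>S. \<not> nz (g ((w g)(l := z)))}" for g
    have "card (bad g) \<le> d" if "g \<in> J" for g
      unfolding bad_def using that w[OF that] Suc.prems S
      by (intro polyfun_roots[where \<phi> = "\<lambda>z. g ((w g)(l := z))" and w = "w g l"] poly) auto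
    then have "card (\<Union>g\<in>J. bad g) \<le> (\<Sum>g\<in>J. d)"
      using card_UN_le[OF J, of bad] sum_mono[of J "\<lambda>g. card (bad g)" "\<lambda>_. d"] by fastforce
    also have "\<dots> < card S" using S(3) by (simp add: mult.commute)
    finally have "card (\<Union>g\<in>J. bad g) < card S" .
    moreover have "(\<Union>g\<in>J. bad g) \<subseteq> S" by (auto simp: bad_def)
    ultimately obtain z where z: "z \<in> S" "z \<notin> (\<Union>g\<in>J. bad g)" by (metis less_irrefl subsetI subset_antisym)
    have "\<forall>g\<in>J. \<exists>w'. (\<forall>i<Suc l. w' i = (c(l := z)) i) \<and> nz (g w')"
    proof
      fix g assume g: "g \<in> J"
      then have "nz (g ((w g)(l := z)))" using z by (auto simp: bad_def)
      then show "\<exists>w'. (\<forall>i<Suc l. w' i = (c(l := z)) i) \<and> nz (g w')"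
        using w[OF g] by (intro exI[of _ "(w g)(l := z)"]) auto
    qed
    then show ?case by blast
  qed (use nonzero in auto)
  from this[of L] obtain c where c: "\<forall>g\<in>J. \<exists>w. (\<forall>i<L. w i = c i) \<and> nz (g w)" by auto
  have "nz (g c)" if g: "g \<in> J" for g
  proof -
    obtain w where w: "\<forall>i<L. w i = c i" "nz (g w)" using c g by blast
    have "g w = g c" by (rule dep[OF g]) (use w(1) in auto)
    then show ?thesis using w(2) by simp
  qed
  then show ?thesis by blast
qed

lemma polyfun_affine: "(\<lambda>z. a + b * z) \<in> polyfun (Suc d)"
proof -
  have "(\<lambda>z. (a + b * z) * 1) \<in> polyfun (Suc d)" by (intro polyfun_affine_mult polyfun_const)
  then show ?thesis by simp
qed

text \<open>The curve has to meet two kinds of conditions: \<open>top_coeff\<close> is nonzero for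
  each of at most \<open>n ^ L\<close> sets \<open>T\<close>, as \<open>low_support_nonzero\<close>
  demands, and the curve and the curve plus 1 are nonzero at all variables of \<open>Y\<close>, so
  that the point stays admissible for \<open>reduce_to_small\<close> whichever vertex is chosen.
  Each condition is satisfiable and has degree at most \<open>L\<close> in every coefficient, so
  \<open>avoid_roots\<close> meets all of them together.\<close>

lemma part_shift:
  fixes e :: "nat \<Rightarrow> 'a" and n L :: nat
  assumes Y: "Y \<subseteq> {..<n}" and aff: "multiaffine Y f" and L: "0 < L"
    and e: "\<And>i j. i < n \<Longrightarrow> j < n \<Longrightarrow> i \<noteq> j \<Longrightarrow> nz (e i - e j)"
    and S: "finite S" "separated S" "L * (n ^ L + 2 * n) < card S"
    and rel: "\<And>T. T \<subseteq> Y \<Longrightarrow> card T = L \<Longrightarrow> \<exists>\<kappa>. (\<exists>U\<in>Pow T. nz (\<kappa> U)) \<and>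
      (\<forall>x. (\<forall>i. i \<notin> Y \<longrightarrow> x i = z i) \<longrightarrow> \<not> nz (\<Sum>U\<in>Pow T. \<kappa> U * f (override T (ind U) x)))"
    and nonzero: "nz (f z)"
  shows "\<exists>c. \<exists>B\<subseteq>Y. card B < L \<and>
    (\<forall>j\<in>Y. nz (curve L c (e j)) \<and> nz (curve L c (e j) + 1)) \<and>
    nz (f (override Y (shift (\<lambda>j. curve L c (e j)) B) z))"
proof -
  have finY: "finite Y" using Y finite_subset by blast
  define TT where "TT = {T. T \<subseteq> Y \<and> card T = L}"
  have finTT: "finite TT" using finY by (auto simp: TT_def)
  have "card Y \<le> n" using Y card_mono[of "{..<n}"] by fastforce
  have "card TT = card Y choose L" unfolding TT_def using finY by (rule n_subsets)
  also have "\<dots> \<le> card Y ^ L"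
    by (cases "L \<le> card Y") (auto simp: binomial_le_pow binomial_eq_0)
  also have "\<dots> \<le> n ^ L" using \<open>card Y \<le> n\<close> by (rule power_mono) simp
  finally have cardTT: "card TT \<le> n ^ L" .
  have "\<forall>T\<in>TT. \<exists>\<kappa>. (\<exists>U\<in>Pow T. nz (\<kappa> U)) \<and>
      (\<forall>x. (\<forall>i. i \<notin> Y \<longrightarrow> x i = z i) \<longrightarrow> \<not> nz (\<Sum>U\<in>Pow T. \<kappa> U * f (override T (ind U) x)))"
    using rel unfolding TT_def by blast
  from bchoice[OF this] obtain \<kappa> where
    \<kappa>: "\<forall>T\<in>TT. (\<exists>U\<in>Pow T. nz (\<kappa> T U)) \<and>
      (\<forall>x. (\<forall>i. i \<notin> Y \<longrightarrow> x i = z i) \<longrightarrow> \<not> nz (\<Sum>U\<in>Pow T. \<kappa> T U * f (override T (ind U) x)))"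
    by blast
  define \<alpha> where "\<alpha> c = (\<lambda>j. curve L c (e j))" for c
  define J where "J = (\<lambda>T c. top_coeff T (\<kappa> T) (\<alpha> c)) ` TT \<union>
    ((\<lambda>j c. \<alpha> c j) ` Y \<union> (\<lambda>j c. \<alpha> c j + 1) ` Y)"
  have finJ: "finite J" using finTT finY by (simp add: J_def)
  have "card J \<le> card TT + (card Y + card Y)"
    unfolding J_def
    by (intro order_trans[OF card_Un_le] add_mono card_image_le finTT finY)
  also have "\<dots> \<le> n ^ L + 2 * n" using cardTT \<open>card Y \<le> n\<close> by simp
  finally have "L * card J \<le> L * (n ^ L + 2 * n)" by (rule mult_le_mono2)
  then have cardJ: "L * card J < card S" using S(3) by linarith
  have aff_c: "\<alpha> (c(i := x)) j = \<alpha> (c(i := 0)) j + e j ^ (L - Suc i) * x" if "i < L" for c i x j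
    unfolding \<alpha>_def using that by (rule curve_update)
  have top_cong: "top_coeff T g x = top_coeff T g y" if "\<And>j. j \<in> T \<Longrightarrow> x j = y j" for T g x y
    unfolding top_coeff_def using that by (intro sum.cong arg_cong2[of _ _ _ _ "(*)"] prod.cong) auto
  have poly: "(\<lambda>x. g (c(i := x))) \<in> polyfun L" if g: "g \<in> J" and i: "i < L" for g c i
  proof -
    obtain L' where L': "L = Suc L'" using L by (cases L) auto
    consider T where "T \<in> TT" "g = (\<lambda>c. top_coeff T (\<kappa> T) (\<alpha> c))"
      | j where "j \<in> Y" "g = (\<lambda>c. \<alpha> c j)" | j where "j \<in> Y" "g = (\<lambda>c. \<alpha> c j + 1)"
      using \<open>g \<in> J\<close> unfolding J_def by blast
    then show ?thesis
    proof cases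
      case (1 T)
      have T: "finite T" "card T = L" using 1(1) finY finite_subset by (auto simp: TT_def)
      \<comment> \<open>Each of the \<open>L\<close> coordinates in \<open>T\<close> is affine in
        the coefficient \<open>c i\<close>, which gives degree \<open>L\<close>.\<close>
      have "(\<lambda>x. top_coeff T (\<kappa> T) (override T (\<alpha> (c(i := x))) (\<lambda>_. 0))) \<in> polyfun (card T)"
      proof (rule polyfun_multiaffine[where f = "top_coeff T (\<kappa> T)" and y = "\<lambda>_. 0"
            and x = "\<lambda>x. override T (\<alpha> (c(i := x))) (\<lambda>_. 0)"])
        show "override T (\<alpha> (c(i := x))) (\<lambda>_. 0) j = \<alpha> (c(i := 0)) j + e j ^ (L - Suc i) * x"
          if "j \<in> T" for j x
          unfolding override_def using that aff_c[OF i, of c x j] by (simp only: if_True)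
        show "override T (\<alpha> (c(i := x))) (\<lambda>_. 0) j = 0" if "j \<notin> T" for j x
          using that by (simp add: override_def)
      qed (use T(1) multiaffine_top_coeff in auto)
      moreover have "top_coeff T (\<kappa> T) (override T (\<alpha> (c(i := x))) (\<lambda>_. 0)) = g (c(i := x))" for x
        unfolding 1(2) by (rule top_cong) (simp add: override_def)
      ultimately show ?thesis using T by simp
    next
      case (2 j)
      have "(\<lambda>x. g (c(i := x))) = (\<lambda>x. \<alpha> (c(i := 0)) j + e j ^ (L - Suc i) * x)"
        unfolding 2(2) using aff_c[OF i, of c _ j] by (intro ext)
      then show ?thesis using polyfun_affine by (metis L')
    next
      case (3 j)
      have "g (c(i := x)) = (\<alpha> (c(i := 0)) j + 1) + e j ^ (L - Suc i) * x" for x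
        unfolding 3(2) aff_c[OF i, of c x j] by simp
      then have "(\<lambda>x. g (c(i := x))) = (\<lambda>x. (\<alpha> (c(i := 0)) j + 1) + e j ^ (L - Suc i) * x)"
        by (intro ext)
      then show ?thesis using polyfun_affine by (metis L')
    qed
  qed
  have dep: "g c = g c'" if "g \<in> J" "\<And>i. i < L \<Longrightarrow> c i = c' i" for g c c'
  proof -
    have "\<alpha> c = \<alpha> c'" unfolding \<alpha>_def using curve_cong[of L c c'] that(2) by blast
    then show ?thesis using that(1) unfolding J_def by auto
  qed
  have nonz: "\<exists>c. nz (g c)" if "g \<in> J" for g
  proof -
    consider T where "T \<in> TT" "g = (\<lambda>c. top_coeff T (\<kappa> T) (\<alpha> c))"
      | j where "j \<in> Y" "g = (\<lambda>c. \<alpha> c j)" | j where "j \<in> Y" "g = (\<lambda>c. \<alpha> c j + 1)"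
      using \<open>g \<in> J\<close> unfolding J_def by blast
    then show ?thesis
    proof cases
      case (1 T)
      have T: "finite T" "card T = L" "T \<subseteq> Y" using 1(1) finY finite_subset by (auto simp: TT_def)
      obtain U where U: "U \<subseteq> T" "nz (\<kappa> T U)" using \<kappa> 1(1) by blast
      have "nz (top_coeff T (\<kappa> T) (\<lambda>j. 1 - ind U j))" using T(1) U by (rule top_coeff_nonzero)
      \<comment> \<open>With \<open>L\<close> coefficients the curve can take any values on a single
        set \<open>T\<close> of size \<open>L\<close>, in particular those of
        \<open>top_coeff_nonzero\<close>.\<close>
      have "\<exists>c. \<forall>j\<in>T. \<not> nz (curve L c (e j) - (1 - ind U j))"
      proof (rule curve_interpolation[OF T(1,2)])
        fix i j assume "i \<in> T" "j \<in> T" "i \<noteq> j"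
        then show "nz (e i - e j)" using e[of i j] T(3) Y by auto
      qed
      then obtain c where c: "\<forall>j\<in>T. \<not> nz (curve L c (e j) - (1 - ind U j))" by blast
      have "nz (top_coeff T (\<kappa> T) (override T (\<alpha> c) (\<lambda>j. 1 - ind U j)))"
        using \<open>nz (top_coeff T (\<kappa> T) (\<lambda>j. 1 - ind U j))\<close>
        by (subst nz_multiaffine_cong[OF T(1) multiaffine_top_coeff[OF T(1)], of _ "\<lambda>j. 1 - ind U j"])
          (use c in \<open>auto simp: override_def \<alpha>_def\<close>)
      moreover have "top_coeff T (\<kappa> T) (override T (\<alpha> c) (\<lambda>j. 1 - ind U j)) = g c"
        unfolding 1(2) by (rule top_cong) (simp add: override_def)
      ultimately show ?thesis by auto
    next
      case (2 j)
      \<comment> \<open>Index \<open>L - 1\<close> belongs to the constant term, so this is the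
        constant curve 1.\<close>
      have "curve L (\<lambda>i. if i = L - 1 then 1 else 0) (e j) = 1"
        unfolding curve_def using L by (subst sum.remove[of _ "L - 1"]) (auto intro!: sum.neutral)
      then show ?thesis using nz_1 unfolding 2(2) \<alpha>_def by metis
    next
      case (3 j)
      have "curve L (\<lambda>i. 0) (e j) = 0" by (simp add: curve_def)
      then have "curve L (\<lambda>i. 0) (e j) + 1 = 1" by simp
      then show ?thesis using nz_1 unfolding 3(2) \<alpha>_def by metis
    qed
  qed
  have "\<exists>c. \<forall>g\<in>J. nz (g c)"
  proof (rule avoid_roots[OF finJ S(1,2) cardJ])
    show "(\<lambda>x. g (c(i := x))) \<in> polyfun L" if "g \<in> J" "i < L" for g c i
      using that by (rule poly)
    show "g c = g c'" if "g \<in> J" "\<And>i. i < L \<Longrightarrow> c i = c' i" for g c c'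
      using that by (rule dep)
    show "\<exists>c. nz (g c)" if "g \<in> J" for g
      using that by (rule nonz)
  qed
  then obtain c where c: "\<forall>g\<in>J. nz (g c)" by blast
  have "\<exists>B\<subseteq>Y. card B < L \<and> nz (f (override Y (shift (\<alpha> c) B) z))"
  proof (rule low_support_nonzero[OF finY aff _ _ nonzero])
    show "nz (top_coeff T (\<kappa> T) (\<alpha> c))" if "T \<subseteq> Y" "card T = L" for T
      using c that unfolding J_def TT_def by auto
    show "\<not> nz (\<Sum>U\<in>Pow T. \<kappa> T U * f (override T (ind U) x))"
      if T: "T \<subseteq> Y" "card T = L" and x: "\<And>i. i \<notin> Y \<Longrightarrow> x i = z i" for T x
    proof -
      have "T \<in> TT" using T by (simp add: TT_def)
      then show ?thesis using \<kappa> x by blast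
    qed
  qed
  moreover have "\<forall>j\<in>Y. nz (\<alpha> c j) \<and> nz (\<alpha> c j + 1)" using c unfolding J_def by auto
  ultimately show ?thesis unfolding \<alpha>_def by blast
qed

text \<open>The parts are treated one by one, with all variables outside the current part frozen at
  the last nonzero point \<open>z\<close>. Hence the relations of a part may depend on the curves
  chosen before. Fewer than \<open>L\<close> shifted variables per part make at most
  \<open>m * L\<close> in total.\<close>

lemma all_parts_shift:
  fixes e :: "nat \<Rightarrow> 'a" and n L m :: nat and f :: "'a sparse list list"
  assumes f: "form_vars f \<subseteq> {..<n}" "\<forall>G\<in>set f. disjoint_gate G" and L: "0 < L"
    and e: "\<And>i j. i < n \<Longrightarrow> j < n \<Longrightarrow> i \<noteq> j \<Longrightarrow> nz (e i - e j)"
    and S: "finite S" "separated S" "L * (n ^ L + 2 * n) < card S"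
    and h: "\<And>j. j < n \<Longrightarrow> h j < m"
    and coll: "\<And>G b. G \<in> set f \<Longrightarrow> b < m \<Longrightarrow> card (collisions G {j. j < n \<and> h j = b}) \<le> c"
    and len: "length f * 2 ^ c < 2 ^ L"
    and nonzero: "\<exists>x. nz (form_eval f x)"
  shows "\<exists>C B. B \<subseteq> {..<n} \<and> card B \<le> m * L \<and>
    (\<forall>j<n. nz (curve L (C (h j)) (e j)) \<and> nz (curve L (C (h j)) (e j) + 1)) \<and>
    nz (form_eval f (shift (\<lambda>j. curve L (C (h j)) (e j)) B))"
proof -
  have "\<exists>C B z. B \<subseteq> {j. j < n \<and> h j < k} \<and> card B \<le> k * L \<and>
     (\<forall>j<n. h j < k \<longrightarrow> nz (curve L (C (h j)) (e j)) \<and> nz (curve L (C (h j)) (e j) + 1) \<and>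
       z j = shift (\<lambda>j. curve L (C (h j)) (e j)) B j) \<and> nz (form_eval f z)" if "k \<le> m" for k
    using that
  proof (induction k)
    case 0
    then show ?case using nonzero by auto
  next
    case (Suc k)
    then obtain C B z where IH: "B \<subseteq> {j. j < n \<and> h j < k}" "card B \<le> k * L"
     "\<forall>j<n. h j < k \<longrightarrow> nz (curve L (C (h j)) (e j)) \<and> nz (curve L (C (h j)) (e j) + 1) \<and>
       z j = shift (\<lambda>j. curve L (C (h j)) (e j)) B j" "nz (form_eval f z)" by auto
    define Y where "Y = {j. j < n \<and> h j = k}"
    have Y: "Y \<subseteq> {..<n}" "finite Y" by (auto simp: Y_def)
    have aff: "multiaffine Y (form_eval f)"
      using multiaffine_form[OF _ f(2)] f(1) finite_subset by blast
    have rel: "\<exists>\<kappa>. (\<exists>U\<in>Pow T. nz (\<kappa> U)) \<and>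
      (\<forall>x. (\<forall>i. i \<notin> Y \<longrightarrow> x i = z i) \<longrightarrow> \<not> nz (\<Sum>U\<in>Pow T. \<kappa> U * form_eval f (override T (ind U) x)))"
      if T: "T \<subseteq> Y" "card T = L" for T
    proof (rule cube_relation[OF Y(2) T(1)])
      fix G assume "G \<in> set f"
      then have "card (collisions G Y) \<le> c" using coll[of G k] Suc.prems by (simp add: Y_def)
      moreover have "finite (collisions G Y)" using collisions_subset[of G Y] Y(2) finite_subset by blast
      then have "card (collisions G Y \<inter> T) \<le> card (collisions G Y)" by (intro card_mono) auto
      ultimately show "card (collisions G Y \<inter> T) \<le> c" by simp
    qed (use len T in auto)
    have "\<exists>d. \<exists>D\<subseteq>Y. card D < L \<and>
      (\<forall>j\<in>Y. nz (curve L d (e j)) \<and> nz (curve L d (e j) + 1)) \<and>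
      nz (form_eval f (override Y (shift (\<lambda>j. curve L d (e j)) D) z))"
    proof (rule part_shift[OF Y(1) aff L _ S _ IH(4)])
      show "nz (e i - e j)" if "i < n" "j < n" "i \<noteq> j" for i j using that by (rule e)
    qed (rule rel)
    then obtain d D where dD: "D \<subseteq> Y" "card D < L"
      "\<forall>j\<in>Y. nz (curve L d (e j)) \<and> nz (curve L d (e j) + 1)"
      "nz (form_eval f (override Y (shift (\<lambda>j. curve L d (e j)) D) z))"
      by blast
    define C' where "C' = C(k := d)"
    define z' where "z' = override Y (shift (\<lambda>j. curve L d (e j)) D) z"
    have "card (B \<union> D) \<le> Suc k * L" using card_Un_le[of B D] IH(2) dD(2) by simp
    moreover have "B \<union> D \<subseteq> {j. j < n \<and> h j < Suc k}" using IH(1) dD(1) by (auto simp: Y_def)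
    moreover have "nz (curve L (C' (h j)) (e j)) \<and> nz (curve L (C' (h j)) (e j) + 1) \<and>
       z' j = shift (\<lambda>j. curve L (C' (h j)) (e j)) (B \<union> D) j" if j: "j < n" "h j < Suc k" for j
    proof (cases "h j = k")
      case True
      then have "j \<in> Y" "j \<notin> B" using j IH(1) by (auto simp: Y_def)
      then show ?thesis using dD(3) True by (simp add: C'_def z'_def override_def)
    next
      case False
      then have "j \<notin> Y" "j \<notin> D" "h j < k" using j dD(1) by (auto simp: Y_def)
      then show ?thesis using IH(3) j False by (simp add: C'_def z'_def override_def)
    qed
    ultimately show ?case using dD(4) unfolding z'_def[symmetric] by blast
  qed
  from this[of m] obtain C B z where *: "B \<subseteq> {j. j < n \<and> h j < m}" "card B \<le> m * L"
     "\<forall>j<n. h j < m \<longrightarrow> nz (curve L (C (h j)) (e j)) \<and> nz (curve L (C (h j)) (e j) + 1) \<and>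
       z j = shift (\<lambda>j. curve L (C (h j)) (e j)) B j" "nz (form_eval f z)" by auto
  have "form_eval f z = form_eval f (shift (\<lambda>j. curve L (C (h j)) (e j)) B)"
    using * h f(1) by (intro form_eval_cong) blast
  then show ?thesis using * h by (intro exI[of _ C] exI[of _ B]) auto
qed

text \<open>Every coordinate is affine in a single coefficient of a single curve, so the formula has
  degree at most \<open>n\<close> in it, and one of more than \<open>n\<close> separated values
  keeps the formula nonzero. The curve conditions of \<open>part_shift\<close> may be lost; only the
  nonzero value matters now.\<close>

lemma reduce_coefficients:
  fixes e :: "nat \<Rightarrow> 'a" and f :: "'a sparse list list"
  assumes f: "form_vars f \<subseteq> {..<n}" "\<forall>G\<in>set f. disjoint_gate G"
    and S: "finite S" "separated S" "n < card S"
    and P: "finite P" "\<And>b i. (b, i) \<in> P \<Longrightarrow> i < L"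
    and nonzero: "nz (form_eval f (shift (\<lambda>j. curve L (C (h j)) (e j)) B))"
  shows "\<exists>C. (\<forall>(b, i)\<in>P. C b i \<in> S) \<and> nz (form_eval f (shift (\<lambda>j. curve L (C (h j)) (e j)) B))"
  using P
proof (induction P rule: finite_induct)
  case empty
  then show ?case using nonzero by auto
next
  case (insert bi P)
  obtain b i where bi: "bi = (b, i)" by (cases bi)
  obtain C where C: "\<forall>(b, i)\<in>P. C b i \<in> S" "nz (form_eval f (shift (\<lambda>j. curve L (C (h j)) (e j)) B))"
    using insert by blast
  define D where "D x = C(b := (C b)(i := x))" for x
  define y where "y x = shift (\<lambda>j. curve L (D x (h j)) (e j)) B" for x
  have i: "i < L" using insert.prems bi by blast
  have aff: "y x j = (y 0 j) + (if h j = b then e j ^ (L - Suc i) else 0) * x" for x j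
    using curve_update[OF i, of "C b" x "e j"] by (simp add: y_def D_def)
  have "(\<lambda>x. form_eval f (override {..<n} (y x) (\<lambda>_. 0))) \<in> polyfun (card {..<n})"
  proof (rule polyfun_multiaffine[where f = "form_eval f" and y = "\<lambda>_. 0"
        and x = "\<lambda>x. override {..<n} (y x) (\<lambda>_. 0)"])
    show "override {..<n} (y x) (\<lambda>_. 0) j = y 0 j + (if h j = b then e j ^ (L - Suc i) else 0) * x"
      if "j \<in> {..<n}" for j x
      unfolding override_def using that aff[of x j] by (simp only: if_True)
    show "override {..<n} (y x) (\<lambda>_. 0) j = 0" if "j \<notin> {..<n}" for j x
      using that by (simp add: override_def)
  qed (use multiaffine_form[OF finite_subset[OF f(1)] f(2)] in auto)
  moreover have "form_eval f (override {..<n} (y x) (\<lambda>_. 0)) = form_eval f (y x)" for x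
    using f(1) by (intro form_eval_cong) (auto simp: override_def)
  ultimately have pf: "(\<lambda>x. form_eval f (y x)) \<in> polyfun n" by simp
  have "D (C b i) = C" by (simp add: D_def)
  then have "nz (form_eval f (y (C b i)))" using C(2) by (simp add: y_def)
  then have "card {x\<in>S. \<not> nz (form_eval f (y x))} \<le> n"
    by (rule polyfun_roots[OF pf _ S(1,2)])
  then have "{x\<in>S. \<not> nz (form_eval f (y x))} \<noteq> S" using S(3) by auto
  then obtain x where x: "x \<in> S" "nz (form_eval f (y x))" by blast
  have "\<forall>(b', i')\<in>insert bi P. D x b' i' \<in> S"
    using C(1) x(1) bi by (auto simp: D_def)
  then show ?case using x(2) unfolding y_def by blast
qed

theorem hitting_point:
  fixes f :: "'a sparse list list" and n K u :: nat
  defines "m \<equiv> 3 * u\<^sup>2"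
  assumes n: "0 < n" "n \<le> u ^ 3" "u \<le> n"
    and f: "form_vars f \<subseteq> {..<n}" "\<forall>G\<in>set f. disjoint_gate G" "\<exists>x. nz (form_eval f x)"
    and size: "length f \<le> 2 ^ K" "(\<Sum>G\<leftarrow>f. \<Sum>Q\<leftarrow>G. length Q) < 2 ^ K"
    and t: "2 ^ K * m < 2 ^ t" and L: "K + 3 * t < L"
    and p: "Factorial_Ring.prime p" "n \<le> p" "m \<le> p"
    and e: "\<And>i j. i < n \<Longrightarrow> j < n \<Longrightarrow> i \<noteq> j \<Longrightarrow> nz (e i - e j)"
    and S: "finite S" "separated S" "L * (n ^ L + 2 * n) < card S"
    and S0: "finite S0" "separated S0" "n < card S0"
  shows "\<exists>a \<in> {..<2 * t} \<rightarrow>\<^sub>E {..<p}. \<exists>C B. (\<forall>b<m. \<forall>i<L. C b i \<in> S0) \<and> B \<subseteq> {..<n} \<and> card B \<le> 2 * (m * L) \<and>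
    nz (form_eval f (shift (\<lambda>j. curve L (C (hash p m (2 * t) a j)) (e j)) B))"
proof -
  have u: "0 < u" using n by (cases u) auto
  have m: "0 < m" using u by (simp add: m_def)
  \<comment> \<open>As \<open>n \<le> u ^ 3\<close>, this is at least \<open>2 * n / u * K\<close>,
    so the potential shrinks by a factor \<open>exp (- K)\<close>, which beats its initial bound
    \<open>2 ^ K\<close>.\<close>
  define D where "D = 2 * u\<^sup>2 * K"
  have "potential u f \<le> (\<Sum>G\<leftarrow>f. \<Sum>Q\<leftarrow>G. length Q)"
    unfolding potential_def by (intro sum_list_mono) (simp add: weight_def)
  then have "potential u f < 2 ^ K" using size(2) by linarith
  then have pot: "real (potential u f) < 2 ^ K" using of_nat_less_iff[of "potential u f" "2 ^ K", where 'a = real] by simp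
  have small: "real (potential u f) * (1 - real u / (2 * real n)) ^ D < 1"
  proof -
    have "1 - real u / (2 * real n) \<le> exp (- (real u / (2 * real n)))"
      using exp_ge_add_one_self[of "- (real u / (2 * real n))"] by simp
    moreover have nonneg: "0 \<le> 1 - real u / (2 * real n)" using n by (simp add: field_simps)
    ultimately have "(1 - real u / (2 * real n)) ^ D \<le> exp (- (real u / (2 * real n))) ^ D"
      by (intro power_mono)
    also have "\<dots> = exp (- (real D * (real u / (2 * real n))))"
      by (simp flip: exp_of_nat_mult)
    also have "\<dots> \<le> exp (- real K)"
    proof -
      have "real n * real K \<le> real (u ^ 3) * real K"
        using n(2) by (intro mult_right_mono) (auto simp del: of_nat_power)
      also have "real (u ^ 3) * real K = real D * (real u / 2)"
        by (simp add: D_def power2_eq_square power3_eq_cube)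
      finally have "real K \<le> real D * (real u / 2) / real n" using n(1) by (simp add: field_simps)
      then show ?thesis by simp
    qed
    finally have *: "(1 - real u / (2 * real n)) ^ D \<le> exp (- real K)" .
    have "real (potential u f) * (1 - real u / (2 * real n)) ^ D \<le> real (potential u f) * exp (- real K)"
      using * by (intro mult_left_mono) auto
    also have "\<dots> < 2 ^ K * exp (- real K)" using pot by simp
    also have "\<dots> \<le> exp 1 ^ K * exp (- real K)"
      using exp_ge_add_one_self[of 1] by (intro mult_right_mono power_mono) auto
    also have "\<dots> = 1" by (simp flip: exp_of_nat_mult exp_add)
    finally show ?thesis .
  qed
  obtain A g where g: "A \<subseteq> {..<n}" "card A \<le> D" "form_vars g \<subseteq> {..<n} - A" "small_form u g"
    "length g \<le> length f" "\<exists>x. nz (form_eval g x)"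
    "\<And>x. (\<forall>v\<in>{..<n}. nz (x v)) \<Longrightarrow> nz (form_eval g x) \<Longrightarrow> \<exists>B\<subseteq>A. nz (form_eval f (shift x B))"
    using reduce_to_small[of "{..<n}" f n u D] f u n small by auto
  have gd: "\<forall>G\<in>set g. disjoint_gate G" using g(4) by (auto simp: small_form_def)
  have lg: "length g * m < 2 ^ t"
    using t g(5) size(1) mult_le_mono1[of "length g" "2 ^ K" m] by linarith
  \<comment> \<open>The factor 3 in \<open>m\<close> is chosen for this:
    \<open>m\<^sup>2 = 9 * u ^ 4\<close> and \<open>n * u \<le> u ^ 4\<close>.\<close>
  have "8 * (n * u) \<le> m\<^sup>2"
  proof -
    have "8 * (n * u) \<le> 8 * (u ^ 3 * u)" using n(2) by (intro mult_le_mono) auto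
    also have "\<dots> \<le> 9 * (u ^ 3 * u)" by (intro mult_le_mono) auto
    also have "\<dots> = m\<^sup>2" by (simp add: m_def power2_eq_square power3_eq_cube)
    finally show ?thesis .
  qed
  then obtain a where a: "a \<in> {..<2 * t} \<rightarrow>\<^sub>E {..<p}"
    "\<forall>G\<in>set g. \<forall>b<m. card (collisions G {j. j < n \<and> hash p m (2 * t) a j = b}) \<le> 3 * t"
    using hash_few_collisions[OF p m, of u g t] u n(1) g(3,4) lg by auto
  define h where "h = hash p m (2 * t) a"
  have hm: "h j < m" for j using m by (simp add: h_def hash_def)
  \<comment> \<open>The equations against the unknowns in \<open>cube_relation\<close>, for at most
    \<open>3 * t\<close> collisions per gate and part.\<close>
  have "length g * 2 ^ (3 * t) \<le> 2 ^ K * 2 ^ (3 * t)" using g(5) size(1) by (intro mult_right_mono) auto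
  also have "\<dots> < 2 ^ L" using L by (simp flip: power_add)
  finally have len: "length g * 2 ^ (3 * t) < 2 ^ L" .
  have Lpos: "0 < L" using L by simp
  have gv: "form_vars g \<subseteq> {..<n}" using g(3) by blast
  have "\<exists>C B. B \<subseteq> {..<n} \<and> card B \<le> m * L \<and>
    (\<forall>j<n. nz (curve L (C (h j)) (e j)) \<and> nz (curve L (C (h j)) (e j) + 1)) \<and>
    nz (form_eval g (shift (\<lambda>j. curve L (C (h j)) (e j)) B))"
  proof (rule all_parts_shift[OF gv gd Lpos _ S hm _ len g(6)])
    show "nz (e i - e j)" if "i < n" "j < n" "i \<noteq> j" for i j using that by (rule e)
    show "card (collisions G {j. j < n \<and> h j = b}) \<le> 3 * t" if "G \<in> set g" "b < m" for G b
      using a(2) that by (simp add: h_def)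
  qed
  then obtain C B where CB: "B \<subseteq> {..<n}" "card B \<le> m * L"
    "\<forall>j<n. nz (curve L (C (h j)) (e j)) \<and> nz (curve L (C (h j)) (e j) + 1)"
    "nz (form_eval g (shift (\<lambda>j. curve L (C (h j)) (e j)) B))"
    by blast
  define \<alpha> where "\<alpha> = (\<lambda>j. curve L (C (h j)) (e j))"
  \<comment> \<open>Dropping variables that do not occur in \<open>g\<close> makes \<open>B'\<close>
    disjoint from every subset of \<open>A\<close>, so that the two shifts combine into the shift by
    the union.\<close>
  define B' where "B' = B \<inter> form_vars g"
  have "form_eval g (shift \<alpha> B') = form_eval g (shift \<alpha> B)"
    by (rule form_eval_cong) (auto simp: B'_def)
  then have "nz (form_eval g (shift \<alpha> B'))" using CB(4) by (simp add: \<alpha>_def)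
  moreover have "\<forall>v\<in>{..<n}. nz (shift \<alpha> B' v)" using CB(3) by (auto simp: \<alpha>_def)
  ultimately have "\<exists>A'\<subseteq>A. nz (form_eval f (shift (shift \<alpha> B') A'))"
    by (intro g(7))
  then obtain A' where A': "A' \<subseteq> A" "nz (form_eval f (shift (shift \<alpha> B') A'))" by blast
  have "shift (shift \<alpha> B') A' = shift \<alpha> (B' \<union> A')"
    using A'(1) g(3) by (auto simp: fun_eq_iff B'_def)
  then have nzf: "nz (form_eval f (shift (\<lambda>j. curve L (C (h j)) (e j)) (B' \<union> A')))"
    using A'(2) by (simp add: \<alpha>_def)
  have "\<exists>C'. (\<forall>(b, i)\<in>{..<m} \<times> {..<L}. C' b i \<in> S0) \<and>
    nz (form_eval f (shift (\<lambda>j. curve L (C' (h j)) (e j)) (B' \<union> A')))"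
    by (rule reduce_coefficients[where P = "{..<m} \<times> {..<L}" and L = L and e = e and h = h
          and B = "B' \<union> A'" and C = C, OF f(1,2) S0 _ _ nzf]) auto
  then obtain C' where C': "\<forall>(b, i)\<in>{..<m} \<times> {..<L}. C' b i \<in> S0"
    "nz (form_eval f (shift (\<lambda>j. curve L (C' (h j)) (e j)) (B' \<union> A')))" by blast
  have "card B' \<le> card B" unfolding B'_def using CB(1) finite_subset by (intro card_mono) auto
  moreover have "card A' \<le> card A" using A'(1) g(1) finite_subset by (intro card_mono) auto
  moreover have "D \<le> m * L"
  proof -
    have "D \<le> m * K" by (simp add: D_def m_def)
    also have "\<dots> \<le> m * L" using L by simp
    finally show ?thesis .
  qed
  ultimately have "card (B' \<union> A') \<le> 2 * (m * L)"
    using card_Un_le[of B' A'] CB(2) g(2) by linarith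
  moreover have "B' \<union> A' \<subseteq> {..<n}" using CB(1) A'(1) g(1) by (auto simp: B'_def)
  moreover have "\<forall>b<m. \<forall>i<L. C' b i \<in> S0" using C'(1) by auto
  ultimately show ?thesis using a(1) C'(2) unfolding h_def by blast
qed

end

section \<open>One commutative ring mapping onto all fields\<close>

text \<open>A field in the sense of HOL-Algebra is a record, while the development above lives in a type class.
  The product of the ring of integers and of all fields over a type is an instance of the class; the
  integer component makes \<open>0 \<noteq> 1\<close> even if there is no field over the type.\<close>

typedef 'a prod_ring =
  "{p :: int \<times> ('a ring \<Rightarrow> 'a). \<forall>F. if field F then snd p F \<in> carrier F else snd p F = undefined}"
proof
  show "(0, \<lambda>F. if field F then \<zero>\<^bsub>F\<^esub> else undefined) \<in>
      {p :: int \<times> ('a ring \<Rightarrow> 'a). \<forall>F. if field F then snd p F \<in> carrier F else snd p F = undefined}"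
    by (auto simp: field_def domain_def cring_def intro!: ring.ring_simprules(2))
qed

definition int_part :: "'a prod_ring \<Rightarrow> int" where
  "int_part x = fst (Rep_prod_ring x)"

definition proj :: "'a ring \<Rightarrow> 'a prod_ring \<Rightarrow> 'a" where
  "proj F x = snd (Rep_prod_ring x) F"

definition make :: "int \<Rightarrow> ('a ring \<Rightarrow> 'a) \<Rightarrow> 'a prod_ring" where
  "make z g = Abs_prod_ring (z, \<lambda>F. if field F then g F else undefined)"

lemma proj_closed: "field F \<Longrightarrow> proj F x \<in> carrier F"
  using Rep_prod_ring[of x] by (auto simp: proj_def split: if_splits)

lemma prod_ring_eqI:
  assumes "int_part x = int_part y" "\<And>F. field F \<Longrightarrow> proj F x = proj F y"
  shows "x = y"
proof -
  have "snd (Rep_prod_ring x) F = snd (Rep_prod_ring y) F" for F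
    using assms(2)[of F] Rep_prod_ring[of x] Rep_prod_ring[of y]
    by (cases "field F") (auto simp: proj_def split: if_splits)
  then have "Rep_prod_ring x = Rep_prod_ring y"
    using assms(1) by (auto simp: int_part_def prod_eq_iff)
  then show ?thesis by (simp add: Rep_prod_ring_inject)
qed

lemma make_parts:
  assumes "\<And>F. field F \<Longrightarrow> g F \<in> carrier F"
  shows "int_part (make z g) = z" "field F \<Longrightarrow> proj F (make z g) = g F"
  using assms by (auto simp: make_def int_part_def proj_def Abs_prod_ring_inverse)

lemma field_facts:
  assumes "field F"
  shows "ring F" "cring F" "domain F" "abelian_group F"
  using assms by (auto simp: field_def domain_def cring_def ring_def)

instantiation prod_ring :: (type) comm_ring_1
begin

definition "0 = make 0 (\<lambda>F. \<zero>\<^bsub>F\<^esub>)"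
definition "1 = make 1 (\<lambda>F. \<one>\<^bsub>F\<^esub>)"
definition "x + y = make (int_part x + int_part y) (\<lambda>F. proj F x \<oplus>\<^bsub>F\<^esub> proj F y)"
definition "x * y = make (int_part x * int_part y) (\<lambda>F. proj F x \<otimes>\<^bsub>F\<^esub> proj F y)"
definition "- x = make (- int_part x) (\<lambda>F. \<ominus>\<^bsub>F\<^esub> proj F x)"
definition "x - y = make (int_part x - int_part y) (\<lambda>F. proj F x \<ominus>\<^bsub>F\<^esub> proj F y)"

lemma ring_closures:
  assumes "field F"
  shows "\<zero>\<^bsub>F\<^esub> \<in> carrier F" "\<one>\<^bsub>F\<^esub> \<in> carrier F" "proj F x \<oplus>\<^bsub>F\<^esub> proj F y \<in> carrier F"
    "proj F x \<otimes>\<^bsub>F\<^esub> proj F y \<in> carrier F" "\<ominus>\<^bsub>F\<^esub> proj F x \<in> carrier F"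
    "proj F x \<ominus>\<^bsub>F\<^esub> proj F y \<in> carrier F"
proof -
  interpret field F by fact
  show "\<zero>\<^bsub>F\<^esub> \<in> carrier F" "\<one>\<^bsub>F\<^esub> \<in> carrier F" "proj F x \<oplus>\<^bsub>F\<^esub> proj F y \<in> carrier F"
    "proj F x \<otimes>\<^bsub>F\<^esub> proj F y \<in> carrier F" "\<ominus>\<^bsub>F\<^esub> proj F x \<in> carrier F"
    "proj F x \<ominus>\<^bsub>F\<^esub> proj F y \<in> carrier F"
    using proj_closed[OF assms] by auto
qed

lemma int_part_ops:
  "int_part (0 :: 'a prod_ring) = 0" "int_part (1 :: 'a prod_ring) = 1"
  "int_part (x + y) = int_part x + int_part y" "int_part (x * y) = int_part x * int_part y"
  "int_part (- x) = - int_part x" "int_part (x - y) = int_part x - int_part y" for x y :: "'a prod_ring"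
  unfolding zero_prod_ring_def one_prod_ring_def plus_prod_ring_def times_prod_ring_def
    uminus_prod_ring_def minus_prod_ring_def
  by (rule make_parts; simp add: ring_closures)+

lemma proj_ops:
  assumes "field F"
  shows "proj F 0 = \<zero>\<^bsub>F\<^esub>" "proj F 1 = \<one>\<^bsub>F\<^esub>" "proj F (x + y) = proj F x \<oplus>\<^bsub>F\<^esub> proj F y"
    "proj F (x * y) = proj F x \<otimes>\<^bsub>F\<^esub> proj F y" "proj F (- x) = \<ominus>\<^bsub>F\<^esub> proj F x"
    "proj F (x - y) = proj F x \<ominus>\<^bsub>F\<^esub> proj F y"
  unfolding zero_prod_ring_def one_prod_ring_def plus_prod_ring_def times_prod_ring_def
    uminus_prod_ring_def minus_prod_ring_def
  by (subst make_parts(2); simp add: ring_closures assms)+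

instance
proof
  fix x y z :: "'a prod_ring"
  note ops = int_part_ops proj_ops
  show "x * y * z = x * (y * z)"
    by (rule prod_ring_eqI)
      (simp_all add: ops proj_closed cring.cring_simprules[OF field_facts(2)])
  show "x * y = y * x"
    by (rule prod_ring_eqI)
      (simp_all add: ops proj_closed cring.cring_simprules(14)[OF field_facts(2)])
  show "1 * x = x"
    by (rule prod_ring_eqI)
      (simp_all add: ops proj_closed cring.cring_simprules[OF field_facts(2)])
  show "(x + y) * z = x * z + y * z"
    by (rule prod_ring_eqI)
      (simp_all add: ops proj_closed distrib_right cring.cring_simprules(13)[OF field_facts(2)])
  show "x + y + z = x + (y + z)"
    by (rule prod_ring_eqI)
      (simp_all add: ops proj_closed cring.cring_simprules(7)[OF field_facts(2)])
  show "x + y = y + x"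
    by (rule prod_ring_eqI)
      (simp_all add: ops proj_closed cring.cring_simprules(10)[OF field_facts(2)])
  show "0 + x = x"
    by (rule prod_ring_eqI)
      (simp_all add: ops proj_closed cring.cring_simprules(8)[OF field_facts(2)])
  show "- x + x = 0"
    by (rule prod_ring_eqI)
      (simp_all add: ops proj_closed cring.cring_simprules(9)[OF field_facts(2)])
  show "x - y = x + - y"
    by (rule prod_ring_eqI)
      (simp_all add: ops proj_closed a_minus_def)
  show "(0 :: 'a prod_ring) \<noteq> 1"
    using int_part_ops(1,2) by (metis zero_neq_one)
qed

end

text \<open>The embedding at one component respects sums and products but does not send one to 1.
  Statements that involve empty products therefore hold only after \<open>proj\<close>.\<close>

definition inject :: "'a ring \<Rightarrow> 'a \<Rightarrow> 'a prod_ring" where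
  "inject F a = make 0 (\<lambda>G. if G = F then a else \<zero>\<^bsub>G\<^esub>)"

section \<open>The component of one field\<close>

locale projected_field = field R for R :: "'a ring" (structure)
begin

lemma field_R: "field R" ..

lemma inject_parts:
  assumes "a \<in> carrier R"
  shows "int_part (inject R a) = 0" "proj R (inject R a) = a"
    "field G \<Longrightarrow> G \<noteq> R \<Longrightarrow> proj G (inject R a) = \<zero>\<^bsub>G\<^esub>"
proof -
  have c: "field G \<Longrightarrow> (if G = R then a else \<zero>\<^bsub>G\<^esub>) \<in> carrier G" for G
    using assms ring_closures(1) by auto
  show "int_part (inject R a) = 0" "proj R (inject R a) = a"
    "field G \<Longrightarrow> G \<noteq> R \<Longrightarrow> proj G (inject R a) = \<zero>\<^bsub>G\<^esub>"
    unfolding inject_def using make_parts[of "\<lambda>G. if G = R then a else \<zero>\<^bsub>G\<^esub>", OF c] field_R by auto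
qed

lemma inject_zero: "inject R \<zero> = 0"
proof (rule prod_ring_eqI)
  show "proj F (inject R \<zero>) = proj F 0" if "field F" for F
    using that inject_parts[OF zero_closed] by (cases "F = R") (simp_all add: proj_ops)
qed (simp add: int_part_ops inject_parts)

lemma inject_eqI:
  assumes "a \<in> carrier R" "int_part x = 0" "proj R x = a" "\<And>G. field G \<Longrightarrow> G \<noteq> R \<Longrightarrow> proj G x = \<zero>\<^bsub>G\<^esub>"
  shows "inject R a = x"
proof (rule prod_ring_eqI)
  show "proj F (inject R a) = proj F x" if "field F" for F
    using that assms inject_parts[OF assms(1)] by (cases "F = R") simp_all
qed (simp add: assms(2) inject_parts(1)[OF assms(1)])

lemma inject_add:
  assumes "a \<in> carrier R" "b \<in> carrier R"
  shows "inject R (a \<oplus> b) = inject R a + inject R b"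
proof (rule inject_eqI)
  fix G :: "'a ring" assume G: "field G" "G \<noteq> R"
  interpret G: field G by fact
  show "proj G (inject R a + inject R b) = \<zero>\<^bsub>G\<^esub>"
    using G assms by (simp add: proj_ops inject_parts)
qed (use assms field_R in \<open>auto simp: int_part_ops proj_ops inject_parts\<close>)

lemma inject_mult:
  assumes "a \<in> carrier R" "b \<in> carrier R"
  shows "inject R (a \<otimes> b) = inject R a * inject R b"
proof (rule inject_eqI)
  fix G :: "'a ring" assume G: "field G" "G \<noteq> R"
  interpret G: field G by fact
  show "proj G (inject R a * inject R b) = \<zero>\<^bsub>G\<^esub>"
    using G assms by (simp add: proj_ops inject_parts)
qed (use assms field_R in \<open>auto simp: int_part_ops proj_ops inject_parts\<close>)

lemma inject_finsum:
  assumes "\<And>i. i \<in> A \<Longrightarrow> f i \<in> carrier R"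
  shows "inject R (\<Oplus>i\<in>A. f i) = (\<Sum>i\<in>A. inject R (f i))"
  using assms
proof (induction A rule: infinite_finite_induct)
  case (insert a A)
  then show ?case by (subst finsum_insert) (auto simp: inject_add finsum_closed Pi_def)
qed (auto simp: inject_zero finsum_infinite)

lemma proj_sum: "proj R (\<Sum>i\<in>A. g i) = (\<Oplus>i\<in>A. proj R (g i))"
proof (induction A rule: infinite_finite_induct)
  case (insert a A)
  then show ?case
    by (subst finsum_insert) (auto simp: proj_ops field_R proj_closed)
qed (auto simp: proj_ops field_R finsum_infinite)

lemma proj_prod: "proj R (\<Prod>i\<in>A. g i) = finprod R (\<lambda>i. proj R (g i)) A"
proof (induction A rule: infinite_finite_induct)
  case (insert a A)
  then show ?case
    by (subst finprod_insert) (auto simp: proj_ops field_R proj_closed)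
qed (auto simp: proj_ops field_R)

lemma proj_power: "proj R (x ^ k) = proj R x [^] k"
  by (induction k) (auto simp: proj_ops field_R nat_pow_Suc proj_closed m_comm)

definition nz :: "'a prod_ring \<Rightarrow> bool" where
  "nz x \<longleftrightarrow> proj R x \<noteq> \<zero>"

lemma nz_diff_iff: "nz (x - y) \<longleftrightarrow> proj R x \<noteq> proj R y"
  using proj_closed[OF field_R, of x] proj_closed[OF field_R, of y]
  by (auto simp: nz_def proj_ops field_R r_right_minus_eq)

text \<open>The ideal is the kernel of the projection to \<open>R\<close>; an inverse modulo it is
  the inverse in \<open>R\<close>, put back into that component.\<close>

lemma maximal_compl_nz: "maximal_compl nz"
proof
  show "nz 1" by (simp add: nz_def proj_ops field_R)
  show "\<not> nz 0" by (simp add: nz_def proj_ops field_R)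
  show "nz (x * y) \<longleftrightarrow> nz x \<and> nz y" for x y
    using proj_closed[OF field_R] by (auto simp: nz_def proj_ops field_R integral_iff)
  show "\<not> nz x \<Longrightarrow> \<not> nz y \<Longrightarrow> \<not> nz (x + y)" for x y
    by (auto simp: nz_def proj_ops field_R)
  show "\<exists>y. \<not> nz (x * y - 1)" if "nz x" for x
  proof -
    have u: "proj R x \<in> Units R"
      using that proj_closed[OF field_R, of x] by (simp add: nz_def field_Units)
    then have "proj R (x * inject R (inv proj R x)) = \<one>"
      by (simp add: proj_ops field_R inject_parts)
    then show ?thesis
      unfolding nz_diff_iff by (intro exI[of _ "inject R (inv proj R x)"]) (simp add: proj_ops field_R)
  qed
qed

subsection \<open>Evaluation of formal polynomials\<close>

definition proper :: "nat \<Rightarrow> 'a mpol \<Rightarrow> bool" where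
  "proper n P \<longleftrightarrow> (\<forall>u. P u \<in> carrier R) \<and> finite {u. P u \<noteq> \<zero>} \<and> (\<forall>u. P u \<noteq> \<zero> \<longrightarrow> set_mset u \<subseteq> {..<n})"

definition mon :: "nat \<Rightarrow> nat multiset \<Rightarrow> (nat \<Rightarrow> 'a prod_ring) \<Rightarrow> 'a prod_ring" where
  "mon n u x = (\<Prod>i<n. x i ^ count u i)"

text \<open>Evaluation in the product ring, where the results on type classes apply;
  \<open>mpol_eval_ev\<close> compares it with \<open>mpol_eval\<close> after projection.\<close>

definition ev :: "nat \<Rightarrow> 'a mpol \<Rightarrow> (nat \<Rightarrow> 'a prod_ring) \<Rightarrow> 'a prod_ring" where
  "ev n P x = (\<Sum>u | P u \<noteq> \<zero>. inject R (P u) * mon n u x)"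

lemma ev_superset:
  assumes "finite A" "{u. P u \<noteq> \<zero>} \<subseteq> A"
  shows "ev n P x = (\<Sum>u\<in>A. inject R (P u) * mon n u x)"
  unfolding ev_def using assms by (intro sum.mono_neutral_left) (auto simp: inject_zero)

lemma mon_add: "mon n (u + w) x = mon n u x * mon n w x"
  by (simp add: mon_def power_add prod.distrib)

lemma mon_set:
  assumes "set_mset u \<subseteq> {..<n}"
  shows "mon n u x = (\<Prod>i\<in>set_mset u. x i ^ count u i)"
  unfolding mon_def using assms by (intro prod.mono_neutral_right) (auto simp: not_in_iff)

lemma mpol_eval_ev:
  assumes "proper n P" "\<And>i. i < n \<Longrightarrow> proj R (y i) = x ! i"
  shows "mpol_eval P x = proj R (ev n P y)"
proof -
  have c: "P u \<in> carrier R" for u using assms(1) by (simp add: proper_def)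
  have "proj R (inject R (P u) * mon n u y) = P u \<otimes> finprod R (\<lambda>i. (x ! i) [^] count u i) (set_mset u)"
    if "P u \<noteq> \<zero>" for u
  proof -
    have u: "set_mset u \<subseteq> {..<n}" using assms(1) that by (auto simp: proper_def)
    have "finprod R (\<lambda>i. proj R (y i) [^] count u i) (set_mset u) =
        finprod R (\<lambda>i. (x ! i) [^] count u i) (set_mset u)"
    proof (rule finprod_cong')
      show "(\<lambda>i. (x ! i) [^] count u i) \<in> set_mset u \<rightarrow> carrier R"
      proof
        fix i assume "i \<in># u"
        then have "x ! i = proj R (y i)" using u assms(2)[of i] by auto
        then show "(x ! i) [^] count u i \<in> carrier R" using proj_closed[OF field_R] by simp
      qed
      show "proj R (y i) [^] count u i = (x ! i) [^] count u i" if "i \<in> set_mset u" for i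
        using assms(2)[of i] that u by auto
    qed simp
    then show ?thesis
      unfolding mon_set[OF u] using c by (simp add: proj_ops field_R inject_parts proj_prod proj_power)
  qed
  moreover have "proj R (inject R (P u) * mon n u y) \<in> carrier R" for u by (rule proj_closed[OF field_R])
  ultimately show ?thesis
    unfolding mpol_eval_def ev_def proj_sum by (intro finsum_cong') auto
qed

lemma proper_const: "c \<in> carrier R \<Longrightarrow> proper n (indexed_const c)"
  by (auto simp: proper_def indexed_const_def intro: finite_subset[of _ "{{#}}"])

lemma indexed_var_eq: "indexed_var (i :: nat) = (\<lambda>u. if u = {#i#} then \<one> else \<zero>)"
proof
  fix u :: "nat multiset"
  show "indexed_var i u = (if u = {#i#} then \<one> else \<zero>)"
    unfolding indexed_var_def indexed_pmult_def indexed_const_def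
    by (auto dest: multi_member_split)
qed

lemma proper_var: "i < n \<Longrightarrow> proper n (indexed_var i)"
  by (auto simp: proper_def indexed_var_eq intro: finite_subset[of _ "{{#i#}}"])

lemma ev_const: "c \<in> carrier R \<Longrightarrow> ev n (indexed_const c) x = inject R c"
  by (subst ev_superset[of "{{#}}"]) (auto simp: indexed_const_def mon_def)

lemma proper_add:
  assumes "proper n P" "proper n Q"
  shows "proper n (indexed_padd P Q)"
proof -
  have "{u. P u \<oplus> Q u \<noteq> \<zero>} \<subseteq> {u. P u \<noteq> \<zero>} \<union> {u. Q u \<noteq> \<zero>}" by auto
  moreover have "finite ({u. P u \<noteq> \<zero>} \<union> {u. Q u \<noteq> \<zero>})" using assms by (simp add: proper_def)
  ultimately have "finite {u. P u \<oplus> Q u \<noteq> \<zero>}" by (rule finite_subset)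
  moreover have "set_mset u \<subseteq> {..<n}" if "P u \<oplus> Q u \<noteq> \<zero>" for u
    using that assms unfolding proper_def by (cases "P u = \<zero>") auto
  ultimately show ?thesis using assms by (simp add: proper_def indexed_padd_def)
qed

lemma ev_add:
  assumes "proper n P" "proper n Q"
  shows "ev n (indexed_padd P Q) x = ev n P x + ev n Q x"
proof -
  let ?A = "{u. P u \<noteq> \<zero>} \<union> {u. Q u \<noteq> \<zero>}"
  have fin: "finite ?A" using assms by (simp add: proper_def)
  have sub: "{u. indexed_padd P Q u \<noteq> \<zero>} \<subseteq> ?A"
    by (auto simp: indexed_padd_def)
  have c: "P u \<in> carrier R" "Q u \<in> carrier R" for u using assms by (auto simp: proper_def)
  show ?thesis
    unfolding ev_superset[OF fin sub] ev_superset[of ?A P, OF fin Un_upper1] ev_superset[of ?A Q, OF fin Un_upper2]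
    by (simp add: indexed_padd_def inject_add c distrib_right sum.distrib)
qed

lemma finite_submultisets: "finite {u. u \<subseteq># (w :: nat multiset)}"
proof (rule finite_subset)
  show "{u. u \<subseteq># w} \<subseteq> mset ` {xs. set xs \<subseteq> set_mset w \<and> length xs \<le> size w}"
  proof
    fix u assume "u \<in> {u. u \<subseteq># w}"
    then have u: "u \<subseteq># w" by simp
    obtain xs where "mset xs = u" using ex_mset by blast
    then show "u \<in> mset ` {xs. set xs \<subseteq> set_mset w \<and> length xs \<le> size w}"
      using set_mset_mono[OF u] size_mset_mono[OF u] by (intro image_eqI[of _ _ xs]) auto
  qed
  show "finite (mset ` {xs. set xs \<subseteq> set_mset w \<and> length xs \<le> size w})"
    by (intro finite_imageI finite_lists_length_le) simp
qed

lemma mpol_mult_nonzero: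
  assumes "mpol_mult P Q w \<noteq> \<zero>" "\<And>u. P u \<in> carrier R" "\<And>u. Q u \<in> carrier R"
  shows "\<exists>u v. w = u + v \<and> P u \<noteq> \<zero> \<and> Q v \<noteq> \<zero>"
proof (rule ccontr)
  assume no: "\<not> ?thesis"
  have "P u \<otimes> Q (w - u) = \<zero>" if "u \<subseteq># w" for u
  proof -
    have "w = u + (w - u)" using that by simp
    then have "P u = \<zero> \<or> Q (w - u) = \<zero>" using no by metis
    then show ?thesis using assms(2,3) by auto
  qed
  then have "mpol_mult P Q w = (\<Oplus>u\<in>{u. u \<subseteq># w}. \<zero>)"
    unfolding mpol_mult_def by (intro finsum_cong') auto
  then show False using assms(1) by simp
qed

lemma proper_mult:
  assumes "proper n P" "proper n Q"
  shows "proper n (mpol_mult P Q)"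
proof -
  have c: "P u \<in> carrier R" "Q u \<in> carrier R" for u using assms by (auto simp: proper_def)
  have nonz: "\<exists>u v. w = u + v \<and> P u \<noteq> \<zero> \<and> Q v \<noteq> \<zero>" if "mpol_mult P Q w \<noteq> \<zero>" for w
    using mpol_mult_nonzero[OF that] c by blast
  have "{w. mpol_mult P Q w \<noteq> \<zero>} \<subseteq> (\<lambda>(u, v). u + v) ` ({u. P u \<noteq> \<zero>} \<times> {u. Q u \<noteq> \<zero>})"
    using nonz by fastforce
  moreover have "finite ({u. P u \<noteq> \<zero>} \<times> {u. Q u \<noteq> \<zero>})" using assms by (simp add: proper_def)
  ultimately have "finite {w. mpol_mult P Q w \<noteq> \<zero>}"
    using finite_subset finite_imageI by metis
  moreover have "set_mset w \<subseteq> {..<n}" if "mpol_mult P Q w \<noteq> \<zero>" for w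
    using nonz[OF that] assms by (fastforce simp: proper_def)
  moreover have "mpol_mult P Q w \<in> carrier R" for w
    unfolding mpol_mult_def using c by (intro finsum_closed) auto
  ultimately show ?thesis by (simp add: proper_def)
qed

lemma ev_mult:
  assumes "proper n P" "proper n Q"
  shows "ev n (mpol_mult P Q) x = ev n P x * ev n Q x"
proof -
  define A where "A = {u. P u \<noteq> \<zero>}"
  define B where "B = {u. Q u \<noteq> \<zero>}"
  define C where "C = (\<lambda>(u, v). u + v) ` (A \<times> B)"
  have fin: "finite A" "finite B" "finite C" using assms by (auto simp: proper_def A_def B_def C_def)
  have c: "P u \<in> carrier R" "Q u \<in> carrier R" for u using assms by (auto simp: proper_def)
  have "{w. mpol_mult P Q w \<noteq> \<zero>} \<subseteq> C"
    using mpol_mult_nonzero[of P Q] c by (fastforce simp: A_def B_def C_def)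
  then have "ev n (mpol_mult P Q) x = (\<Sum>w\<in>C. inject R (mpol_mult P Q w) * mon n w x)"
    using ev_superset fin by blast
  also have "\<dots> = (\<Sum>w\<in>C. \<Sum>u\<in>{u. u \<subseteq># w}. inject R (P u) * inject R (Q (w - u)) * mon n w x)"
    unfolding mpol_mult_def using c
    by (subst inject_finsum) (auto simp: sum_distrib_right inject_mult)
  also have "\<dots> = (\<Sum>(w, u)\<in>(SIGMA w:C. {u. u \<subseteq># w}). inject R (P u) * inject R (Q (w - u)) * mon n w x)"
    using fin finite_submultisets by (intro sum.Sigma) auto
  \<comment> \<open>Reindexing by \<open>w = u + v\<close>; a pair \<open>(w, u)\<close> outside the
    image has \<open>P u\<close> or \<open>Q (w - u)\<close> zero.\<close>
  also have "\<dots> = (\<Sum>(u, v)\<in>A \<times> B. inject R (P u) * inject R (Q v) * mon n (u + v) x)"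
  proof (rule sum.mono_neutral_cong_right[THEN trans])
    show "finite (SIGMA w:C. {u. u \<subseteq># w})" using fin finite_submultisets by (intro finite_SigmaI) auto
    show "(\<lambda>(u, v). (u + v, u)) ` (A \<times> B) \<subseteq> (SIGMA w:C. {u. u \<subseteq># w})" by (auto simp: C_def)
    show "\<forall>i\<in>(SIGMA w:C. {u. u \<subseteq># w}) - (\<lambda>(u, v). (u + v, u)) ` (A \<times> B).
        (case i of (w, u) \<Rightarrow> inject R (P u) * inject R (Q (w - u)) * mon n w x) = 0"
    proof clarify
      fix w u assume u: "u \<subseteq># w" and no: "(w, u) \<notin> (\<lambda>(u, v). (u + v, u)) ` (A \<times> B)"
      have "u \<notin> A \<or> w - u \<notin> B"
      proof (rule ccontr)
        assume "\<not> ?thesis"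
        then have "(w, u) \<in> (\<lambda>(u, v). (u + v, u)) ` (A \<times> B)"
          using u by (intro image_eqI[of _ _ "(u, w - u)"]) auto
        then show False using no by blast
      qed
      then show "inject R (P u) * inject R (Q (w - u)) * mon n w x = 0"
        by (auto simp: A_def B_def inject_zero)
    qed
    show "(\<Sum>(w, u)\<in>(\<lambda>(u, v). (u + v, u)) ` (A \<times> B). inject R (P u) * inject R (Q (w - u)) * mon n w x) =
        (\<Sum>(u, v)\<in>A \<times> B. inject R (P u) * inject R (Q v) * mon n (u + v) x)"
      by (subst sum.reindex) (auto simp: inj_on_def case_prod_beta)
  qed auto
  also have "\<dots> = (\<Sum>u\<in>A. \<Sum>v\<in>B. (inject R (P u) * mon n u x) * (inject R (Q v) * mon n v x))"
    unfolding sum.cartesian_product by (intro sum.cong) (auto simp: mon_add mult_ac)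
  also have "\<dots> = ev n P x * ev n Q x" unfolding ev_def A_def B_def by (rule sum_product[symmetric])
  finally show ?thesis .
qed

lemma proper_sum: "(\<And>P. P \<in> set Ps \<Longrightarrow> proper n P) \<Longrightarrow> proper n (mpol_sum Ps)"
  by (induction Ps) (auto simp: mpol_sum_def proper_const proper_add)

lemma proper_prod: "(\<And>P. P \<in> set Ps \<Longrightarrow> proper n P) \<Longrightarrow> proper n (mpol_prod Ps)"
  by (induction Ps) (auto simp: mpol_prod_def proper_const proper_mult)

lemma ev_sum:
  assumes "\<And>P. P \<in> set Ps \<Longrightarrow> proper n P"
  shows "ev n (mpol_sum Ps) x = (\<Sum>P\<leftarrow>Ps. ev n P x)"
  using assms
proof (induction Ps)
  case Nil
  then show ?case by (simp add: mpol_sum_def ev_const inject_zero)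
next
  case (Cons P Ps)
  have "mpol_sum (P # Ps) = indexed_padd P (mpol_sum Ps)" by (simp add: mpol_sum_def)
  then show ?case using Cons proper_sum[of Ps] by (simp add: ev_add)
qed

text \<open>Only the projections agree: the empty product evaluates to
  \<open>inject R \<one>\<close> on the left and to 1 on the right.\<close>

lemma proj_ev_prod:
  assumes "\<And>P. P \<in> set Ps \<Longrightarrow> proper n P"
  shows "proj R (ev n (mpol_prod Ps) x) = proj R (\<Prod>P\<leftarrow>Ps. ev n P x)"
  using assms
proof (induction Ps)
  case Nil
  then show ?case by (simp add: mpol_prod_def ev_const inject_parts proj_ops field_R)
next
  case (Cons P Ps)
  have "mpol_prod (P # Ps) = mpol_mult P (mpol_prod Ps)" by (simp add: mpol_prod_def)
  then show ?case using Cons proper_prod[of Ps] by (simp add: ev_mult proj_ops field_R)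
qed

subsection \<open>Leading monomials\<close>

definition leading :: "(nat multiset \<Rightarrow> nat) \<Rightarrow> 'a mpol \<Rightarrow> nat multiset \<Rightarrow> bool" where
  "leading w P u \<longleftrightarrow> P u \<noteq> \<zero> \<and> (\<forall>v. P v \<noteq> \<zero> \<longrightarrow> v \<noteq> u \<longrightarrow> w v < w u)"

text \<open>Both leading monomials are unique of maximal weight, so their sum arises from a single
  pair of monomials and its coefficient cannot cancel in a field.\<close>

lemma leading_mult:
  assumes "\<And>u v. w (u + v) = w u + w v" "proper n P" "proper n Q" "leading w P u" "leading w Q v"
  shows "leading w (mpol_mult P Q) (u + v)"
proof -
  have c: "P u \<in> carrier R" "Q u \<in> carrier R" for u using assms by (auto simp: proper_def)
  have le: "w u' \<le> w u" if "P u' \<noteq> \<zero>" for u'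
    using assms(4) that by (cases "u' = u") (auto simp: leading_def less_imp_le)
  have le': "w v' \<le> w v" if "Q v' \<noteq> \<zero>" for v'
    using assms(5) that by (cases "v' = v") (auto simp: leading_def less_imp_le)
  have eq: "u' = u" "v' = v" if "P u' \<noteq> \<zero>" "Q v' \<noteq> \<zero>" "w u' + w v' \<ge> w u + w v" for u' v'
    using le[OF that(1)] le'[OF that(2)] that assms(4,5) unfolding leading_def
    by (metis add_less_le_mono add_le_less_mono not_less)+
  have "mpol_mult P Q (u + v) = (\<Oplus>u'\<in>{u'. u' \<subseteq># u + v}. if u = u' then P u' \<otimes> Q (u + v - u') else \<zero>)"
    unfolding mpol_mult_def
  proof (rule finsum_cong')
    fix u' assume "u' \<in> {u'. u' \<subseteq># u + v}"
    then have s: "u + v = u' + (u + v - u')" by simp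
    show "P u' \<otimes> Q (u + v - u') = (if u = u' then P u' \<otimes> Q (u + v - u') else \<zero>)"
    proof (cases "P u' = \<zero> \<or> Q (u + v - u') = \<zero>")
      case False
      have "w u + w v = w u' + w (u + v - u')" using s assms(1) by metis
      then have "u' = u" using False eq(1)[of u' "u + v - u'"] by simp
      then show ?thesis by simp
    qed (use c in auto)
  qed (use c in auto)
  also have "\<dots> = P u \<otimes> Q (u + v - u)"
    using c by (intro finsum_singleton) (auto simp: finite_submultisets)
  finally have "mpol_mult P Q (u + v) = P u \<otimes> Q v" by simp
  then have "mpol_mult P Q (u + v) \<noteq> \<zero>"
    using assms(4,5) c by (auto simp: leading_def integral_iff)
  moreover have "w x < w (u + v)" if x: "mpol_mult P Q x \<noteq> \<zero>" "x \<noteq> u + v" for x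
  proof -
    obtain u' v' where uv: "x = u' + v'" "P u' \<noteq> \<zero>" "Q v' \<noteq> \<zero>"
      using mpol_mult_nonzero[OF x(1)] c by blast
    show ?thesis
    proof (rule ccontr)
      assume "\<not> ?thesis"
      then have "w u + w v \<le> w u' + w v'" by (simp add: uv(1) assms(1))
      then show False using eq[OF uv(2,3)] uv(1) x(2) by simp
    qed
  qed
  ultimately show ?thesis by (simp add: leading_def)
qed

lemma leading_prod:
  assumes "\<And>u v. w (u + v) = w u + w v" "\<And>P. P \<in> set Ps \<Longrightarrow> proper n P \<and> leading w P (l P)"
  shows "leading w (mpol_prod Ps) (\<Sum>P\<leftarrow>Ps. l P)"
  using assms(2)
proof (induction Ps)
  case Nil
  then show ?case by (auto simp: mpol_prod_def leading_def indexed_const_def)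
next
  case (Cons P Ps)
  have "mpol_prod (P # Ps) = mpol_mult P (mpol_prod Ps)" by (simp add: mpol_prod_def)
  then show ?case using Cons leading_mult[OF assms(1), of n P "mpol_prod Ps" "l P" "\<Sum>P\<leftarrow>Ps. l P"] proper_prod[of Ps]
    by simp
qed

text \<open>The weight puts the variable \<open>v\<close> above all others, so that the leading monomial of a
  multilinear polynomial contains \<open>v\<close> whenever \<open>v\<close> occurs at all.\<close>

definition wt :: "nat \<Rightarrow> nat \<Rightarrow> nat multiset \<Rightarrow> nat" where
  "wt n v u = (\<Sum>i\<in>#u. 2 ^ (if i = v then n else i))"

text \<open>On multilinear monomials the weight is a binary number whose bits are the variables,
  with \<open>v\<close> moved to bit \<open>n\<close>. It is therefore injective there, and a
  monomial of maximal weight is strictly above all others.\<close>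

lemma leading_exists:
  assumes "proper n P" "multilinear P" "P x \<noteq> \<zero>" "v < n"
  shows "\<exists>u. leading (wt n v) P u \<and> (v \<in># x \<longrightarrow> v \<in># u)"
proof -
  define \<sigma> where "\<sigma> i = (if i = v then n else i)" for i
  have wt: "wt n v u = set_encode (\<sigma> ` set_mset u)" and enc: "u = mset_set (set_mset u)"
    and sub: "set_mset u \<subseteq> {..<n}" if "P u \<noteq> \<zero>" for u
  proof -
    have "\<And>i. count u i \<le> 1" using assms(2) that by (auto simp: multilinear_def)
    then show e: "u = mset_set (set_mset u)"
      by (intro multiset_eqI) (metis One_nat_def count_mset_set(1,3) count_greater_zero_iff finite_set_mset le_antisym less_one not_gr_zero not_le not_less_eq_eq)
    show s: "set_mset u \<subseteq> {..<n}" using assms(1) that by (auto simp: proper_def)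
    have "inj_on \<sigma> (set_mset u)" using s by (auto simp: inj_on_def \<sigma>_def split: if_splits)
    then have "set_encode (\<sigma> ` set_mset u) = (\<Sum>i\<in>set_mset u. 2 ^ \<sigma> i)"
      by (simp add: set_encode_def sum.reindex)
    also have "\<dots> = (\<Sum>i\<in>#mset_set (set_mset u). 2 ^ \<sigma> i)" by (simp add: sum_unfold_sum_mset)
    also have "\<dots> = wt n v u" unfolding wt_def \<sigma>_def using e by simp
    finally show "wt n v u = set_encode (\<sigma> ` set_mset u)" by simp
  qed
  have inj: "u = u'" if "P u \<noteq> \<zero>" "P u' \<noteq> \<zero>" "wt n v u = wt n v u'" for u u'
  proof -
    have "set_encode (\<sigma> ` set_mset u) = set_encode (\<sigma> ` set_mset u')" using wt that by simp
    then have "\<sigma> ` set_mset u = \<sigma> ` set_mset u'"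
      by (simp add: set_encode_eq)
    moreover have "inj_on \<sigma> {..<n}" by (auto simp: inj_on_def \<sigma>_def split: if_splits)
    ultimately have "set_mset u = set_mset u'"
      using sub that inj_on_image_eq_iff by metis
    then show ?thesis using enc that by metis
  qed
  let ?S = "{u. P u \<noteq> \<zero>}"
  have S: "finite ?S" "?S \<noteq> {}" using assms(1,3) by (auto simp: proper_def)
  then have "Max (wt n v ` ?S) \<in> wt n v ` ?S" by (intro Max_in) auto
  then obtain u where "u \<in> ?S" and max: "wt n v u = Max (wt n v ` ?S)" by (metis (no_types, lifting) imageE)
  then have u: "u \<in> ?S" "\<And>u'. u' \<in> ?S \<Longrightarrow> wt n v u' \<le> wt n v u"
    using S(1) unfolding max by auto
  have "leading (wt n v) P u"
    unfolding leading_def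
  proof (intro conjI allI impI)
    fix u' assume u': "P u' \<noteq> \<zero>" "u' \<noteq> u"
    then have "wt n v u' \<noteq> wt n v u" using inj u(1) by blast
    then show "wt n v u' < wt n v u" using u(2)[of u'] u'(1) by simp
  qed (use u(1) in simp)
  moreover have "v \<in># u" if vx: "v \<in># x"
  proof (rule ccontr)
    assume no: "v \<notin># u"
    have "u = mset_set (set_mset u)" "set_mset u \<subseteq> {..<n}" using enc sub u(1) by auto
    have "wt n v u = set_encode (set_mset u)"
    proof -
      have "\<sigma> ` set_mset u = set_mset u" using no by (auto simp: \<sigma>_def image_def)
      then show ?thesis using wt u(1) by simp
    qed
    \<comment> \<open>Without \<open>v\<close> the weight uses only bits below \<open>n\<close> and
      stays below \<open>2 ^ n\<close>, which a monomial containing \<open>v\<close>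
      reaches.\<close>
    also have "\<dots> \<le> (\<Sum>i<n. 2 ^ i)"
      unfolding set_encode_def using \<open>set_mset u \<subseteq> {..<n}\<close> by (intro sum_mono2) auto
    also have "\<dots> < (2 ^ n :: nat)" by (simp add: sum_power2 flip: atLeast0LessThan)
    also have "\<dots> \<le> wt n v x"
    proof -
      obtain y where "x = add_mset v y" using vx by (meson multi_member_split)
      then show ?thesis by (simp add: wt_def)
    qed
    finally show False using u(2)[of x] assms(3) by simp
  qed
  ultimately show ?thesis by blast
qed

definition mpol_vars :: "'a mpol \<Rightarrow> nat set" where
  "mpol_vars P = (\<Union>u\<in>{u. P u \<noteq> \<zero>}. set_mset u)"

lemma mpol_varsD: "v \<in> mpol_vars P \<Longrightarrow> \<exists>u. P u \<noteq> \<zero> \<and> v \<in># u"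
  by (auto simp: mpol_vars_def)

text \<open>Cancellation might conceivably hide a square in the product. If two factors share
  \<open>v\<close>, then for the weight \<open>wt n v\<close> the leading monomials of both contain
  \<open>v\<close>; the leading monomial of the product is the sum of all of them and contains
  \<open>v\<close> twice. Nonzero factors are assumed because zero has no leading monomial.\<close>

lemma multilinear_prod_disjoint:
  assumes "\<And>P. P \<in> set Ps \<Longrightarrow> proper n P \<and> multilinear P \<and> P \<noteq> indexed_const \<zero>"
    and "multilinear (mpol_prod Ps)"
  shows "sorted_wrt (\<lambda>P Q. mpol_vars P \<inter> mpol_vars Q = {}) Ps"
  unfolding sorted_wrt_iff_nth_less
proof (intro allI impI, rule ccontr)
  fix a b assume ab: "a < b" "b < length Ps"
    and ne: "mpol_vars (Ps ! a) \<inter> mpol_vars (Ps ! b) \<noteq> {}"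
  from ne obtain v where vv: "v \<in> mpol_vars (Ps ! a)" "v \<in> mpol_vars (Ps ! b)" by blast
  obtain ua where va: "(Ps ! a) ua \<noteq> \<zero>" "v \<in># ua" using mpol_varsD[OF vv(1)] by blast
  obtain ub where vb: "(Ps ! b) ub \<noteq> \<zero>" "v \<in># ub" using mpol_varsD[OF vv(2)] by blast
  have vn: "v < n" using va assms(1)[of "Ps ! a"] ab by (fastforce simp: proper_def)
  have "\<forall>P\<in>set Ps. \<exists>u. leading (wt n v) P u \<and> ((\<exists>x. P x \<noteq> \<zero> \<and> v \<in># x) \<longrightarrow> v \<in># u)"
  proof
    fix P assume P: "P \<in> set Ps"
    show "\<exists>u. leading (wt n v) P u \<and> ((\<exists>x. P x \<noteq> \<zero> \<and> v \<in># x) \<longrightarrow> v \<in># u)"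
    proof (cases "\<exists>x. P x \<noteq> \<zero> \<and> v \<in># x")
    case True
    then show ?thesis using leading_exists[OF _ _ _ vn, of P] assms(1)[OF P] by blast
  next
    case False
    obtain x where "P x \<noteq> \<zero>" using assms(1)[OF P] by (auto simp: indexed_const_def fun_eq_iff split: if_splits)
    then show ?thesis using leading_exists[OF _ _ _ vn, of P x] assms(1)[OF P] False by metis
    qed
  qed
  from bchoice[OF this] obtain l where
    l: "\<forall>P\<in>set Ps. leading (wt n v) P (l P) \<and> ((\<exists>x. P x \<noteq> \<zero> \<and> v \<in># x) \<longrightarrow> v \<in># l P)" ..
  have "leading (wt n v) (mpol_prod Ps) (\<Sum>P\<leftarrow>Ps. l P)"
    using l assms(1) by (intro leading_prod) (auto simp: wt_def)
  then have "count (\<Sum>P\<leftarrow>Ps. l P) v \<le> 1"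
    using assms(2) by (auto simp: leading_def multilinear_def)
  moreover have "2 \<le> count (\<Sum>P\<leftarrow>Ps. l P) v"
  proof -
    have "l (Ps ! a) + l (Ps ! b) \<subseteq># (\<Sum>P\<leftarrow>Ps. l P)"
    proof -
      define A where "A = take b Ps"
      have "Ps = A @ Ps ! b # drop (Suc b) Ps" using ab id_take_nth_drop by (simp add: A_def)
      then have "(\<Sum>P\<leftarrow>Ps. l P) = (\<Sum>P\<leftarrow>A. l P) + (l (Ps ! b) + (\<Sum>P\<leftarrow>drop (Suc b) Ps. l P))"
        by (metis list.simps(9) map_append sum_list.Cons sum_list.append)
      moreover have "l (Ps ! a) \<subseteq># (\<Sum>P\<leftarrow>A. l P)"
      proof -
        have "Ps ! a \<in> set A" using ab by (auto simp: A_def in_set_conv_nth intro!: exI[of _ a])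
        then show ?thesis
        proof (induction A)
          case (Cons P A)
          then show ?case by (auto intro: subset_mset.add_increasing)
        qed simp
      qed
      ultimately show ?thesis by (simp add: subset_mset.add_mono)
    qed
    moreover have "v \<in># l (Ps ! a)" "v \<in># l (Ps ! b)"
      using l va vb ab by (metis nth_mem order_less_trans)+
    then have "2 \<le> count (l (Ps ! a) + l (Ps ! b)) v"
      by (metis add_mono count_greater_eq_one_iff count_union one_add_one)
    ultimately show ?thesis using mset_subset_eq_count order_trans by metis
  qed
  ultimately show False by simp
qed

text \<open>At the indicator of the variables of a monomial, exactly the monomials supported within
  them survive; for a monomial of minimal support nothing else survives, and its coefficient is the
  value.\<close>

lemma multilinear_nonzero_point:
  assumes "proper n P" "multilinear P" "P \<noteq> indexed_const \<zero>"
  shows "\<exists>x. nz (ev n P x)"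
proof -
  let ?S = "{u. P u \<noteq> \<zero>}"
  have "?S \<noteq> {}" using assms(3) by (auto simp: indexed_const_def fun_eq_iff split: if_splits)
  then obtain u where u: "P u \<noteq> \<zero>" "\<And>u'. P u' \<noteq> \<zero> \<Longrightarrow> card (set_mset u) \<le> card (set_mset u')"
    using ex_has_least_nat[of "\<lambda>u. P u \<noteq> \<zero>" _ "\<lambda>u. card (set_mset u)"] by blast
  have fin: "finite ?S" using assms(1) by (simp add: proper_def)
  have z: "mon n u' (ind (set_mset u)) = 0" if u': "P u' \<noteq> \<zero>" "u' \<noteq> u" for u'
  proof -
    have "\<not> set_mset u' \<subseteq> set_mset u"
    proof
      assume "set_mset u' \<subseteq> set_mset u"
      then have eq: "set_mset u' = set_mset u" using u(2)[OF u'(1)] card_seteq by blast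
      have "count u' i = count u i" for i
      proof -
        have "count u' i \<le> 1" "count u i \<le> 1" using assms(2) u(1) u'(1) by (auto simp: multilinear_def)
        moreover have "count u' i = 0 \<longleftrightarrow> count u i = 0" using eq by (metis count_eq_zero_iff)
        ultimately show ?thesis by linarith
      qed
      then show False using u'(2) multiset_eqI by blast
    qed
    then obtain i where i: "i \<in># u'" "i \<notin># u" by blast
    then have "i < n" using assms(1) u'(1) by (fastforce simp: proper_def)
    then show ?thesis unfolding mon_def using i by (intro prod_zero) (auto intro!: bexI[of _ i] simp: zero_power)
  qed
  have "mon n u (ind (set_mset u)) = 1"
    unfolding mon_def by (intro prod.neutral) (auto simp: not_in_iff)
  then have "ev n P (ind (set_mset u)) = inject R (P u)"
    unfolding ev_def using fin u(1) z by (subst sum.remove[of _ u]) (auto intro!: sum.neutral)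
  then have "nz (ev n P (ind (set_mset u)))"
    using u(1) assms(1) by (simp add: nz_def inject_parts proper_def)
  then show ?thesis by blast
qed

end

section \<open>From formulas to nested lists\<close>

lemma size_bounds:
  fixes f :: "'a spsp_formula"
  shows "length f \<le> spsp_size f" "(\<Sum>T\<leftarrow>f. \<Sum>Q\<leftarrow>T. length Q) < spsp_size f"
proof -
  have le: "length Q \<le> (\<Sum>M\<leftarrow>Q. 1 + length M)" for Q :: "'a sp_gate"
    by (induction Q) auto
  have le2: "(\<Sum>Q\<leftarrow>T. length Q) \<le> (\<Sum>Q\<leftarrow>T. 1 + (\<Sum>M\<leftarrow>Q. 1 + length M))" for T :: "'a psp_gate"
    by (intro sum_list_mono le_trans[OF le]) simp
  have "(\<Sum>T\<leftarrow>f. \<Sum>Q\<leftarrow>T. length Q) \<le> (\<Sum>T\<leftarrow>f. 1 + (\<Sum>Q\<leftarrow>T. 1 + (\<Sum>M\<leftarrow>Q. 1 + length M)))"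
  proof (rule sum_list_mono)
    show "(\<Sum>Q\<leftarrow>T. length Q) \<le> 1 + (\<Sum>Q\<leftarrow>T. 1 + (\<Sum>M\<leftarrow>Q. 1 + length M))" for T :: "'a psp_gate"
      using le2[of T] by linarith
  qed
  then show "(\<Sum>T\<leftarrow>f. \<Sum>Q\<leftarrow>T. length Q) < spsp_size f"
    unfolding spsp_size_def by (simp del: sum_list_Suc)
  have "length f \<le> (\<Sum>T\<leftarrow>f. 1 + (\<Sum>Q\<leftarrow>T. 1 + (\<Sum>M\<leftarrow>Q. 1 + length M)))"
    by (induction f) auto
  then show "length f \<le> spsp_size f" unfolding spsp_size_def by simp
qed

context projected_field
begin

text \<open>The list is read off the polynomial instead of the gates: a bottom gate with a factor 0
  may multiply a variable by itself although its polynomial is multilinear.\<close>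

definition sparse_of :: "'a mpol \<Rightarrow> 'a prod_ring sparse" where
  "sparse_of P = map (\<lambda>u. (set_mset u, inject R (P u))) (SOME us. distinct us \<and> set us = {u. P u \<noteq> \<zero>})"

lemma sparse_of:
  assumes "proper n P"
  shows "sparse_vars (sparse_of P) = mpol_vars P" "length (sparse_of P) = card {u. P u \<noteq> \<zero>}"
    "multilinear P \<Longrightarrow> sparse_eval (sparse_of P) x = ev n P x"
proof -
  have fin: "finite {u. P u \<noteq> \<zero>}" using assms by (simp add: proper_def)
  define us where "us = (SOME us. distinct us \<and> set us = {u. P u \<noteq> \<zero>})"
  have "\<exists>us. distinct us \<and> set us = {u. P u \<noteq> \<zero>}"
    using finite_distinct_list[OF fin] by blast
  from someI_ex[OF this] have us: "distinct us" "set us = {u. P u \<noteq> \<zero>}" by (auto simp: us_def)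
  have s: "sparse_of P = map (\<lambda>u. (set_mset u, inject R (P u))) us"
    by (simp add: sparse_of_def us_def)
  show "sparse_vars (sparse_of P) = mpol_vars P"
    using us(2) by (auto simp: s sparse_vars_def mpol_vars_def)
  show "length (sparse_of P) = card {u. P u \<noteq> \<zero>}"
    using us distinct_card by (fastforce simp: s)
  show "sparse_eval (sparse_of P) x = ev n P x" if ml: "multilinear P"
  proof -
    have m: "mon n u x = prod x (set_mset u)" if "u \<in> set us" for u
    proof -
      have u: "P u \<noteq> \<zero>" using that us(2) by simp
      then have sub: "set_mset u \<subseteq> {..<n}" using assms by (simp add: proper_def)
      have "x i ^ count u i = x i" if "i \<in># u" for i
      proof -
        have "count u i \<le> 1" "0 < count u i" using ml u that by (auto simp: multilinear_def)
        then have "count u i = 1" by linarith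
        then show ?thesis by simp
      qed
      then show ?thesis unfolding mon_set[OF sub] by (intro prod.cong) auto
    qed
    have "sparse_eval (sparse_of P) x = (\<Sum>u\<leftarrow>us. inject R (P u) * prod x (set_mset u))"
      by (simp add: s sparse_eval_def o_def)
    also have "\<dots> = (\<Sum>u\<in>set us. inject R (P u) * prod x (set_mset u))"
      using us(1) by (simp add: sum_list_distinct_conv_sum_set)
    also have "\<dots> = (\<Sum>u\<in>set us. inject R (P u) * mon n u x)"
      by (intro sum.cong) (auto simp: m)
    finally show ?thesis by (simp add: ev_def us(2))
  qed
qed

definition gate_monomial :: "'a p_gate \<Rightarrow> nat multiset" where
  "gate_monomial M = mset (concat (map (\<lambda>g. case g of Var i \<Rightarrow> [i] | Const _ \<Rightarrow> []) M))"

context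
  fixes K :: "'a set" and n :: nat
  assumes K: "K \<subseteq> carrier R"
begin

lemma proper_input: "wf_input K n g \<Longrightarrow> proper n (input_poly g)"
  using K by (cases g) (auto intro: proper_var proper_const)

lemma proper_p_poly:
  assumes "\<forall>g\<in>set M. wf_input K n g"
  shows "proper n (p_poly M)"
  unfolding p_poly_def using assms proper_input by (intro proper_prod) auto

lemma proper_sp_poly:
  assumes "\<forall>M\<in>set Q. \<forall>g\<in>set M. wf_input K n g"
  shows "proper n (sp_poly Q)"
  unfolding sp_poly_def using assms proper_p_poly by (intro proper_sum) auto

lemma proper_psp_poly:
  assumes "\<forall>Q\<in>set T. \<forall>M\<in>set Q. \<forall>g\<in>set M. wf_input K n g"
  shows "proper n (psp_poly T)"
  unfolding psp_poly_def using assms proper_sp_poly by (intro proper_prod) auto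

lemma p_poly_support:
  assumes "\<forall>g\<in>set M. wf_input K n g" "p_poly M u \<noteq> \<zero>"
  shows "u = gate_monomial M"
  using assms
proof (induction M arbitrary: u)
  case Nil
  then show ?case
    by (auto simp: p_poly_def mpol_prod_def indexed_const_def gate_monomial_def split: if_splits)
next
  case (Cons g M)
  have M: "\<forall>g\<in>set M. wf_input K n g" and g: "wf_input K n g" using Cons.prems by auto
  have eq: "p_poly (g # M) = mpol_mult (input_poly g) (p_poly M)"
    by (simp add: p_poly_def mpol_prod_def)
  have c: "input_poly g w \<in> carrier R" "p_poly M w \<in> carrier R" for w
    using proper_p_poly[OF M] proper_input[OF g] by (auto simp: proper_def)
  obtain v w where vw: "u = v + w" "input_poly g v \<noteq> \<zero>" "p_poly M w \<noteq> \<zero>"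
    using mpol_mult_nonzero[of "input_poly g" "p_poly M" u] Cons.prems(2) c unfolding eq by blast
  have "w = gate_monomial M" using Cons.IH[OF M vw(3)] .
  moreover have "v = (case g of Var i \<Rightarrow> {#i#} | Const _ \<Rightarrow> {#})"
    using vw(2) by (cases g) (auto simp: indexed_var_eq indexed_const_def split: if_splits)
  ultimately show ?case using vw(1) by (cases g) (auto simp: gate_monomial_def)
qed

lemma mpol_sum_nonzero:
  assumes "mpol_sum Ps u \<noteq> \<zero>"
  shows "\<exists>P\<in>set Ps. P u \<noteq> \<zero>"
proof (rule ccontr)
  assume "\<not> ?thesis"
  then have "mpol_sum Ps u = \<zero>"
    by (induction Ps) (auto simp: mpol_sum_def indexed_const_def indexed_padd_def)
  then show False using assms by simp
qed

text \<open>Each bottom gate contributes at most one monomial, so passing from gates to polynomials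
  does not increase the size.\<close>

lemma sp_poly_sparsity:
  assumes "\<forall>M\<in>set Q. \<forall>g\<in>set M. wf_input K n g"
  shows "card {u. sp_poly Q u \<noteq> \<zero>} \<le> length Q"
proof -
  have "{u. sp_poly Q u \<noteq> \<zero>} \<subseteq> gate_monomial ` set Q"
  proof
    fix u assume "u \<in> {u. sp_poly Q u \<noteq> \<zero>}"
    then obtain M where "M \<in> set Q" "p_poly M u \<noteq> \<zero>"
      using mpol_sum_nonzero[of "map p_poly Q" u] by (auto simp: sp_poly_def)
    then show "u \<in> gate_monomial ` set Q" using p_poly_support[of M u] assms by auto
  qed
  then have "card {u. sp_poly Q u \<noteq> \<zero>} \<le> card (gate_monomial ` set Q)" by (intro card_mono) auto
  also have "\<dots> \<le> length Q" using card_image_le[of "set Q" gate_monomial] card_length[of Q] by simp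
  finally show ?thesis .
qed

theorem formula_lists:
  assumes wf: "wf_spsp K n f" and ml: "multilinear_spsp f"
  shows "\<exists>g. form_vars g \<subseteq> {..<n} \<and> (\<forall>G\<in>set g. disjoint_gate G) \<and>
    length g \<le> length f \<and> (\<Sum>G\<leftarrow>g. \<Sum>Q\<leftarrow>G. length Q) \<le> (\<Sum>T\<leftarrow>f. \<Sum>Q\<leftarrow>T. length Q) \<and>
    (spsp_poly f \<noteq> indexed_const \<zero> \<longrightarrow> (\<exists>x. nz (form_eval g x))) \<and>
    (\<forall>x y. (\<forall>i<n. proj R (y i) = x ! i) \<longrightarrow> mpol_eval (spsp_poly f) x = proj R (form_eval g y))"
proof -
  define nonzero where "nonzero T \<longleftrightarrow> (\<forall>Q\<in>set T. sp_poly Q \<noteq> indexed_const \<zero>)" for T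
  define gate where "gate T = map (\<lambda>Q. sparse_of (sp_poly Q)) T" for T
  \<comment> \<open>Gates with a vanishing factor contribute zero and are dropped, because
    disjointness of the variables is available only for nonzero factors.\<close>
  define g where "g = map gate (filter nonzero f)"
  have wfT: "\<forall>Q\<in>set T. \<forall>M\<in>set Q. \<forall>g\<in>set M. wf_input K n g" if "T \<in> set f" for T
    using wf that by (auto simp: wf_spsp_def)
  have sp: "proper n (sp_poly Q)" "multilinear (sp_poly Q)" if "T \<in> set f" "Q \<in> set T" for T Q
    using proper_sp_poly wfT[OF that(1)] that ml by (auto simp: multilinear_spsp_def)
  have psp: "proper n (psp_poly T)" if "T \<in> set f" for T
    using proper_psp_poly wfT[OF that] by blast
  have spsp: "proper n (spsp_poly f)"
    unfolding spsp_poly_def using psp by (intro proper_sum) auto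
  have gate: "proj R (gate_eval (gate T) y) = proj R (ev n (psp_poly T) y)" if "T \<in> set f" for T y
  proof -
    have "map (\<lambda>Q. sparse_eval Q y) (gate T) = map (\<lambda>P. ev n P y) (map sp_poly T)"
      using sp[OF that] sparse_of(3) by (auto simp: gate_def)
    then show ?thesis
      unfolding gate_eval_def psp_poly_def using sp[OF that] by (subst proj_ev_prod) auto
  qed
  have gate0: "proj R (ev n (psp_poly T) y) = \<zero>" if T: "T \<in> set f" "\<not> nonzero T" for T y
  proof -
    obtain Q where Q: "Q \<in> set T" "sp_poly Q = indexed_const \<zero>" using T(2) by (auto simp: nonzero_def)
    have "ev n (sp_poly Q) y = 0" unfolding Q(2) by (simp add: ev_const inject_zero)
    then have "0 \<in> set (map (\<lambda>P. ev n P y) (map sp_poly T))" using Q(1) by force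
    then have "(\<Prod>P\<leftarrow>map sp_poly T. ev n P y) = 0" by (induction T) auto
    then show ?thesis
      unfolding psp_poly_def using sp[OF T(1)] by (subst proj_ev_prod) (auto simp: proj_ops field_R)
  qed
  have "proj R (form_eval (map gate (filter nonzero f')) y) = proj R (\<Sum>T\<leftarrow>f'. ev n (psp_poly T) y)"
    if "set f' \<subseteq> set f" for f' y
    using that
  proof (induction f')
    case (Cons T f')
    then show ?case
      using gate[of T y] gate0[of T y] proj_closed[OF field_R] by (auto simp: proj_ops field_R)
  qed simp
  then have "proj R (form_eval g y) = proj R (\<Sum>P\<leftarrow>map psp_poly f. ev n P y)" for y
    by (simp add: g_def o_def)
  moreover have "ev n (spsp_poly f) y = (\<Sum>P\<leftarrow>map psp_poly f. ev n P y)" for y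
    unfolding spsp_poly_def using psp by (intro ev_sum) auto
  ultimately have eval: "proj R (form_eval g y) = proj R (ev n (spsp_poly f) y)" for y by metis
  have "\<forall>x y. (\<forall>i<n. proj R (y i) = x ! i) \<longrightarrow> mpol_eval (spsp_poly f) x = proj R (form_eval g y)"
    using mpol_eval_ev[OF spsp] eval by simp
  moreover have "\<exists>x. nz (form_eval g x)" if "spsp_poly f \<noteq> indexed_const \<zero>"
    using multilinear_nonzero_point[OF spsp _ that] ml eval by (auto simp: multilinear_spsp_def nz_def)
  moreover have "form_vars g \<subseteq> {..<n}"
  proof -
    have "sparse_vars (sparse_of (sp_poly Q)) \<subseteq> {..<n}" if "T \<in> set f" "Q \<in> set T" for T Q
      using sp[OF that] sparse_of(1) by (fastforce simp: mpol_vars_def proper_def)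
    then show ?thesis by (auto simp: form_vars_def gate_vars_def g_def gate_def)
  qed
  moreover have "disjoint_gate (gate T)" if T: "T \<in> set f" "nonzero T" for T
  proof -
    have "sorted_wrt (\<lambda>P Q. mpol_vars P \<inter> mpol_vars Q = {}) (map sp_poly T)"
      using T ml sp[OF T(1)]
      by (intro multilinear_prod_disjoint) (auto simp: nonzero_def multilinear_spsp_def psp_poly_def)
    then have "sorted_wrt (\<lambda>Q Q'. mpol_vars (sp_poly Q) \<inter> mpol_vars (sp_poly Q') = {}) T"
      by (simp add: sorted_wrt_map)
    then have "sorted_wrt (\<lambda>Q Q'. sparse_vars (sparse_of (sp_poly Q)) \<inter> sparse_vars (sparse_of (sp_poly Q')) = {}) T"
      by (rule sorted_wrt_mono_rel[rotated]) (use sp[OF T(1)] sparse_of(1) in metis)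
    then show ?thesis by (simp add: disjoint_gate_def gate_def sorted_wrt_map)
  qed
  then have "\<forall>G\<in>set g. disjoint_gate G" by (auto simp: g_def)
  moreover have "length g \<le> length f" by (simp add: g_def)
  moreover have "(\<Sum>G\<leftarrow>g. \<Sum>Q\<leftarrow>G. length Q) \<le> (\<Sum>T\<leftarrow>f. \<Sum>Q\<leftarrow>T. length Q)"
  proof -
    have T: "(\<Sum>Q\<leftarrow>gate T. length Q) \<le> (\<Sum>Q\<leftarrow>T. length Q)" if "T \<in> set f" for T
      unfolding gate_def map_map o_def
      using sp[OF that] sparse_of(2) sp_poly_sparsity wfT[OF that] by (intro sum_list_mono) metis
    have "(\<Sum>G\<leftarrow>map gate (filter nonzero f'). \<Sum>Q\<leftarrow>G. length Q) \<le> (\<Sum>T\<leftarrow>f'. \<Sum>Q\<leftarrow>T. length Q)"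
      if "set f' \<subseteq> set f" for f'
      using that
    proof (induction f')
      case (Cons T f')
      then show ?case using T[of T] by auto
    qed simp
    then show ?thesis by (simp only: g_def)
  qed
  ultimately show ?thesis by blast
qed

end

end

section \<open>Reasoning about programs with a time bound\<close>

text \<open>\<open>run_time B p\<close> bounds the running time of \<open>p\<close> provided that every loop takes at most \<open>B\<close> rounds.\<close>

primrec run_time :: "nat \<Rightarrow> prog \<Rightarrow> nat" where
  "run_time B (Do i) = 1"
| "run_time B (Then p q) = run_time B p + run_time B q"
| "run_time B (IfN r p q) = 1 + run_time B p + run_time B q"
| "run_time B (IfF r p q) = 1 + run_time B p + run_time B q"
| "run_time B (WhileN r p) = B * (1 + run_time B p) + 1"

text \<open>For a fixed program each level of loop nesting raises the degree by one.\<close>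

lemma run_time_polynomial: "\<exists>a b. \<forall>B. run_time B p \<le> a * Suc B ^ b"
proof (induction p)
  case (Do i)
  show ?case by (intro exI[of _ 1] exI[of _ 0]) simp
next
  have sum: "\<exists>a b. \<forall>B. 1 + run_time B p + run_time B q \<le> a * Suc B ^ b"
    if p: "\<exists>a b. \<forall>B. run_time B p \<le> a * Suc B ^ b" and q: "\<exists>a b. \<forall>B. run_time B q \<le> a * Suc B ^ b" for p q
  proof -
    obtain a b where p: "\<And>B. run_time B p \<le> a * Suc B ^ b" using p by blast
    obtain c d where q: "\<And>B. run_time B q \<le> c * Suc B ^ d" using q by blast
    have "1 + run_time B p + run_time B q \<le> (1 + a + c) * Suc B ^ (b + d)" for B
    proof -
      have "1 \<le> Suc B ^ (b + d)" by simp
      moreover have "run_time B p \<le> a * Suc B ^ (b + d)"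
        using p[of B] by (rule le_trans) (intro mult_le_mono2 power_increasing, auto)
      moreover have "run_time B q \<le> c * Suc B ^ (b + d)"
        using q[of B] by (rule le_trans) (intro mult_le_mono2 power_increasing, auto)
      ultimately have "1 + run_time B p + run_time B q \<le>
          Suc B ^ (b + d) + a * Suc B ^ (b + d) + c * Suc B ^ (b + d)" by linarith
      then show ?thesis by (simp only: distrib_right mult_1)
    qed
    then show ?thesis by blast
  qed
  {
    case (Then p q)
    from sum[OF Then] show ?case by (auto intro: Suc_leD)
  next
    case (IfN r p q)
    from sum[OF IfN] show ?case by simp
  next
    case (IfF r p q)
    from sum[OF IfF] show ?case by simp
  next
    case (WhileN r p)
    then obtain a b where p: "\<And>B. run_time B p \<le> a * Suc B ^ b" by blast
    have "run_time B (WhileN r p) \<le> (1 + a + 1) * Suc B ^ Suc b" for B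
    proof -
      have "1 \<le> Suc B ^ b" by simp
      then have "1 + run_time B p \<le> Suc B ^ b + a * Suc B ^ b" using p[of B] by linarith
      then have "B * (1 + run_time B p) \<le> Suc B * (Suc B ^ b + a * Suc B ^ b)"
        by (intro mult_le_mono) auto
      moreover have "1 \<le> Suc B ^ Suc b" by (simp only: one_le_power le_add1 Suc_eq_plus1_left)
      moreover have "(1 + a + 1) * Suc B ^ Suc b = Suc B * (Suc B ^ b + a * Suc B ^ b) + Suc B ^ Suc b"
        by (simp only: power_Suc distrib_right distrib_left mult_1 mult_ac)
      ultimately show ?thesis by (simp only: run_time.simps)
    qed
    then show ?case by blast
  }
qed

text \<open>Total correctness: the run is asserted to exist, with its time bound.\<close>

definition wp :: "('a, 'b) ring_scheme \<Rightarrow> (nat \<Rightarrow> 'a) \<Rightarrow> nat \<Rightarrow> prog \<Rightarrow> ('a state \<Rightarrow> bool) \<Rightarrow> 'a state \<Rightarrow> bool" where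
  "wp R e B p Q s \<longleftrightarrow> (\<exists>t s'. run R e p s t s' \<and> t \<le> run_time B p \<and> Q s')"

fun block :: "instr list \<Rightarrow> prog" where
  "block [] = Do (SetN 0 0)"
| "block [i] = Do i"
| "block (i # j # is) = Then (Do i) (block (j # is))"

declare block.simps [simp del]

definition copy :: "nat \<Rightarrow> nat \<Rightarrow> instr" where
  "copy r a = AddN r a 2"

context
  fixes R :: "('a, 'b) ring_scheme" and e :: "nat \<Rightarrow> 'a" and B :: nat
begin

lemma wp_Do: "Q (exec_instr R e i s) \<Longrightarrow> wp R e B (Do i) Q s"
  unfolding wp_def by (intro exI conjI, rule run.Do) simp_all

lemma wp_Then: "wp R e B p (wp R e B q Q) s \<Longrightarrow> wp R e B (Then p q) Q s"
  unfolding wp_def by (metis add_mono run.Then run_time.simps(2))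

lemma wp_block: "is \<noteq> [] \<Longrightarrow> Q (fold (exec_instr R e) is s) \<Longrightarrow> wp R e B (block is) Q s"
proof (induction "is" arbitrary: s rule: block.induct)
  case (2 i)
  then show ?case by (simp add: wp_Do block.simps)
next
  case (3 i j "is")
  show ?case unfolding block.simps
    by (rule wp_Then, rule wp_Do, rule "3.IH") (use "3.prems" in simp_all)
qed auto

lemma wp_IfN:
  "(fst s r \<noteq> 0 \<Longrightarrow> wp R e B p Q s) \<Longrightarrow> (fst s r = 0 \<Longrightarrow> wp R e B q Q s) \<Longrightarrow> wp R e B (IfN r p q) Q s"
  unfolding wp_def
proof (cases "fst s r = 0")
  case True
  assume "fst s r = 0 \<Longrightarrow> \<exists>t s'. run R e q s t s' \<and> t \<le> run_time B q \<and> Q s'"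
  then obtain t s' where "run R e q s t s'" "t \<le> run_time B q" "Q s'" using True by blast
  then show "\<exists>t s'. run R e (IfN r p q) s t s' \<and> t \<le> run_time B (IfN r p q) \<and> Q s'"
    by (intro exI[of _ "1 + t"] exI[of _ s'] conjI run.IfN_zero True) auto
next
  case False
  assume "fst s r \<noteq> 0 \<Longrightarrow> \<exists>t s'. run R e p s t s' \<and> t \<le> run_time B p \<and> Q s'"
  then obtain t s' where "run R e p s t s'" "t \<le> run_time B p" "Q s'" using False by blast
  then show "\<exists>t s'. run R e (IfN r p q) s t s' \<and> t \<le> run_time B (IfN r p q) \<and> Q s'"
    by (intro exI[of _ "1 + t"] exI[of _ s'] conjI run.IfN_pos False) auto
qed

lemma wp_While:
  assumes "n \<le> B" "I 0 s"
    and body: "\<And>k s. k < n \<Longrightarrow> I k s \<Longrightarrow> fst s r \<noteq> 0 \<and> wp R e B p (I (Suc k)) s"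
    and final: "\<And>s. I n s \<Longrightarrow> fst s r = 0 \<and> Q s"
  shows "wp R e B (WhileN r p) Q s"
proof -
  have "\<exists>t s'. run R e (WhileN r p) s t s' \<and> t \<le> (n - k) * (1 + run_time B p) + 1 \<and> Q s'"
    if "k \<le> n" "I k s" for k s
    using that
  proof (induction "n - k" arbitrary: k s)
    case 0
    then have "I n s" by simp
    then show ?case using final run.WhileN_stop[of s r R e p] by fastforce
  next
    case (Suc d)
    then have k: "k < n" by simp
    from body[OF k Suc.prems(2)] obtain t s' where 1: "fst s r \<noteq> 0" "run R e p s t s'" "t \<le> run_time B p" "I (Suc k) s'"
      unfolding wp_def by blast
    have "\<exists>t' s''. run R e (WhileN r p) s' t' s'' \<and>
        t' \<le> (n - Suc k) * (1 + run_time B p) + 1 \<and> Q s''"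
      by (rule Suc.hyps(1)) (use Suc.hyps(2) k 1(4) in auto)
    then obtain t' s'' where 2: "run R e (WhileN r p) s' t' s''"
      "t' \<le> (n - Suc k) * (1 + run_time B p) + 1" "Q s''" by blast
    have "n - k = Suc (n - Suc k)" using k by simp
    then have "1 + t + t' \<le> (n - k) * (1 + run_time B p) + 1"
      using 1(3) 2(2) by simp
    then show ?case using run.WhileN_loop[OF 1(1,2) 2(1)] 2(3) by blast
  qed
  from this[of 0 s] obtain t s' where
    "run R e (WhileN r p) s t s'" "t \<le> n * (1 + run_time B p) + 1" "Q s'"
    using assms(2) by auto
  moreover have "n * (1 + run_time B p) \<le> B * (1 + run_time B p)"
    using assms(1) by (rule mult_le_mono1)
  ultimately show ?thesis unfolding wp_def by fastforce
qed

end

definition mul :: "nat \<Rightarrow> nat \<Rightarrow> nat \<Rightarrow> nat \<Rightarrow> prog" where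
  "mul r a b c = Then (block [SetN r 0, copy c b]) (WhileN c (block [AddN r r a, SubN c c 3]))"

text \<open>The guard \<open>g = r + 1 - d\<close>, with truncated subtraction, is nonzero exactly
  when \<open>d \<le> r\<close>.\<close>

definition divmod :: "nat \<Rightarrow> nat \<Rightarrow> nat \<Rightarrow> nat \<Rightarrow> prog" where
  "divmod q r d g = Then (block [SetN q 0, AddN g r 3, SubN g g d])
     (WhileN g (block [SubN r r d, AddN q q 3, AddN g r 3, SubN g g d]))"

text \<open>Registers 2 and 3 hold the constants 0 and 1 throughout.\<close>

lemma wp_mul:
  assumes "fst s 2 = 0" "fst s 3 = 1" "fst s b \<le> B"
    and "r \<notin> {a, b, c, 2, 3}" "c \<notin> {a, b, 2, 3}"
    and "Q ((fst s)(r := fst s a * fst s b, c := 0), snd s)"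
  shows "wp R e B (mul r a b c) Q s"
proof -
  obtain \<nu> \<phi> where s: "s = (\<nu>, \<phi>)" by (cases s)
  show ?thesis unfolding mul_def
  proof (intro wp_Then wp_block)
    show "wp R e B (WhileN c (block [AddN r r a, SubN c c 3])) Q
      (fold (exec_instr R e) [SetN r 0, copy c b] s)"
    proof (rule wp_While[where n = "\<nu> b" and I = "\<lambda>k s. s = (\<nu>(r := k * \<nu> a, c := \<nu> b - k), \<phi>)"])
      show "fold (exec_instr R e) [SetN r 0, copy c b] s = (\<nu>(r := 0 * \<nu> a, c := \<nu> b - 0), \<phi>)"
        using assms by (simp add: s copy_def)
      fix k s' assume k: "k < \<nu> b" and s': "s' = (\<nu>(r := k * \<nu> a, c := \<nu> b - k), \<phi>)"
      show "fst s' c \<noteq> 0 \<and> wp R e B (block [AddN r r a, SubN c c 3])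
          (\<lambda>s. s = (\<nu>(r := Suc k * \<nu> a, c := \<nu> b - Suc k), \<phi>)) s'"
      proof
        show "fst s' c \<noteq> 0" using k by (simp add: s')
        have regs: "\<nu> 3 = 1" "r \<noteq> a" "r \<noteq> c" "c \<noteq> a" "r \<noteq> 3" "c \<noteq> 3" using assms by (auto simp: s)
        have "fold (exec_instr R e) [AddN r r a, SubN c c 3] s' = (\<nu>(r := Suc k * \<nu> a, c := \<nu> b - Suc k), \<phi>)"
          using regs by (simp add: s' fun_upd_twist[of c r] add.commute)
        then show "wp R e B (block [AddN r r a, SubN c c 3])
            (\<lambda>s. s = (\<nu>(r := Suc k * \<nu> a, c := \<nu> b - Suc k), \<phi>)) s'"
          by (intro wp_block) auto
      qed
    next
      fix s' assume s': "s' = (\<nu>(r := \<nu> b * \<nu> a, c := \<nu> b - \<nu> b), \<phi>)"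
      show "fst s' c = 0 \<and> Q s'" using assms by (simp add: s s' mult.commute)
    qed (use assms s in simp)
  qed simp
qed

lemma wp_divmod:
  assumes "fst s 2 = 0" "fst s 3 = 1" "fst s r \<le> B" "0 < fst s d" "distinct [q, r, d, g, 2, 3]"
    and "Q ((fst s)(q := fst s r div fst s d, r := fst s r mod fst s d, g := 0), snd s)"
  shows "wp R e B (divmod q r d g) Q s"
proof -
  obtain \<nu> \<phi> where s: "s = (\<nu>, \<phi>)" by (cases s)
  define I where "I k s' \<longleftrightarrow> s' = (\<nu>(q := k, r := \<nu> r - k * \<nu> d, g := \<nu> r - k * \<nu> d + 1 - \<nu> d), \<phi>)"
    for k and s' :: "'a state"
  show ?thesis unfolding divmod_def
  proof (intro wp_Then wp_block)
    show "wp R e B (WhileN g (block [SubN r r d, AddN q q 3, AddN g r 3, SubN g g d])) Q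
      (fold (exec_instr R e) [SetN q 0, AddN g r 3, SubN g g d] s)"
    proof (rule wp_While[where n = "\<nu> r div \<nu> d" and I = I])
      show "I 0 (fold (exec_instr R e) [SetN q 0, AddN g r 3, SubN g g d] s)"
        using assms by (auto simp: s I_def fun_eq_iff)
      show "\<nu> r div \<nu> d \<le> B" using assms(3) s le_trans[OF div_le_dividend] by simp
      fix k s' assume k: "k < \<nu> r div \<nu> d" and s': "I k s'"
      have "Suc k * \<nu> d \<le> \<nu> r"
        using k mult_le_mono1[of "Suc k" "\<nu> r div \<nu> d" "\<nu> d"] div_times_less_eq_dividend[of "\<nu> r" "\<nu> d"] by linarith
      then have le: "\<nu> d \<le> \<nu> r - k * \<nu> d" by simp
      have sub: "\<nu> r - k * \<nu> d - \<nu> d = \<nu> r - Suc k * \<nu> d" by simp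
      show "fst s' g \<noteq> 0 \<and> wp R e B (block [SubN r r d, AddN q q 3, AddN g r 3, SubN g g d]) (I (Suc k)) s'"
      proof
        show "fst s' g \<noteq> 0" using s' le by (simp add: I_def)
        show "wp R e B (block [SubN r r d, AddN q q 3, AddN g r 3, SubN g g d]) (I (Suc k)) s'"
        proof (rule wp_block)
          have "\<nu> 3 = 1" "q \<noteq> r" "q \<noteq> d" "q \<noteq> g" "r \<noteq> d" "r \<noteq> g" "d \<noteq> g" "q \<noteq> 3" "r \<noteq> 3" "g \<noteq> 3"
            using assms(2,5) by (auto simp: s)
          then show "I (Suc k) (fold (exec_instr R e) [SubN r r d, AddN q q 3, AddN g r 3, SubN g g d] s')"
            using s' sub by (simp add: I_def fun_upd_twist[of q r] fun_upd_twist[of r g] fun_upd_twist[of q g])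
        qed simp
      qed
    next
      fix s' assume s': "I (\<nu> r div \<nu> d) s'"
      have "\<nu> r - \<nu> r div \<nu> d * \<nu> d = \<nu> r mod \<nu> d" by (rule minus_div_mult_eq_mod)
      moreover have "\<nu> r mod \<nu> d < \<nu> d" using assms(4) s by simp
      ultimately have "s' = (\<nu>(q := \<nu> r div \<nu> d, r := \<nu> r mod \<nu> d, g := 0), \<phi>)"
        using s' by (simp add: I_def)
      then show "fst s' g = 0 \<and> Q s'" using assms(6) by (simp add: s)
    qed
  qed simp
qed

section \<open>Parameters of the construction\<close>

definition cbrt :: "nat \<Rightarrow> nat" where
  "cbrt n = (LEAST u. n \<le> u ^ 3)"

definition parts :: "nat \<Rightarrow> nat" where
  "parts n = 3 * (cbrt n)\<^sup>2"

definition lg :: "nat \<Rightarrow> nat" where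
  "lg n = (LEAST l. parts n < 2 ^ l)"

text \<open>For \<open>t = K + lg n\<close>, the length \<open>5 * t\<close> exceeds
  \<open>K + 3 * t\<close>, as \<open>hitting_point\<close> requires, and the block of hash digits,
  which has the same length, holds the \<open>2 * t\<close> hash coefficients.\<close>

definition curve_len :: "nat \<Rightarrow> nat \<Rightarrow> nat" where
  "curve_len n K = 5 * (K + lg n)"

text \<open>The bound of \<open>prime_between\<close> for \<open>x = n + parts n + 2\<close>. It
  exceeds \<open>n\<close>, so one digit can hold a hash coefficient, the index of a field element
  or a position.\<close>

definition base :: "nat \<Rightarrow> nat" where
  "base n = 4 * (n + parts n + 2)\<^sup>2"

definition pos_start :: "nat \<Rightarrow> nat \<Rightarrow> nat" where
  "pos_start n K = 1 + curve_len n K + parts n * curve_len n K"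

definition full_width :: "nat \<Rightarrow> nat \<Rightarrow> nat" where
  "full_width n K = pos_start n K + 2 * (parts n * curve_len n K)"

text \<open>A point is given by \<open>full_width\<close> digits: the modulus of the hash function minus one, the coefficients of
  the hash function, those of the curves, and the positions that are shifted by 1. If these are more
  than \<open>n + 1\<close> digits, the full grid is smaller, and it is addressed by a first digit 0.\<close>

definition width :: "nat \<Rightarrow> nat \<Rightarrow> nat" where
  "width n K = min (n + 1) (full_width n K)"

text \<open>The default 0 matters: a grid point asks for the digits 1 to \<open>n\<close> even if
  there are fewer.\<close>

definition digit :: "nat \<Rightarrow> nat \<Rightarrow> nat \<Rightarrow> nat \<Rightarrow> nat" where
  "digit N M i k = (if k < M then i div N ^ k mod N else 0)"

primrec hash_acc :: "(nat \<Rightarrow> nat) \<Rightarrow> nat \<Rightarrow> nat \<Rightarrow> nat \<Rightarrow> nat" where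
  "hash_acc d j p 0 = 0"
| "hash_acc d j p (Suc i) = (hash_acc d j p i * j + d (Suc i)) mod p"

primrec curve_acc :: "('a, 'b) ring_scheme \<Rightarrow> (nat \<Rightarrow> 'a) \<Rightarrow> (nat \<Rightarrow> nat) \<Rightarrow> nat \<Rightarrow> nat \<Rightarrow> nat \<Rightarrow> 'a" where
  "curve_acc R e d j a 0 = \<zero>\<^bsub>R\<^esub>"
| "curve_acc R e d j a (Suc i) = (curve_acc R e d j a i \<otimes>\<^bsub>R\<^esub> e j) \<oplus>\<^bsub>R\<^esub> e (d (a + i))"

primrec pos_acc :: "('a, 'b) ring_scheme \<Rightarrow> (nat \<Rightarrow> nat) \<Rightarrow> nat \<Rightarrow> nat \<Rightarrow> 'a \<Rightarrow> nat \<Rightarrow> 'a" where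
  "pos_acc R d j a v 0 = v"
| "pos_acc R d j a v (Suc i) = (if d (a + i) = j then pos_acc R d j a v i \<oplus>\<^bsub>R\<^esub> \<one>\<^bsub>R\<^esub> else pos_acc R d j a v i)"

definition part_of :: "nat \<Rightarrow> nat \<Rightarrow> (nat \<Rightarrow> nat) \<Rightarrow> nat \<Rightarrow> nat" where
  "part_of n K d j = hash_acc d j (d 0 + 1) (curve_len n K) mod parts n"

definition coord :: "('a, 'b) ring_scheme \<Rightarrow> (nat \<Rightarrow> 'a) \<Rightarrow> nat \<Rightarrow> nat \<Rightarrow> (nat \<Rightarrow> nat) \<Rightarrow> nat \<Rightarrow> 'a" where
  "coord R e n K d j =
     (if d 0 = 0 then e (d (Suc j))
      else pos_acc R d j (pos_start n K)
        (curve_acc R e d j (1 + curve_len n K + part_of n K d j * curve_len n K) (curve_len n K))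
        (width n K - pos_start n K))"

lemma cbrt: "n \<le> cbrt n ^ 3" "k < cbrt n \<Longrightarrow> k ^ 3 < n"
proof -
  have "n \<le> n ^ 3" by (simp add: power3_eq_cube)
  then show "n \<le> cbrt n ^ 3" unfolding cbrt_def by (rule LeastI)
  show "k < cbrt n \<Longrightarrow> k ^ 3 < n" unfolding cbrt_def using not_less_Least by (meson not_le)
qed

lemma lg: "parts n < 2 ^ lg n" "l < lg n \<Longrightarrow> 2 ^ l \<le> parts n"
proof -
  have "parts n < 2 ^ parts n" by (rule less_exp)
  then show "parts n < 2 ^ lg n" unfolding lg_def by (rule LeastI)
  show "l < lg n \<Longrightarrow> 2 ^ l \<le> parts n" unfolding lg_def using not_less_Least by (meson not_le)
qed

lemma base_pos: "0 < base n"
  by (simp add: base_def)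

text \<open>A common bound for the rounds of all loops, including those inside \<open>mul\<close>
  and \<open>divmod\<close>: \<open>base n * base n\<close> covers the reduction of hash values, and
  the last summand the number of points and the extraction of their digits.\<close>

definition round_bound :: "nat \<Rightarrow> nat \<Rightarrow> nat" where
  "round_bound n K = n + K + cbrt n + (cbrt n)\<^sup>2 + lg n + curve_len n K + (n + parts n + 2) + base n * base n
     + full_width n K + base n ^ width n K"

section \<open>The program\<close>

text \<open>Registers: 0 \<open>n\<close>, 1 \<open>K\<close>, 7 \<open>parts\<close>, 10 \<open>lg\<close>, 12 \<open>curve_len\<close>, 14 \<open>base\<close>, 17 \<open>pos_start\<close>, 18 \<open>width\<close>,
  19 \<open>width - pos_start\<close>, 20 the number of points, 21 those still to be written, 23 the index of the
  current point, 24 the next output cell, 28 the current coordinate, 100 onwards the digits.\<close>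

definition prog_cbrt :: prog where
  "prog_cbrt = Then (block [SetN 3 1, SetN 4 0, copy 5 0])
     (Then (WhileN 5 (Then (block [AddN 4 4 3]) (Then (mul 6 4 4 9) (Then (mul 8 6 4 9) (block [SubN 5 0 8])))))
     (Then (mul 6 4 4 9) (block [AddN 7 6 6, AddN 7 7 6])))"

definition prog_lg :: prog where
  "prog_lg = Then (block [SetN 8 1, SetN 10 0, AddN 5 7 3, SubN 5 5 8])
     (WhileN 5 (block [AddN 8 8 8, AddN 10 10 3, AddN 5 7 3, SubN 5 5 8]))"

definition prog_lengths :: prog where
  "prog_lengths = block [AddN 11 1 10, AddN 12 11 11, AddN 12 12 12, AddN 12 12 11,
       AddN 13 0 7, AddN 13 13 3, AddN 13 13 3]"

definition prog_base :: prog where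
  "prog_base = Then (mul 14 13 13 9) (block [AddN 14 14 14, AddN 14 14 14])"

text \<open>The minimum in \<open>width\<close> is computed as
  \<open>n + 1 - (n + 1 - full_width)\<close> with truncated subtraction.\<close>

definition prog_widths :: prog where
  "prog_widths = Then (mul 15 7 12 9) (block [AddN 17 12 15, AddN 17 17 3, AddN 16 17 15, AddN 16 16 15,
       AddN 18 0 3, SubN 19 18 16, SubN 18 18 19, SubN 19 18 17, SetN 20 1, copy 21 18])"

definition prog_power :: prog where
  "prog_power = Then (WhileN 21 (Then (mul 22 20 14 9) (block [copy 20 22, SubN 21 21 3])))
     (block [SetN 23 0, copy 21 20, SetN 24 0])"

definition prog_digits :: prog where
  "prog_digits = Then (block [copy 25 23, SetN 26 100, copy 27 18])
     (WhileN 27 (Then (divmod 29 25 14 9) (block [StoreN 26 25, copy 25 29, AddN 26 26 3, SubN 27 27 3])))"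

definition prog_grid :: prog where
  "prog_grid = block [AddN 32 28 30, AddN 32 32 3, LoadN 33 32, EnumF 24 33]"

definition prog_hash :: prog where
  "prog_hash = Then (block [AddN 34 31 3, SetN 35 0, SetN 36 101, copy 37 12])
     (Then (WhileN 37 (Then (mul 38 35 28 9) (Then (block [LoadN 39 36, AddN 35 38 39])
       (Then (divmod 40 35 34 9) (block [AddN 36 36 3, SubN 37 37 3])))))
     (Then (divmod 40 35 7 9) (Then (mul 38 35 12 9) (block [AddN 36 38 12, AddN 36 36 3, AddN 36 36 30]))))"

text \<open>The two field cells after the current output cell serve as scratch space. Coordinates
  are written in increasing order, so no earlier one is lost.\<close>

definition prog_curve :: prog where
  "prog_curve = Then (block [AddN 41 24 3, AddN 42 41 3, ZeroF 24, EnumF 41 28, copy 37 12])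
     (WhileN 37 (block [MulF 24 24 41, LoadN 39 36, EnumF 42 39, AddF 24 24 42, AddN 36 36 3, SubN 37 37 3]))"

text \<open>Numbers can only be tested for zero, so equality of a position with the current variable
  is tested by the sum of both truncated differences.\<close>

definition prog_pos :: prog where
  "prog_pos = Then (block [OneF 41, AddN 36 17 30, copy 37 19])
     (WhileN 37 (Then (block [LoadN 39 36, SubN 38 39 28, SubN 40 28 39, AddN 38 38 40])
       (Then (IfN 38 (block [SetN 38 0]) (block [AddF 24 24 41])) (block [AddN 36 36 3, SubN 37 37 3]))))"

definition prog_point :: prog where
  "prog_point = Then (block [SetN 28 0, copy 27 0, SetN 30 100, LoadN 31 30])
     (WhileN 27 (Then (IfN 31 (Then prog_hash (Then prog_curve prog_pos)) prog_grid)
       (block [AddN 28 28 3, AddN 24 24 3, SubN 27 27 3])))"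

definition prog_main :: prog where
  "prog_main = Then prog_cbrt (Then prog_lg (Then prog_lengths (Then prog_base (Then prog_widths (Then prog_power
     (Then (WhileN 21 (Then prog_digits (Then prog_point (block [AddN 23 23 3, SubN 21 21 3]))))
     (block [copy 0 20])))))))"

section \<open>Correctness of the subprograms\<close>

definition frame :: "nat set \<Rightarrow> (nat \<Rightarrow> nat) \<Rightarrow> (nat \<Rightarrow> nat) \<Rightarrow> bool" where
  "frame W \<nu> \<nu>' \<longleftrightarrow> (\<forall>r. r \<notin> W \<longrightarrow> \<nu>' r = \<nu> r)"

lemma frameD: "frame W \<nu> \<nu>' \<Longrightarrow> r \<notin> W \<Longrightarrow> \<nu>' r = \<nu> r"
  by (simp add: frame_def)

context
  fixes R :: "('a, 'b) ring_scheme" and e :: "nat \<Rightarrow> 'a" and n K B :: nat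
  assumes B: "round_bound n K \<le> B"
begin

lemma bounds:
  "n \<le> B" "cbrt n \<le> B" "(cbrt n)\<^sup>2 \<le> B" "lg n \<le> B" "curve_len n K \<le> B"
  "n + parts n + 2 \<le> B" "base n * base n \<le> B" "full_width n K \<le> B" "base n ^ width n K \<le> B" "base n \<le> B"
proof -
  have "base n \<le> base n * base n" by simp
  then show "n \<le> B" "cbrt n \<le> B" "(cbrt n)\<^sup>2 \<le> B" "lg n \<le> B" "curve_len n K \<le> B"
    "n + parts n + 2 \<le> B" "base n * base n \<le> B" "full_width n K \<le> B" "base n ^ width n K \<le> B" "base n \<le> B"
    using B unfolding round_bound_def by linarith+
qed

abbreviation "WP \<equiv> wp R e B"

lemma wp_cbrt:
  assumes "\<nu> 0 = n" "\<nu> 2 = 0"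
    and Q: "\<And>\<nu>'. frame {3..9} \<nu> \<nu>' \<Longrightarrow> \<nu>' 3 = 1 \<Longrightarrow> \<nu>' 7 = parts n \<Longrightarrow> Q (\<nu>', \<phi>)"
  shows "WP prog_cbrt Q (\<nu>, \<phi>)"
  unfolding prog_cbrt_def
proof (intro wp_Then wp_block)
  let ?loop = "Then (block [AddN 4 4 3]) (Then (mul 6 4 4 9) (Then (mul 8 6 4 9) (block [SubN 5 0 8])))"
  let ?rest = "Then (mul 6 4 4 9) (block [AddN 7 6 6, AddN 7 7 6])"
  define I where "I k s \<longleftrightarrow> snd s = \<phi> \<and> frame {3..9} \<nu> (fst s) \<and> fst s 3 = 1 \<and> fst s 4 = k \<and> fst s 5 = n - k ^ 3"
    for k and s :: "'a state"
  show "WP (WhileN 5 ?loop) (WP ?rest Q) (fold (exec_instr R e) [SetN 3 1, SetN 4 0, copy 5 0] (\<nu>, \<phi>))"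
  proof (rule wp_While[where n = "cbrt n" and I = I])
    show "I 0 (fold (exec_instr R e) [SetN 3 1, SetN 4 0, copy 5 0] (\<nu>, \<phi>))"
      using assms by (auto simp: I_def frame_def copy_def)
    fix k s assume k: "k < cbrt n" and s: "I k s"
    obtain \<nu>' where s': "s = (\<nu>', \<phi>)" using s by (cases s) (auto simp: I_def)
    have c: "\<nu>' 0 = n" "\<nu>' 2 = 0" "\<nu>' 3 = 1" "\<nu>' 4 = k" "\<nu>' 5 = n - k ^ 3" "frame {3..9} \<nu> \<nu>'"
      using s assms by (auto simp: I_def s' frame_def)
    have k1: "Suc k \<le> B" using k bounds(2) by simp
    show "fst s 5 \<noteq> 0 \<and> WP ?loop (I (Suc k)) s"
    proof
      show "fst s 5 \<noteq> 0" using cbrt(2)[OF k] c by (simp add: s')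
      show "WP ?loop (I (Suc k)) s"
        by (intro wp_Then wp_block wp_mul)
          (use c k1 in \<open>auto simp: s' I_def frame_def power3_eq_cube mult.assoc\<close>)
    qed
  next
    fix s assume s: "I (cbrt n) s"
    obtain \<nu>' where s': "s = (\<nu>', \<phi>)" using s by (cases s) (auto simp: I_def)
    have c: "\<nu>' 2 = 0" "\<nu>' 3 = 1" "\<nu>' 4 = cbrt n" "\<nu>' 5 = 0" "frame {3..9} \<nu> \<nu>'"
      using s assms cbrt(1)[of n] by (auto simp: I_def s' frame_def)
    have "WP ?rest Q s"
      by (intro wp_Then wp_block wp_mul)
        (use c bounds(2) in \<open>auto simp: s' frame_def parts_def power2_eq_square intro!: Q\<close>)
    then show "fst s 5 = 0 \<and> WP ?rest Q s" using c by (simp add: s')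
  qed (rule bounds)
qed simp

lemma wp_lg:
  assumes "\<nu> 2 = 0" "\<nu> 3 = 1" "\<nu> 7 = parts n"
    and Q: "\<And>\<nu>'. frame {5, 8, 10} \<nu> \<nu>' \<Longrightarrow> \<nu>' 10 = lg n \<Longrightarrow> Q (\<nu>', \<phi>)"
  shows "WP prog_lg Q (\<nu>, \<phi>)"
  unfolding prog_lg_def
proof (intro wp_Then wp_block)
  let ?loop = "block [AddN 8 8 8, AddN 10 10 3, AddN 5 7 3, SubN 5 5 8]"
  define I where "I k s \<longleftrightarrow> snd s = \<phi> \<and> frame {5, 8, 10} \<nu> (fst s) \<and> fst s 8 = 2 ^ k \<and> fst s 10 = k
      \<and> fst s 5 = parts n + 1 - 2 ^ k" for k and s :: "'a state"
  show "WP (WhileN 5 ?loop) Q (fold (exec_instr R e) [SetN 8 1, SetN 10 0, AddN 5 7 3, SubN 5 5 8] (\<nu>, \<phi>))"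
  proof (rule wp_While[where n = "lg n" and I = I])
    show "I 0 (fold (exec_instr R e) [SetN 8 1, SetN 10 0, AddN 5 7 3, SubN 5 5 8] (\<nu>, \<phi>))"
      using assms by (auto simp: I_def frame_def)
    fix k s assume k: "k < lg n" and s: "I k s"
    obtain \<nu>' where s': "s = (\<nu>', \<phi>)" using s by (cases s) (auto simp: I_def)
    have c: "\<nu>' 3 = 1" "\<nu>' 7 = parts n" "\<nu>' 8 = 2 ^ k" "\<nu>' 10 = k" "\<nu>' 5 = parts n + 1 - 2 ^ k"
      "frame {5, 8, 10} \<nu> \<nu>'"
      using s assms by (auto simp: I_def s' frame_def)
    show "fst s 5 \<noteq> 0 \<and> WP ?loop (I (Suc k)) s"
    proof
      show "fst s 5 \<noteq> 0" using lg(2)[OF k] c by (simp add: s')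
      show "WP ?loop (I (Suc k)) s"
        by (rule wp_block) (use c in \<open>auto simp: s' I_def frame_def\<close>)
    qed
  next
    fix s assume s: "I (lg n) s"
    obtain \<nu>' where s': "s = (\<nu>', \<phi>)" using s by (cases s) (auto simp: I_def)
    show "fst s 5 = 0 \<and> Q s" using s lg(1)[of n] by (auto simp: s' I_def intro!: Q)
  qed (rule bounds)
qed simp

definition params :: "(nat \<Rightarrow> nat) \<Rightarrow> bool" where
  "params \<nu> \<longleftrightarrow> \<nu> 0 = n \<and> \<nu> 2 = 0 \<and> \<nu> 3 = 1 \<and> \<nu> 7 = parts n \<and> \<nu> 12 = curve_len n K \<and> \<nu> 14 = base n
     \<and> \<nu> 17 = pos_start n K \<and> \<nu> 18 = width n K \<and> \<nu> 19 = width n K - pos_start n K"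

lemma wp_lengths:
  assumes "\<nu> 0 = n" "\<nu> 1 = K" "\<nu> 3 = 1" "\<nu> 7 = parts n" "\<nu> 10 = lg n"
    and Q: "\<And>\<nu>'. frame {11, 12, 13} \<nu> \<nu>' \<Longrightarrow> \<nu>' 12 = curve_len n K \<Longrightarrow>
      \<nu>' 13 = n + parts n + 2 \<Longrightarrow> Q (\<nu>', \<phi>)"
  shows "WP prog_lengths Q (\<nu>, \<phi>)"
  unfolding prog_lengths_def
  by (rule wp_block, simp) (use assms(1-5) in \<open>auto intro!: Q simp: frame_def curve_len_def\<close>)

lemma wp_base:
  assumes "\<nu> 2 = 0" "\<nu> 3 = 1" "\<nu> 13 = n + parts n + 2"
    and Q: "\<And>\<nu>'. frame {9, 14} \<nu> \<nu>' \<Longrightarrow> \<nu>' 14 = base n \<Longrightarrow> Q (\<nu>', \<phi>)"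
  shows "WP prog_base Q (\<nu>, \<phi>)"
proof -
  have base: "base n = \<nu> 13 * \<nu> 13 + \<nu> 13 * \<nu> 13 + (\<nu> 13 * \<nu> 13 + \<nu> 13 * \<nu> 13)"
    by (simp add: base_def assms(3) power2_eq_square)
  have le: "\<nu> 13 \<le> B" using bounds(6) assms(3) by simp
  show ?thesis unfolding prog_base_def
    by (intro wp_Then wp_mul wp_block) (use assms(1,2) le in \<open>auto intro!: Q simp: frame_def base\<close>)
qed

lemma wp_widths:
  assumes "\<nu> 0 = n" "\<nu> 2 = 0" "\<nu> 3 = 1" "\<nu> 7 = parts n" "\<nu> 12 = curve_len n K" "\<nu> 14 = base n"
    and Q: "\<And>\<nu>'. frame {9, 15, 16, 17, 18, 19, 20, 21} \<nu> \<nu>' \<Longrightarrow> params \<nu>' \<Longrightarrow>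
      \<nu>' 20 = 1 \<Longrightarrow> \<nu>' 21 = width n K \<Longrightarrow> Q (\<nu>', \<phi>)"
  shows "WP prog_widths Q (\<nu>, \<phi>)"
proof -
  define c where "c = parts n * curve_len n K"
  have e: "pos_start n K = Suc (curve_len n K + c)" "full_width n K = Suc (curve_len n K + c + c + c)"
    by (simp_all add: pos_start_def full_width_def c_def)
  have w: "width n K = Suc n - (Suc n - full_width n K)" by (simp add: width_def)
  define \<nu>' where "\<nu>' = \<nu>(15 := c, 9 := 0, 17 := pos_start n K, 16 := full_width n K,
      18 := width n K, 19 := width n K - pos_start n K, 20 := 1, 21 := width n K)"
  have "Q (\<nu>', \<phi>)"
    by (rule Q) (use assms(1-6) in \<open>auto simp: \<nu>'_def frame_def params_def\<close>)
  moreover have "fold (exec_instr R e) [AddN 17 12 15, AddN 17 17 3, AddN 16 17 15, AddN 16 16 15,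
       AddN 18 0 3, SubN 19 18 16, SubN 18 18 19, SubN 19 18 17, SetN 20 1, copy 21 18]
       (\<nu>(15 := c, 9 := 0), \<phi>) = (\<nu>', \<phi>)"
    using assms(1-6) by (simp add: \<nu>'_def copy_def w e fun_eq_iff)
  ultimately show ?thesis unfolding prog_widths_def
    by (intro wp_Then wp_mul wp_block) (use assms(1-6) bounds(5) in \<open>simp_all add: c_def\<close>)
qed

lemma width_le: "width n K \<le> B"
  using bounds(8) by (simp add: width_def)

lemma wp_power:
  assumes p: "params \<nu>" "\<nu> 20 = 1" "\<nu> 21 = width n K"
    and Q: "\<And>\<nu>'. frame {9, 20, 21, 22, 23, 24} \<nu> \<nu>' \<Longrightarrow> \<nu>' 20 = base n ^ width n K \<Longrightarrow>
      \<nu>' 21 = base n ^ width n K \<Longrightarrow> \<nu>' 23 = 0 \<Longrightarrow> \<nu>' 24 = 0 \<Longrightarrow> Q (\<nu>', \<phi>)"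
  shows "WP prog_power Q (\<nu>, \<phi>)"
  unfolding prog_power_def
proof (intro wp_Then)
  let ?loop = "Then (mul 22 20 14 9) (block [copy 20 22, SubN 21 21 3])"
  let ?rest = "block [SetN 23 0, copy 21 20, SetN 24 0]"
  define I where "I k s \<longleftrightarrow> snd s = \<phi> \<and> frame {9, 20, 21, 22} \<nu> (fst s) \<and> fst s 20 = base n ^ k
      \<and> fst s 21 = width n K - k" for k and s :: "'a state"
  show "WP (WhileN 21 ?loop) (WP ?rest Q) (\<nu>, \<phi>)"
  proof (rule wp_While[where n = "width n K" and I = I])
    show "I 0 (\<nu>, \<phi>)" using p by (simp add: I_def frame_def)
    fix k s assume k: "k < width n K" and s: "I k s"
    obtain \<nu>' where s': "s = (\<nu>', \<phi>)" using s by (cases s) (auto simp: I_def)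
    have c: "\<nu>' 2 = 0" "\<nu>' 3 = 1" "\<nu>' 14 = base n" "\<nu>' 20 = base n ^ k" "\<nu>' 21 = width n K - k"
      "frame {9, 20, 21, 22} \<nu> \<nu>'"
      using s p by (auto simp: I_def s' frame_def params_def)
    show "fst s 21 \<noteq> 0 \<and> WP ?loop (I (Suc k)) s"
    proof
      show "fst s 21 \<noteq> 0" using k c by (simp add: s')
      show "WP ?loop (I (Suc k)) s"
        by (intro wp_Then wp_mul wp_block)
          (use c bounds(10) in \<open>auto simp: s' I_def frame_def copy_def\<close>)
    qed
  next
    fix s assume s: "I (width n K) s"
    obtain \<nu>' where s': "s = (\<nu>', \<phi>)" using s by (cases s) (auto simp: I_def)
    have c: "\<nu>' 2 = 0" "\<nu>' 20 = base n ^ width n K" "\<nu>' 21 = 0" "frame {9, 20, 21, 22} \<nu> \<nu>'"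
      using s p by (auto simp: I_def s' frame_def params_def)
    have "WP ?rest Q s"
      by (rule wp_block, simp) (use c in \<open>auto simp: s' frame_def copy_def intro!: Q\<close>)
    then show "fst s 21 = 0 \<and> WP ?rest Q s" using c by (simp add: s')
  qed (rule width_le)
qed

lemma wp_digits:
  assumes p: "params \<nu>" "\<nu> 23 = i" "i \<le> B"
    and Q: "\<And>\<nu>'. frame ({9, 25, 26, 27, 29} \<union> {100..<100 + width n K}) \<nu> \<nu>' \<Longrightarrow>
      (\<And>k. k < width n K \<Longrightarrow> \<nu>' (100 + k) = digit (base n) (width n K) i k) \<Longrightarrow> Q (\<nu>', \<phi>)"
  shows "WP prog_digits Q (\<nu>, \<phi>)"
  unfolding prog_digits_def
proof (intro wp_Then wp_block)
  let ?W = "{9, 25, 26, 27, 29} \<union> {100..<100 + width n K}"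
  let ?loop = "Then (divmod 29 25 14 9) (block [StoreN 26 25, copy 25 29, AddN 26 26 3, SubN 27 27 3])"
  define I where "I k s \<longleftrightarrow> snd s = \<phi> \<and> frame ?W \<nu> (fst s) \<and> fst s 25 = i div base n ^ k
      \<and> fst s 26 = 100 + k \<and> fst s 27 = width n K - k \<and>
      (\<forall>k'<k. fst s (100 + k') = digit (base n) (width n K) i k')" for k and s :: "'a state"
  show "WP (WhileN 27 ?loop) Q (fold (exec_instr R e) [copy 25 23, SetN 26 100, copy 27 18] (\<nu>, \<phi>))"
  proof (rule wp_While[where n = "width n K" and I = I])
    show "I 0 (fold (exec_instr R e) [copy 25 23, SetN 26 100, copy 27 18] (\<nu>, \<phi>))"
      using p by (auto simp: I_def frame_def params_def copy_def)
    fix k s assume k: "k < width n K" and s: "I k s"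
    obtain \<nu>' where s': "s = (\<nu>', \<phi>)" using s by (cases s) (auto simp: I_def)
    have c: "\<nu>' 2 = 0" "\<nu>' 3 = 1" "\<nu>' 14 = base n" "\<nu>' 25 = i div base n ^ k" "\<nu>' 26 = 100 + k"
      "\<nu>' 27 = width n K - k" "\<forall>k'<k. \<nu>' (100 + k') = digit (base n) (width n K) i k'" "frame ?W \<nu> \<nu>'"
      using s p by (auto simp: I_def s' frame_def params_def)
    have d: "digit (base n) (width n K) i k = i div base n ^ k mod base n" using k by (simp add: digit_def)
    have dv: "i div base n ^ Suc k = i div base n ^ k div base n" by (simp only: power_Suc2 div_mult2_eq)
    have le: "i div base n ^ k \<le> B" using p(3) le_trans[OF div_le_dividend] by blast
    show "fst s 27 \<noteq> 0 \<and> WP ?loop (I (Suc k)) s"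
    proof
      show "fst s 27 \<noteq> 0" using k c by (simp add: s')
      define \<nu>1 where "\<nu>1 = (\<nu>'(29 := i div base n ^ k div base n, 25 := i div base n ^ k mod base n, 9 := 0))"
      have "I (Suc k) (fold (exec_instr R e) [StoreN 26 25, copy 25 29, AddN 26 26 3, SubN 27 27 3] (\<nu>1, \<phi>))"
        using c k d dv by (auto simp: I_def frame_def copy_def \<nu>1_def less_Suc_eq)
      then show "WP ?loop (I (Suc k)) s"
        by (intro wp_Then wp_divmod wp_block) (use c le base_pos in \<open>simp_all add: s' \<nu>1_def\<close>)
    qed
  next
    fix s assume s: "I (width n K) s"
    obtain \<nu>' where s': "s = (\<nu>', \<phi>)" using s by (cases s) (auto simp: I_def)
    show "fst s 27 = 0 \<and> Q s" using s by (auto simp: s' I_def intro!: Q)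
  qed (rule width_le)
qed simp

context
  fixes d :: "nat \<Rightarrow> nat" and j out :: nat
  assumes d: "\<And>k. d k < base n" and j: "j < n"
begin

lemma wp_grid:
  assumes "\<nu> 3 = 1" "\<nu> 24 = out" "\<nu> 28 = j" "\<nu> 30 = 100" "\<And>k. \<nu> (100 + k) = d k"
    and Q: "\<And>\<nu>'. frame {32, 33} \<nu> \<nu>' \<Longrightarrow> Q (\<nu>', \<phi>(out := e (d (Suc j))))"
  shows "WP prog_grid Q (\<nu>, \<phi>)"
proof -
  have "\<nu> (Suc (j + 100)) = d (Suc j)" using assms(5)[of "Suc j"] by (simp add: add.commute)
  then have "fold (exec_instr R e) [AddN 32 28 30, AddN 32 32 3, LoadN 33 32, EnumF 24 33] (\<nu>, \<phi>) =
      (\<nu>(32 := Suc (j + 100), 33 := d (Suc j)), \<phi>(out := e (d (Suc j))))"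
    using assms(1-4) by simp
  moreover have "Q (\<nu>(32 := Suc (j + 100), 33 := d (Suc j)), \<phi>(out := e (d (Suc j))))"
    by (rule Q) (simp add: frame_def)
  ultimately show ?thesis
    unfolding prog_grid_def by (intro wp_block) (simp, simp only:)
qed

lemma wp_hash:
  assumes p: "params \<nu>" "\<nu> 28 = j" "\<nu> 30 = 100" "\<nu> 31 = d 0" "\<And>k. \<nu> (100 + k) = d k"
    and Q: "\<And>\<nu>'. frame ({9} \<union> {34..40}) \<nu> \<nu>' \<Longrightarrow>
      \<nu>' 36 = 100 + (1 + curve_len n K + part_of n K d j * curve_len n K) \<Longrightarrow> Q (\<nu>', \<phi>)"
  shows "WP prog_hash Q (\<nu>, \<phi>)"
  unfolding prog_hash_def
proof (intro wp_Then wp_block)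
  let ?W = "{9} \<union> {34..40}"
  let ?L = "curve_len n K"
  let ?loop = "Then (mul 38 35 28 9) (Then (block [LoadN 39 36, AddN 35 38 39])
       (Then (divmod 40 35 34 9) (block [AddN 36 36 3, SubN 37 37 3])))"
  let ?rest = "Then (divmod 40 35 7 9) (Then (mul 38 35 12 9) (block [AddN 36 38 12, AddN 36 36 3, AddN 36 36 30]))"
  let ?init = "fold (exec_instr R e) [AddN 34 31 3, SetN 35 0, SetN 36 101, copy 37 12] (\<nu>, \<phi>)"
  \<comment> \<open>The accumulator starts at 0 and is then reduced modulo \<open>d 0 + 1\<close>,
    which is at most \<open>base n\<close>. This keeps the next dividend within
    \<open>base n * base n\<close>.\<close>
  have acc: "hash_acc d j (d 0 + 1) k < base n" for k
  proof (cases k)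
    case (Suc k')
    then have "hash_acc d j (d 0 + 1) k < d 0 + 1" by (simp add: hash_acc.simps(2))
    then show ?thesis using d[of 0] by simp
  qed (simp add: base_pos)
  define I where "I k s \<longleftrightarrow> snd s = \<phi> \<and> frame ?W \<nu> (fst s) \<and> fst s 34 = d 0 + 1 \<and>
      fst s 35 = hash_acc d j (d 0 + 1) k \<and> fst s 36 = 101 + k \<and> fst s 37 = ?L - k" for k and s :: "'a state"
  show "WP (WhileN 37 ?loop) (WP ?rest Q) ?init"
  proof (rule wp_While[where n = ?L and I = I])
    show "I 0 ?init" using p by (auto simp: I_def frame_def params_def copy_def)
    fix k s assume k: "k < ?L" and s: "I k s"
    obtain \<nu>' where s': "s = (\<nu>', \<phi>)" using s by (cases s) (auto simp: I_def)
    have dk: "\<nu>' (100 + k) = d k" for k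
      using s p(5)[of k] by (auto simp: I_def s' frame_def)
    have c: "\<nu>' 2 = 0" "\<nu>' 3 = 1" "\<nu>' 28 = j" "\<nu>' 34 = d 0 + 1" "\<nu>' 35 = hash_acc d j (d 0 + 1) k"
      "\<nu>' 36 = 101 + k" "\<nu>' 37 = ?L - k" "frame ?W \<nu> \<nu>'" "\<nu>' (101 + k) = d (Suc k)"
      using s p dk[of "Suc k"] by (auto simp: I_def s' frame_def params_def)
    have "hash_acc d j (d 0 + 1) k * j + d (Suc k) \<le> (base n - 1) * (base n - 1) + (base n - 1)"
      using acc[of k] d[of "Suc k"] j base_pos by (intro add_mono mult_le_mono) (auto simp: base_def power2_eq_square)
    also have "\<dots> \<le> base n * base n" using base_pos by (cases "base n") auto
    finally have le: "hash_acc d j (d 0 + 1) k * j + d (Suc k) \<le> B" using bounds(7) by simp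
    show "fst s 37 \<noteq> 0 \<and> WP ?loop (I (Suc k)) s"
    proof
      show "fst s 37 \<noteq> 0" using k c by (simp add: s')
      show "WP ?loop (I (Suc k)) s"
        by (intro wp_Then wp_mul wp_divmod wp_block)
          (use c le j bounds(1) in \<open>simp_all add: s' I_def frame_def\<close>)
    qed
  next
    fix s assume s: "I ?L s"
    obtain \<nu>' where s': "s = (\<nu>', \<phi>)" using s by (cases s) (auto simp: I_def)
    have c: "\<nu>' 2 = 0" "\<nu>' 3 = 1" "\<nu>' 7 = parts n" "\<nu>' 12 = ?L" "\<nu>' 30 = 100" "\<nu>' 35 = hash_acc d j (d 0 + 1) ?L"
      "\<nu>' 37 = 0" "frame ?W \<nu> \<nu>'"
      using s p by (auto simp: I_def s' frame_def params_def)
    have "cbrt n \<noteq> 0"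
    proof
      assume "cbrt n = 0"
      then show False using cbrt(1)[of n] j by simp
    qed
    then have m: "0 < parts n" by (simp add: parts_def)
    have le: "hash_acc d j (d 0 + 1) ?L \<le> B" using acc[of ?L] bounds(10) by simp
    have "WP ?rest Q s"
      by (intro wp_Then wp_mul wp_divmod wp_block)
        (use c m le bounds(5) in \<open>simp_all add: s' frame_def part_of_def Q\<close>)
    then show "fst s 37 = 0 \<and> WP ?rest Q s" using c by (simp add: s')
  qed (rule bounds)
qed simp

lemma wp_curve:
  assumes p: "params \<nu>" "\<nu> 24 = out" "\<nu> 28 = j" "\<nu> 36 = 100 + a" "\<And>k. \<nu> (100 + k) = d k"
    and Q: "\<And>\<nu>' \<phi>'. frame {36, 37, 39, 41, 42} \<nu> \<nu>' \<Longrightarrow> \<nu>' 41 = out + 1 \<Longrightarrow>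
      (\<And>x. x < out \<Longrightarrow> \<phi>' x = \<phi> x) \<Longrightarrow> \<phi>' out = curve_acc R e d j a (curve_len n K) \<Longrightarrow> Q (\<nu>', \<phi>')"
  shows "WP prog_curve Q (\<nu>, \<phi>)"
  unfolding prog_curve_def
proof (intro wp_Then wp_block)
  let ?W = "{36, 37, 39, 41, 42}"
  let ?L = "curve_len n K"
  let ?loop = "block [MulF 24 24 41, LoadN 39 36, EnumF 42 39, AddF 24 24 42, AddN 36 36 3, SubN 37 37 3]"
  let ?init = "fold (exec_instr R e) [AddN 41 24 3, AddN 42 41 3, ZeroF 24, EnumF 41 28, copy 37 12] (\<nu>, \<phi>)"
  define I where "I k s \<longleftrightarrow> frame ?W \<nu> (fst s) \<and> fst s 36 = 100 + (a + k) \<and> fst s 37 = ?L - k \<and>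
      fst s 41 = out + 1 \<and> fst s 42 = out + 2 \<and> (\<forall>x<out. snd s x = \<phi> x) \<and>
      snd s out = curve_acc R e d j a k \<and> snd s (out + 1) = e j" for k and s :: "'a state"
  show "WP (WhileN 37 ?loop) Q ?init"
  proof (rule wp_While[where n = ?L and I = I])
    show "I 0 ?init" using p by (auto simp: I_def frame_def params_def copy_def)
    fix k s assume k: "k < ?L" and s: "I k s"
    obtain \<nu>' \<phi>' where s': "s = (\<nu>', \<phi>')" by (cases s)
    have c: "\<nu>' 3 = 1" "\<nu>' 24 = out" "\<nu>' 36 = 100 + (a + k)" "\<nu>' 37 = ?L - k"
      "\<nu>' 41 = out + 1" "\<nu>' 42 = out + 2" "frame ?W \<nu> \<nu>'" "\<nu>' (100 + (a + k)) = d (a + k)"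
      using s p(1-4) p(5)[of "a + k"] by (auto simp: I_def s' frame_def params_def)
    show "fst s 37 \<noteq> 0 \<and> WP ?loop (I (Suc k)) s"
    proof
      show "fst s 37 \<noteq> 0" using k c by (simp add: s')
      show "WP ?loop (I (Suc k)) s"
        by (rule wp_block) (use c s in \<open>auto simp: s' I_def frame_def\<close>)
    qed
  next
    fix s assume s: "I ?L s"
    obtain \<nu>' \<phi>' where s': "s = (\<nu>', \<phi>')" by (cases s)
    show "fst s 37 = 0 \<and> Q s" using s by (auto simp: s' I_def intro!: Q)
  qed (rule bounds)
qed simp

lemma wp_pos:
  assumes p: "params \<nu>" "\<nu> 24 = out" "\<nu> 28 = j" "\<nu> 30 = 100" "\<nu> 41 = out + 1" "\<And>k. \<nu> (100 + k) = d k"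
    and Q: "\<And>\<nu>' \<phi>'. frame {36, 37, 38, 39, 40} \<nu> \<nu>' \<Longrightarrow>
      (\<And>x. x < out \<Longrightarrow> \<phi>' x = \<phi> x) \<Longrightarrow>
      \<phi>' out = pos_acc R d j (pos_start n K) (\<phi> out) (width n K - pos_start n K) \<Longrightarrow> Q (\<nu>', \<phi>')"
  shows "WP prog_pos Q (\<nu>, \<phi>)"
  unfolding prog_pos_def
proof (intro wp_Then wp_block)
  let ?W = "{36, 37, 38, 39, 40}"
  let ?N = "width n K - pos_start n K"
  let ?loop = "Then (block [LoadN 39 36, SubN 38 39 28, SubN 40 28 39, AddN 38 38 40])
       (Then (IfN 38 (block [SetN 38 0]) (block [AddF 24 24 41])) (block [AddN 36 36 3, SubN 37 37 3]))"
  let ?init = "fold (exec_instr R e) [OneF 41, AddN 36 17 30, copy 37 19] (\<nu>, \<phi>)"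
  define I where "I k s \<longleftrightarrow> frame ?W \<nu> (fst s) \<and> fst s 36 = 100 + (pos_start n K + k) \<and> fst s 37 = ?N - k \<and>
      (\<forall>x<out. snd s x = \<phi> x) \<and> snd s out = pos_acc R d j (pos_start n K) (\<phi> out) k \<and>
      snd s (out + 1) = \<one>\<^bsub>R\<^esub>" for k and s :: "'a state"
  show "WP (WhileN 37 ?loop) Q ?init"
  proof (rule wp_While[where n = ?N and I = I])
    show "I 0 ?init" using p by (auto simp: I_def frame_def params_def copy_def)
    fix k s assume k: "k < ?N" and s: "I k s"
    obtain \<nu>' \<phi>' where s': "s = (\<nu>', \<phi>')" by (cases s)
    have c: "\<nu>' 3 = 1" "\<nu>' 24 = out" "\<nu>' 28 = j" "\<nu>' 36 = 100 + (pos_start n K + k)" "\<nu>' 37 = ?N - k"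
      "\<nu>' 41 = out + 1" "frame ?W \<nu> \<nu>'" "\<nu>' (100 + (pos_start n K + k)) = d (pos_start n K + k)"
      using s p(1-5) p(6)[of "pos_start n K + k"] by (auto simp: I_def s' frame_def params_def)
    show "fst s 37 \<noteq> 0 \<and> WP ?loop (I (Suc k)) s"
    proof
      show "fst s 37 \<noteq> 0" using k c by (simp add: s')
      show "WP ?loop (I (Suc k)) s"
        by (intro wp_Then wp_block wp_IfN) (use c s in \<open>auto simp: s' I_def frame_def\<close>)
    qed
  next
    fix s assume s: "I ?N s"
    obtain \<nu>' \<phi>' where s': "s = (\<nu>', \<phi>')" by (cases s)
    show "fst s 37 = 0 \<and> Q s" using s by (auto simp: s' I_def intro!: Q)
  next
    show "?N \<le> B" using width_le by simp
  qed
qed simp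

lemma wp_coord:
  assumes p: "params \<nu>" "\<nu> 24 = out" "\<nu> 28 = j" "\<nu> 30 = 100" "\<nu> 31 = d 0" "\<And>k. \<nu> (100 + k) = d k"
    and Q: "\<And>\<nu>' \<phi>'. frame ({9} \<union> {32..42}) \<nu> \<nu>' \<Longrightarrow>
      (\<And>x. x < out \<Longrightarrow> \<phi>' x = \<phi> x) \<Longrightarrow> \<phi>' out = coord R e n K d j \<Longrightarrow> Q (\<nu>', \<phi>')"
  shows "WP (IfN 31 (Then prog_hash (Then prog_curve prog_pos)) prog_grid) Q (\<nu>, \<phi>)"
proof (rule wp_IfN)
  assume "fst (\<nu>, \<phi>) 31 = 0"
  then have d0: "d 0 = 0" using p by simp
  have "\<nu> 3 = 1" using p(1) by (simp add: params_def)
  then show "WP prog_grid Q (\<nu>, \<phi>)"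
    by (rule wp_grid) (use p(2-6) d0 in \<open>auto intro!: Q simp: frame_def coord_def\<close>)
next
  assume "fst (\<nu>, \<phi>) 31 \<noteq> 0"
  then have d0: "d 0 \<noteq> 0" using p by simp
  show "WP (Then prog_hash (Then prog_curve prog_pos)) Q (\<nu>, \<phi>)"
  proof (rule wp_Then, rule wp_hash)
    fix \<nu>1 assume f1: "frame ({9} \<union> {34..40}) \<nu> \<nu>1"
      "\<nu>1 36 = 100 + (1 + curve_len n K + part_of n K d j * curve_len n K)"
    have p1: "params \<nu>1" "\<nu>1 24 = out" "\<nu>1 28 = j" "\<nu>1 30 = 100" "\<And>k. \<nu>1 (100 + k) = d k"
      using p f1 by (auto simp: frame_def params_def)
    show "WP (Then prog_curve prog_pos) Q (\<nu>1, \<phi>)"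
    proof (rule wp_Then, rule wp_curve[OF p1(1-3) f1(2) p1(5)])
      fix \<nu>2 \<phi>2 assume f2: "frame {36, 37, 39, 41, 42} \<nu>1 \<nu>2" "\<nu>2 41 = out + 1"
        "\<And>x. x < out \<Longrightarrow> \<phi>2 x = \<phi> x"
        "\<phi>2 out = curve_acc R e d j (1 + curve_len n K + part_of n K d j * curve_len n K) (curve_len n K)"
      have p2: "params \<nu>2" "\<nu>2 24 = out" "\<nu>2 28 = j" "\<nu>2 30 = 100" "\<And>k. \<nu>2 (100 + k) = d k"
        using p1 f2(1) by (auto simp: frame_def params_def)
      show "WP prog_pos Q (\<nu>2, \<phi>2)"
      proof (rule wp_pos[OF p2(1-4) f2(2) p2(5)])
        fix \<nu>3 \<phi>3 assume f3: "frame {36, 37, 38, 39, 40} \<nu>2 \<nu>3" "\<And>x. x < out \<Longrightarrow> \<phi>3 x = \<phi>2 x"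
          "\<phi>3 out = pos_acc R d j (pos_start n K) (\<phi>2 out) (width n K - pos_start n K)"
        have "frame ({9} \<union> {32..42}) \<nu> \<nu>3" using f1(1) f2(1) f3(1) by (auto simp: frame_def)
        then show "Q (\<nu>3, \<phi>3)"
          by (rule Q) (use f2 f3 d0 in \<open>simp_all add: coord_def\<close>)
      qed
    qed
  qed (use p in auto)
qed

end

lemma wp_point:
  fixes d :: "nat \<Rightarrow> nat"
  assumes d: "\<And>k. d k < base n"
    and p: "params \<nu>" "\<nu> 24 = out" "\<And>k. \<nu> (100 + k) = d k"
    and Q: "\<And>\<nu>' \<phi>'. frame ({9, 24} \<union> {27..42}) \<nu> \<nu>' \<Longrightarrow> \<nu>' 24 = out + n \<Longrightarrow>
      (\<And>x. x < out \<Longrightarrow> \<phi>' x = \<phi> x) \<Longrightarrow> (\<And>j. j < n \<Longrightarrow> \<phi>' (out + j) = coord R e n K d j) \<Longrightarrow> Q (\<nu>', \<phi>')"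
  shows "WP prog_point Q (\<nu>, \<phi>)"
  unfolding prog_point_def
proof (intro wp_Then wp_block)
  let ?W = "{9, 24} \<union> {27..42}"
  let ?loop = "Then (IfN 31 (Then prog_hash (Then prog_curve prog_pos)) prog_grid)
       (block [AddN 28 28 3, AddN 24 24 3, SubN 27 27 3])"
  let ?init = "fold (exec_instr R e) [SetN 28 0, copy 27 0, SetN 30 100, LoadN 31 30] (\<nu>, \<phi>)"
  define I where "I j s \<longleftrightarrow> frame ?W \<nu> (fst s) \<and> fst s 28 = j \<and> fst s 27 = n - j \<and> fst s 24 = out + j \<and>
      fst s 30 = 100 \<and> fst s 31 = d 0 \<and> (\<forall>x<out. snd s x = \<phi> x) \<and>
      (\<forall>j'<j. snd s (out + j') = coord R e n K d j')" for j and s :: "'a state"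
  show "WP (WhileN 27 ?loop) Q ?init"
  proof (rule wp_While[where n = n and I = I])
    show "I 0 ?init" using p(1,2) p(3)[of 0] by (auto simp: I_def frame_def params_def copy_def)
    fix j s assume j: "j < n" and s: "I j s"
    obtain \<nu>' \<phi>' where s': "s = (\<nu>', \<phi>')" by (cases s)
    have c: "params \<nu>'" "\<nu>' 24 = out + j" "\<nu>' 28 = j" "\<nu>' 30 = 100" "\<nu>' 31 = d 0" "\<And>k. \<nu>' (100 + k) = d k"
      "\<nu>' 27 = n - j"
      using s p by (auto simp: I_def s' frame_def params_def)
    show "fst s 27 \<noteq> 0 \<and> WP ?loop (I (Suc j)) s"
    proof
      show "fst s 27 \<noteq> 0" using j c by (simp add: s')
      show "WP ?loop (I (Suc j)) s" unfolding s'
      proof (rule wp_Then, rule wp_coord[OF d j c(1-6)])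
        fix \<nu>1 \<phi>1 assume f: "frame ({9} \<union> {32..42}) \<nu>' \<nu>1" "\<And>x. x < out + j \<Longrightarrow> \<phi>1 x = \<phi>' x"
          "\<phi>1 (out + j) = coord R e n K d j"
        have c1: "\<nu>1 3 = 1" "\<nu>1 24 = out + j" "\<nu>1 28 = j" "\<nu>1 30 = 100" "\<nu>1 31 = d 0" "\<nu>1 27 = n - j"
          using c f(1) by (auto simp: frame_def params_def)
        have fr: "frame ?W \<nu> \<nu>1" using s f(1) by (simp add: I_def s' frame_def)
        have mem: "\<forall>x<out. \<phi>1 x = \<phi> x" "\<forall>j'<Suc j. \<phi>1 (out + j') = coord R e n K d j'"
          using s f(2,3) by (auto simp: I_def s' less_Suc_eq)
        show "WP (block [AddN 28 28 3, AddN 24 24 3, SubN 27 27 3]) (I (Suc j)) (\<nu>1, \<phi>1)"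
          by (rule wp_block) (use c1 fr mem in \<open>auto simp: I_def frame_def\<close>)
      qed
    qed
  next
    fix s assume s: "I n s"
    obtain \<nu>' \<phi>' where s': "s = (\<nu>', \<phi>')" by (cases s)
    show "fst s 27 = 0 \<and> Q s" using s by (auto simp: s' I_def intro!: Q)
  qed (rule bounds)
qed simp

lemma wp_main:
  shows "WP prog_main (\<lambda>s. output_points n s =
      (\<lambda>i. map (coord R e n K (digit (base n) (width n K) i)) [0..<n]) ` {..<base n ^ width n K})
    (initial_state R n K)"
proof -
  let ?X = "base n ^ width n K"
  let ?D = "digit (base n) (width n K)"
  let ?Q = "\<lambda>s. output_points n s = (\<lambda>i. map (coord R e n K (?D i)) [0..<n]) ` {..<?X}"
  define \<nu>0 where "\<nu>0 = (\<lambda>_::nat. 0::nat)(0 := n, 1 := K)"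
  define \<phi>0 where "\<phi>0 = (\<lambda>_::nat. \<zero>\<^bsub>R\<^esub>)"
  have init: "initial_state R n K = (\<nu>0, \<phi>0)" by (simp add: initial_state_def \<nu>0_def \<phi>0_def)
  let ?loop = "Then prog_digits (Then prog_point (block [AddN 23 23 3, SubN 21 21 3]))"
  have main: "WP (WhileN 21 ?loop) (WP (block [copy 0 20]) ?Q) (\<nu>, \<phi>0)"
    if p: "params \<nu>" "\<nu> 20 = ?X" "\<nu> 21 = ?X" "\<nu> 23 = 0" "\<nu> 24 = 0" "\<And>k. \<nu> (100 + k) = 0" for \<nu>
  proof -
    define I where "I i s \<longleftrightarrow> params (fst s) \<and> fst s 20 = ?X \<and> fst s 21 = ?X - i \<and> fst s 23 = i \<and> fst s 24 = i * n \<and>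
        (\<forall>k\<ge>width n K. fst s (100 + k) = 0) \<and>
        (\<forall>i'<i. \<forall>j<n. snd s (i' * n + j) = coord R e n K (?D i') j)" for i and s :: "'a state"
    show ?thesis
    proof (rule wp_While[where n = ?X and I = I])
      show "I 0 (\<nu>, \<phi>0)" using p by (simp add: I_def)
      fix i s assume i: "i < ?X" and s: "I i s"
      obtain \<nu>' \<phi>' where s': "s = (\<nu>', \<phi>')" by (cases s)
      have c: "params \<nu>'" "\<nu>' 20 = ?X" "\<nu>' 21 = ?X - i" "\<nu>' 23 = i" "\<nu>' 24 = i * n"
        "\<forall>k\<ge>width n K. \<nu>' (100 + k) = 0"
        "\<forall>i'<i. \<forall>j<n. \<phi>' (i' * n + j) = coord R e n K (?D i') j"
        using s by (auto simp: I_def s')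
      have iB: "i \<le> B" using i bounds(9) by simp
      show "fst s 21 \<noteq> 0 \<and> WP ?loop (I (Suc i)) s"
      proof
        show "fst s 21 \<noteq> 0" using i c by (simp add: s')
        show "WP ?loop (I (Suc i)) s" unfolding s'
        proof (rule wp_Then, rule wp_digits[OF c(1,4) iB])
          fix \<nu>1 assume f1: "frame ({9, 25, 26, 27, 29} \<union> {100..<100 + width n K}) \<nu>' \<nu>1"
            "\<And>k. k < width n K \<Longrightarrow> \<nu>1 (100 + k) = ?D i k"
          have c1: "params \<nu>1" "\<nu>1 20 = ?X" "\<nu>1 21 = ?X - i" "\<nu>1 23 = i" "\<nu>1 24 = i * n"
            using c f1(1) by (auto simp: frame_def params_def)
          \<comment> \<open>Registers beyond the width are never written and still hold 0, in
            agreement with the default of \<open>digit\<close>.\<close>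
          have d1: "\<nu>1 (100 + k) = ?D i k" for k
          proof (cases "k < width n K")
            case False
            then have "\<nu>1 (100 + k) = \<nu>' (100 + k)" using frameD[OF f1(1)] by simp
            then show ?thesis using False c(6) by (simp add: digit_def)
          qed (use f1(2) in auto)
          have dl: "?D i k < base n" for k using base_pos by (simp add: digit_def)
          show "WP (Then prog_point (block [AddN 23 23 3, SubN 21 21 3])) (I (Suc i)) (\<nu>1, \<phi>')"
          proof (rule wp_Then, rule wp_point[OF dl c1(1,5) d1])
            fix \<nu>2 \<phi>2 assume f2: "frame ({9, 24} \<union> {27..42}) \<nu>1 \<nu>2" "\<nu>2 24 = i * n + n"
              "\<And>x. x < i * n \<Longrightarrow> \<phi>2 x = \<phi>' x" "\<And>j. j < n \<Longrightarrow> \<phi>2 (i * n + j) = coord R e n K (?D i) j"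
            have c2: "params \<nu>2" "\<nu>2 20 = ?X" "\<nu>2 21 = ?X - i" "\<nu>2 23 = i"
              using c1 f2(1) by (auto simp: frame_def params_def)
            have z: "\<nu>2 (100 + k) = 0" if "width n K \<le> k" for k
              using d1[of k] frameD[OF f2(1), of "100 + k"] that by (simp add: digit_def)
            have mem: "\<phi>2 (i' * n + j) = coord R e n K (?D i') j" if "i' < Suc i" "j < n" for i' j
            proof (cases "i' = i")
              case False
              then have "Suc i' * n \<le> i * n" using that(1) by (intro mult_le_mono1) simp
              then have "i' * n + j < i * n" using that(2) by simp
              then show ?thesis using f2(3) c(7) False that by auto
            qed (use f2(4) that in simp)
            show "WP (block [AddN 23 23 3, SubN 21 21 3]) (I (Suc i)) (\<nu>2, \<phi>2)"
              by (rule wp_block) (use c2 f2(2) z mem in \<open>auto simp: I_def params_def\<close>)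
          qed
        qed
      qed
    next
      fix s assume s: "I ?X s"
      obtain \<nu>' \<phi>' where s': "s = (\<nu>', \<phi>')" by (cases s)
      have c: "\<nu>' 2 = 0" "\<nu>' 20 = ?X" "\<nu>' 21 = 0"
        "\<And>i j. i < ?X \<Longrightarrow> j < n \<Longrightarrow> \<phi>' (i * n + j) = coord R e n K (?D i) j"
        using s by (auto simp: I_def s' params_def)
      have "WP (block [copy 0 20]) ?Q s"
        by (rule wp_block, simp)
          (use c in \<open>auto simp: s' copy_def output_points_def intro!: image_cong\<close>)
      then show "fst s 21 = 0 \<and> WP (block [copy 0 20]) ?Q s" using c by (simp add: s')
    qed (rule bounds)
  qed
  show ?thesis unfolding init prog_main_def
  proof (rule wp_Then, rule wp_cbrt)
    fix \<nu>1 assume 1: "frame {3..9} \<nu>0 \<nu>1" "\<nu>1 3 = 1" "\<nu>1 7 = parts n"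
    let ?rest = "Then (WhileN 21 ?loop) (block [copy 0 20])"
    show "WP (Then prog_lg (Then prog_lengths (Then prog_base (Then prog_widths (Then prog_power ?rest))))) ?Q (\<nu>1, \<phi>0)"
    proof (rule wp_Then, rule wp_lg)
      fix \<nu>2 assume 2: "frame {5, 8, 10} \<nu>1 \<nu>2" "\<nu>2 10 = lg n"
      show "WP (Then prog_lengths (Then prog_base (Then prog_widths (Then prog_power ?rest)))) ?Q (\<nu>2, \<phi>0)"
      proof (rule wp_Then, rule wp_lengths)
        fix \<nu>3 assume 3: "frame {11, 12, 13} \<nu>2 \<nu>3" "\<nu>3 12 = curve_len n K" "\<nu>3 13 = n + parts n + 2"
        show "WP (Then prog_base (Then prog_widths (Then prog_power ?rest))) ?Q (\<nu>3, \<phi>0)"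
        proof (rule wp_Then, rule wp_base)
          fix \<nu>4 assume 4: "frame {9, 14} \<nu>3 \<nu>4" "\<nu>4 14 = base n"
          show "WP (Then prog_widths (Then prog_power ?rest)) ?Q (\<nu>4, \<phi>0)"
          proof (rule wp_Then, rule wp_widths)
            fix \<nu>5 assume 5: "frame {9, 15, 16, 17, 18, 19, 20, 21} \<nu>4 \<nu>5" "params \<nu>5"
              "\<nu>5 20 = 1" "\<nu>5 21 = width n K"
            show "WP (Then prog_power ?rest) ?Q (\<nu>5, \<phi>0)"
            proof (rule wp_Then, rule wp_power[OF 5(2-4)])
              fix \<nu>6 assume 6: "frame {9, 20, 21, 22, 23, 24} \<nu>5 \<nu>6" "\<nu>6 20 = ?X" "\<nu>6 21 = ?X"
                "\<nu>6 23 = 0" "\<nu>6 24 = 0"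
              have "params \<nu>6" using 5(2) 6(1) by (simp add: params_def frame_def)
              moreover have "\<nu>6 (100 + k) = 0" for k
                using 1(1) 2(1) 3(1) 4(1) 5(1) 6(1) by (simp add: frame_def \<nu>0_def)
              ultimately show "WP ?rest ?Q (\<nu>6, \<phi>0)"
                by (intro wp_Then main 6)
            qed
          qed (use 1 2 3 4 in \<open>auto simp: frame_def \<nu>0_def\<close>)
        qed (use 1 2 3 in \<open>auto simp: frame_def \<nu>0_def\<close>)
      qed (use 1 2 in \<open>auto simp: frame_def \<nu>0_def\<close>)
    qed (use 1 in \<open>auto simp: frame_def \<nu>0_def\<close>)
  qed (auto simp: \<nu>0_def)
qed

end

theorem constructs_main:
  "\<exists>t \<le> run_time (round_bound n K) prog_main. constructs R e prog_main n K
    ((\<lambda>i. map (coord R e n K (digit (base n) (width n K) i)) [0..<n]) ` {..<base n ^ width n K}) t"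
  using wp_main[of n K "round_bound n K" R e] unfolding wp_def constructs_def by blast

section \<open>The points produced by the program\<close>

lemma digits_surj:
  "(\<And>k. k < M \<Longrightarrow> d k < N) \<Longrightarrow> \<exists>i<N ^ M. \<forall>k<M. digit N M i k = d k"
proof (induction M arbitrary: d)
  case (Suc M)
  obtain i where i: "i < N ^ M" "\<forall>k<M. digit N M i k = d (Suc k)"
    using Suc.IH[of "\<lambda>k. d (Suc k)"] Suc.prems by auto
  have d0: "d 0 < N" using Suc.prems by simp
  define j where "j = d 0 + N * i"
  have "digit N (Suc M) j k = d k" if "k < Suc M" for k
  proof (cases k)
    case 0
    then show ?thesis using d0 by (simp add: digit_def j_def)
  next
    case (Suc k')
    have "j div N = i" using d0 by (simp add: j_def)
    then have "j div N ^ Suc k' = i div N ^ k'" by (simp only: power_Suc div_mult2_eq)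
    then show ?thesis using i(2) that Suc by (auto simp: digit_def)
  qed
  moreover have "j < N ^ Suc M"
  proof -
    have "j < N + N * i" using d0 by (simp add: j_def)
    also have "\<dots> = N * Suc i" by simp
    also have "\<dots> \<le> N * N ^ M" using i(1) by (intro mult_le_mono2) simp
    finally show ?thesis by simp
  qed
  ultimately show ?case by blast
qed simp

lemma hash_acc_eq: "hash_acc d j p i = (\<Sum>k<i. d (Suc k) * j ^ (i - Suc k)) mod p"
proof (induction i)
  case (Suc i)
  have sum: "(\<Sum>k<Suc i. d (Suc k) * j ^ (Suc i - Suc k)) = (\<Sum>k<i. d (Suc k) * j ^ (i - Suc k)) * j + d (Suc i)"
  proof -
    have "d (Suc k) * j ^ (Suc i - Suc k) = d (Suc k) * j ^ (i - Suc k) * j" if "k < i" for k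
      using that by (simp add: power_Suc2[symmetric] Suc_diff_Suc del: power_Suc2)
    then have "(\<Sum>k<i. d (Suc k) * j ^ (Suc i - Suc k)) = (\<Sum>k<i. d (Suc k) * j ^ (i - Suc k)) * j"
      unfolding sum_distrib_right by (intro sum.cong) (simp_all only: lessThan_iff)
    then show ?thesis by simp
  qed
  let ?S = "\<Sum>k<i. d (Suc k) * j ^ (i - Suc k)"
  have "hash_acc d j p (Suc i) = (?S mod p * j mod p + d (Suc i)) mod p"
    by (simp only: hash_acc.simps Suc mod_add_left_eq)
  also have "\<dots> = (?S * j + d (Suc i)) mod p"
    by (simp only: mod_mult_left_eq mod_add_left_eq)
  finally show ?case by (simp only: sum)
qed simp

lemma curve_Suc: "curve (Suc i) c z = curve i c z * z + c i"
proof -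
  have "c k * z ^ (Suc i - Suc k) = c k * z ^ (i - Suc k) * z" if "k < i" for k
  proof -
    have "Suc i - Suc k = Suc (i - Suc k)" using that by simp
    then show ?thesis by (simp add: mult_ac)
  qed
  then show ?thesis by (simp add: curve_def sum_distrib_right)
qed

text \<open>Every occurrence of \<open>j\<close> among the positions adds 1, so a shift by 1 needs
  positions without repetition.\<close>

lemma pos_acc_eq:
  assumes "\<And>k k'. k < q \<Longrightarrow> k' < q \<Longrightarrow> d (a + k) = j \<Longrightarrow> d (a + k') = j \<Longrightarrow> k = k'"
  shows "pos_acc R d j a v q = (if \<exists>k<q. d (a + k) = j then v \<oplus>\<^bsub>R\<^esub> \<one>\<^bsub>R\<^esub> else v)"
  using assms
proof (induction q)
  case (Suc q)
  have IH: "pos_acc R d j a v q = (if \<exists>k<q. d (a + k) = j then v \<oplus>\<^bsub>R\<^esub> \<one>\<^bsub>R\<^esub> else v)"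
    using Suc.IH Suc.prems less_SucI by blast
  show ?case
  proof (cases "d (a + q) = j")
    case True
    have "\<not> (\<exists>k<q. d (a + k) = j)"
    proof
      assume "\<exists>k<q. d (a + k) = j"
      then obtain k where "k < q" "d (a + k) = j" by blast
      then show False using Suc.prems[of q k] True by simp
    qed
    then show ?thesis using True IH by auto
  next
    case False
    then show ?thesis using IH by (auto simp: less_Suc_eq)
  qed
qed simp

lemma cbrt_le: "cbrt n \<le> n"
  unfolding cbrt_def by (rule Least_le) (simp add: power3_eq_cube)

lemma cbrt_pos: "0 < n \<Longrightarrow> 0 < cbrt n"
  using cbrt(1)[of n] by (cases "cbrt n") auto

lemma lg_le: "lg n \<le> parts n"
  unfolding lg_def by (rule Least_le) (rule less_exp)

lemma lg_pos: "0 < n \<Longrightarrow> 0 < lg n"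
  using lg(1)[of n] cbrt_pos[of n] by (cases "lg n") (auto simp: parts_def)

lemma curve_len_pos: "0 < n \<Longrightarrow> 0 < curve_len n K"
  using lg_pos[of n] by (simp add: curve_len_def)

lemma le_base: "n + parts n + 2 \<le> base n"
proof -
  have "n + parts n + 2 \<le> (n + parts n + 2)\<^sup>2" by (simp add: power2_eq_square)
  then show ?thesis by (simp add: base_def)
qed

definition points :: "('a, 'b) ring_scheme \<Rightarrow> (nat \<Rightarrow> 'a) \<Rightarrow> nat \<Rightarrow> nat \<Rightarrow> 'a list set" where
  "points R e n K =
     (\<lambda>i. map (coord R e n K (digit (base n) (width n K) i)) [0..<n]) ` {..<base n ^ width n K}"

section \<open>The points form a hitting set\<close>

context projected_field
begin

lemma curve_acc_eq:
  assumes "\<And>i. e i \<in> carrier R"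
  shows "curve_acc R e d j a i = proj R (curve i (\<lambda>k. inject R (e (d (a + k)))) (inject R (e j)))"
proof (induction i)
  case 0
  then show ?case by (simp add: curve_def proj_ops field_R)
next
  case (Suc i)
  then show ?case using assms by (simp add: curve_Suc proj_ops field_R inject_parts)
qed

lemma points_carrier:
  assumes "\<And>i. e i \<in> carrier R"
  shows "points R e n K \<subseteq> {x. length x = n \<and> set x \<subseteq> carrier R}"
proof -
  have "pos_acc R d j a v q \<in> carrier R" if "v \<in> carrier R" for d j a v q
    using that by (induction q) auto
  then have "coord R e n K d j \<in> carrier R" for d j
    using assms proj_closed[OF field_R] by (simp add: coord_def curve_acc_eq)
  then show ?thesis by (auto simp: points_def)
qed

lemma finite_points: "finite (points R e n K)"
  by (simp add: points_def)

lemma card_points_le: "card (points R e n K) \<le> base n ^ width n K"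
  unfolding points_def using card_image_le[of "{..<base n ^ width n K}"] by simp

lemma grid_point:
  assumes "\<And>k. k < width n K - 1 \<Longrightarrow> d k < base n"
  shows "map (\<lambda>j. e (if j < width n K - 1 then d j else 0)) [0..<n] \<in> points R e n K"
proof -
  define d' where "d' k = (if k = 0 then 0 else d (k - 1))" for k
  have "0 < base n" by (simp add: base_def)
  then have "d' k < base n" if "k < width n K" for k
    using assms[of "k - 1"] that by (simp add: d'_def)
  then obtain i where i: "i < base n ^ width n K" "\<forall>k<width n K. digit (base n) (width n K) i k = d' k"
    using digits_surj by blast
  have w: "0 < width n K" by (simp add: width_def full_width_def pos_start_def)
  have "coord R e n K (digit (base n) (width n K) i) j = e (if j < width n K - 1 then d j else 0)" for j
  proof -
    have "digit (base n) (width n K) i 0 = 0" using i(2) w by (simp add: d'_def)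
    moreover have "digit (base n) (width n K) i (Suc j) = (if j < width n K - 1 then d j else 0)"
      using i(2) by (auto simp: d'_def digit_def)
    ultimately show ?thesis by (simp add: coord_def)
  qed
  then show ?thesis unfolding points_def using i(1) by (intro image_eqI[of _ _ i]) auto
qed

text \<open>Different digit strings may give the same point, while the running time must be bounded
  by the number of points. The strings with first digit 0 settle this: they are a fraction
  \<open>1 / base n\<close> of all strings and give distinct points.\<close>

lemma card_points_ge:
  assumes inj: "inj_on e {..<base n}"
  shows "base n ^ (width n K - 1) \<le> card (points R e n K)"
proof -
  let ?M = "width n K - 1"
  let ?D = "{..<?M} \<rightarrow>\<^sub>E {..<base n}"
  let ?f = "\<lambda>d. map (\<lambda>j. e (if j < ?M then d j else 0)) [0..<n]"
  have "?M \<le> n" by (simp add: width_def)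
  have "inj_on ?f ?D"
  proof (rule inj_onI)
    fix d d' assume d: "d \<in> ?D" "d' \<in> ?D" "?f d = ?f d'"
    have "d j = d' j" if "j < ?M" for j
    proof -
      have "?f d ! j = ?f d' ! j" by (simp only: d(3))
      then have "e (d j) = e (d' j)" using that \<open>?M \<le> n\<close> by simp
      moreover have "d j < base n" "d' j < base n" using d(1,2) that by auto
      ultimately show ?thesis using inj by (auto dest: inj_onD)
    qed
    then show "d = d'" using d(1,2) by (intro PiE_ext[of d _ "\<lambda>_. {..<base n}" d']) auto
  qed
  moreover have "?f ` ?D \<subseteq> points R e n K"
  proof
    fix x assume "x \<in> ?f ` ?D"
    then obtain d where d: "d \<in> ?D" "x = ?f d" by blast
    then have "d k < base n" if "k < ?M" for k using that by auto
    then show "x \<in> points R e n K" unfolding d(2) by (rule grid_point)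
  qed
  ultimately have "card ?D \<le> card (points R e n K)" using finite_points by (rule card_inj_on_le)
  then show ?thesis by (simp add: card_PiE)
qed

lemma separated_inject:
  assumes "\<And>i. e i \<in> carrier R" "inj_on e {..<N}"
  shows "finite ((\<lambda>i. inject R (e i)) ` {..<N})" "card ((\<lambda>i. inject R (e i)) ` {..<N}) = N"
    "prime_compl.separated nz ((\<lambda>i. inject R (e i)) ` {..<N})"
proof -
  interpret maximal_compl nz by (rule maximal_compl_nz)
  have p: "proj R (inject R (e i)) = e i" for i using assms(1) by (simp add: inject_parts)
  have "inj_on (\<lambda>i. inject R (e i)) {..<N}"
  proof (rule inj_onI)
    fix x y assume "x \<in> {..<N}" "y \<in> {..<N}" "inject R (e x) = inject R (e y)"
    then show "x = y" using p assms(2) by (metis inj_onD)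
  qed
  then show "card ((\<lambda>i. inject R (e i)) ` {..<N}) = N" by (simp add: card_image)
  show "separated ((\<lambda>i. inject R (e i)) ` {..<N})"
    unfolding separated_def nz_diff_iff by (auto simp: p)
qed simp

theorem hitting_set_points:
  assumes C: "C \<subseteq> carrier R" and e: "\<And>i. e i \<in> carrier R"
    and inj: "inj_on e {..<base n + curve_len n K * (n ^ curve_len n K + 2 * n) + 1}"
    and s: "s \<le> 2 ^ K"
  shows "hitting_set n (multilinear_spsp_class C n s) (points R e n K)"
  unfolding hitting_set_def
proof (intro conjI ballI impI)
  show "points R e n K \<subseteq> {x. length x = n \<and> set x \<subseteq> carrier R}" using e by (rule points_carrier)
  fix P assume P: "P \<in> multilinear_spsp_class C n s" "P \<noteq> indexed_const \<zero>"
  interpret maximal_compl nz by (rule maximal_compl_nz)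
  obtain f where f: "P = spsp_poly f" "wf_spsp C n f" "multilinear_spsp f" "real (spsp_size f) \<le> s"
    using P(1) by (auto simp: multilinear_spsp_class_def)
  have "real (spsp_size f) \<le> 2 ^ K" using f(4) s by linarith
  then have size: "spsp_size f \<le> 2 ^ K" by (metis of_nat_le_iff of_nat_numeral of_nat_power)
  obtain g where g: "form_vars g \<subseteq> {..<n}" "\<forall>G\<in>set g. disjoint_gate G" "length g \<le> length f"
    "(\<Sum>G\<leftarrow>g. \<Sum>Q\<leftarrow>G. length Q) \<le> (\<Sum>T\<leftarrow>f. \<Sum>Q\<leftarrow>T. length Q)" "\<exists>x. nz (form_eval g x)"
    "\<forall>x y. (\<forall>i<n. proj R (y i) = x ! i) \<longrightarrow> mpol_eval (spsp_poly f) x = proj R (form_eval g y)"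
    using formula_lists[OF C f(2,3)] P(2) f(1) by blast
  have injN: "inj_on e {..<base n}" using inj by (rule inj_on_subset) auto
  define E where "E i = inject R (e i)" for i
  have pE: "proj R (E i) = e i" for i using e by (simp add: E_def inject_parts)
  define S0 where "S0 = E ` {..<base n}"
  have S0: "finite S0" "separated S0" "card S0 = base n"
    using separated_inject[OF e injN] by (auto simp: S0_def E_def)
  have nN: "n < base n" using le_base[of n] by simp
  have hit: "\<exists>x\<in>points R e n K. mpol_eval P x \<noteq> \<zero>"
    if "x \<in> points R e n K" "length x = n" "\<And>j. j < n \<Longrightarrow> proj R (y j) = x ! j" "nz (form_eval g y)" for x y
  proof -
    have "mpol_eval P x = proj R (form_eval g y)" using g(6) that(3) f(1) by blast
    then show ?thesis using that(4) by (intro bexI[OF _ that(1)]) (simp add: nz_def)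
  qed
  show "\<exists>x\<in>points R e n K. mpol_eval P x \<noteq> \<zero>"
  proof (cases "n + 1 \<le> full_width n K")
    case True
    then have w: "width n K - 1 = n" by (simp add: width_def)
    obtain z where z: "nz (form_eval g z)" using g(5) by blast
    have cv: "curve (Suc 0) c x = c 0" for c :: "nat \<Rightarrow> 'a prod_ring" and x by (simp add: curve_def)
    \<comment> \<open>With one coefficient per curve and every variable a part of its own, the
      curves are arbitrary points, and moving the coefficients into \<open>S0\<close> leads to a
      nonzero value on the full grid.\<close>
    have "\<exists>D. (\<forall>(b, i)\<in>{..<n} \<times> {..<1::nat}. D b i \<in> S0) \<and>
        nz (form_eval g (shift (\<lambda>j. curve 1 (D j) (E j)) {}))"
      using reduce_coefficients[where P = "{..<n} \<times> {..<1}" and L = 1 and e = E and h = id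
          and B = "{}" and C = "\<lambda>j _. z j", OF g(1,2) S0(1,2)] nN S0(3) z by (simp add: cv)
    then obtain D where D: "\<forall>b<n. D b 0 \<in> S0" "nz (form_eval g (\<lambda>j. D j (0::nat)))"
      by (force simp: cv lessThan_Suc)
    have "\<forall>b<n. \<exists>c<base n. D b 0 = E c" using D(1) by (auto simp: S0_def)
    then obtain d where d: "\<And>b. b < n \<Longrightarrow> d b < base n \<and> D b 0 = E (d b)" by metis
    have "map (\<lambda>j. e (if j < n then d j else 0)) [0..<n] \<in> points R e n K"
      using grid_point[of n K d e] d unfolding w by blast
    then show ?thesis by (rule hit) (use d D(2) pE in auto)
  next
    case False
    then have w: "width n K = full_width n K" and n: "0 < n"
      by (auto simp: width_def full_width_def pos_start_def)
    define u where "u = cbrt n"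
    define m where "m = parts n"
    define t where "t = K + lg n"
    define L where "L = curve_len n K"
    have mu: "m = 3 * u\<^sup>2" by (simp add: m_def parts_def u_def)
    have L: "L = 5 * t" by (simp add: L_def curve_len_def t_def)
    have Lpos: "0 < L" using curve_len_pos[OF n] by (simp add: L_def)
    have m: "0 < m" using cbrt_pos[OF n] by (simp add: mu u_def)
    obtain p where p: "Factorial_Ring.prime p" "n + m + 2 < p" "p \<le> base n"
      using prime_between[of "n + m + 2"] n m unfolding base_def m_def by (auto simp: Suc_le_eq)
    define S where "S = E ` {..<L * (n ^ L + 2 * n) + 1}"
    have "inj_on e {..<L * (n ^ L + 2 * n) + 1}" using inj by (rule inj_on_subset) (auto simp: L_def)
    from separated_inject[OF e this] have S: "finite S" "separated S" "L * (n ^ L + 2 * n) < card S"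
      by (simp_all add: S_def E_def)
    have sep: "nz (E i - E j)" if "i < n" "j < n" "i \<noteq> j" for i j
      using that nN inj_onD[OF injN, of i j] by (auto simp: nz_diff_iff pE)
    have "\<exists>a \<in> {..<2 * t} \<rightarrow>\<^sub>E {..<p}. \<exists>C B. (\<forall>b<3 * u\<^sup>2. \<forall>i<L. C b i \<in> S0) \<and> B \<subseteq> {..<n} \<and>
      card B \<le> 2 * (3 * u\<^sup>2 * L) \<and>
      nz (form_eval g (shift (\<lambda>j. curve L (C (hash p (3 * u\<^sup>2) (2 * t) a j)) (E j)) B))"
    proof (rule hitting_point[where K = K])
      show "n \<le> u ^ 3" "u \<le> n" using cbrt(1) cbrt_le by (simp_all add: u_def)
      show "length g \<le> 2 ^ K" using g(3) size_bounds(1)[of f] size by linarith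
      show "(\<Sum>G\<leftarrow>g. \<Sum>Q\<leftarrow>G. length Q) < 2 ^ K" using g(4) size_bounds(2)[of f] size by linarith
      have "m < 2 ^ lg n" using lg(1) by (simp add: m_def)
      then show "2 ^ K * (3 * u\<^sup>2) < 2 ^ t" by (simp add: t_def power_add mu)
      show "K + 3 * t < L" using lg_pos[OF n] by (simp add: L t_def)
      show "3 * u\<^sup>2 \<le> p" "n \<le> p" using p(2) mu by simp_all
      show "n < card S0" using nN S0(3) by simp
    qed (use n g p(1) S S0 sep in auto)
    then obtain a D B where a: "a \<in> {..<2 * t} \<rightarrow>\<^sub>E {..<p}" and D: "\<forall>b<m. \<forall>i<L. D b i \<in> S0"
      and B: "B \<subseteq> {..<n}" "card B \<le> 2 * (m * L)"
      and nzg: "nz (form_eval g (shift (\<lambda>j. curve L (D (hash p m (2 * t) a j)) (E j)) B))"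
      unfolding mu by blast
    have "\<forall>b i. \<exists>c<base n. b < m \<longrightarrow> i < L \<longrightarrow> D b i = E c"
    proof (intro allI)
      fix b i
      show "\<exists>c<base n. b < m \<longrightarrow> i < L \<longrightarrow> D b i = E c"
      proof (cases "b < m \<and> i < L")
        case True
        then have "D b i \<in> S0" using D by blast
        then show ?thesis by (auto simp: S0_def)
      qed (use nN in auto)
    qed
    then obtain c where c: "\<And>b i. c b i < base n" "\<And>b i. b < m \<Longrightarrow> i < L \<Longrightarrow> D b i = E (c b i)" by metis
    define bl where "bl = sorted_list_of_set B"
    have finB: "finite B" using B(1) finite_subset by blast
    have bl: "set bl = B" "distinct bl" "length bl = card B"
      using finB by (simp_all add: bl_def)
    define ps where "ps = pos_start n K"
    have ps: "ps = 1 + L + m * L" by (simp add: ps_def pos_start_def L_def m_def)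
    have wid: "width n K = ps + 2 * (m * L)" by (simp add: w full_width_def ps_def m_def L_def)
    define d where "d k = (if k = 0 then p - 1
        else if k < 1 + L then (if L - k < 2 * t then a (L - k) else 0)
        else if k < ps then c ((k - (1 + L)) div L) ((k - (1 + L)) mod L)
        else if k - ps < length bl then bl ! (k - ps) else n)" for k
    have "d k < base n" for k
    proof -
      have "a i < base n" if "i < 2 * t" for i 
      proof -
        have "a i < p" using a that by (auto dest: PiE_mem)
        then show ?thesis using p(3) by linarith
      qed
      moreover have "bl ! i < base n" if "i < length bl" for i
      proof -
        have "bl ! i < n" using bl(1) B(1) nth_mem[OF that] by auto
        then show ?thesis using nN by linarith
      qed
      ultimately show ?thesis using p(2,3) c(1) nN by (auto simp: d_def)
    qed
    then obtain i where i: "i < base n ^ width n K" "\<forall>k<width n K. digit (base n) (width n K) i k = d k"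
      using digits_surj[of "width n K" d "base n"] by blast
    define d' where "d' = digit (base n) (width n K) i"
    have d': "d' k = d k" if "k < ps + 2 * (m * L)" for k using i(2) that by (simp add: d'_def wid)
    define h where "h = hash p m (2 * t) a"
    have hm: "h j < m" for j using m by (simp add: h_def hash_def)
    have d0: "d' 0 + 1 = p" "d' 0 \<noteq> 0"
      using d'[of 0] ps p(2) by (auto simp: d_def)
    have part: "part_of n K d' j = h j" for j
    proof -
      have "(\<Sum>k<L. d' (Suc k) * j ^ (L - Suc k)) = (\<Sum>k<L. (if L - Suc k < 2 * t then a (L - Suc k) else 0) * j ^ (L - Suc k))"
        using d' ps by (intro sum.cong) (auto simp: d_def)
      also have "\<dots> = (\<Sum>k<L. (if k < 2 * t then a k else 0) * j ^ k)"
        by (rule sum.nat_diff_reindex)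
      also have "\<dots> = (\<Sum>k<2 * t. (if k < 2 * t then a k else 0) * j ^ k)"
        using L by (intro sum.mono_neutral_right) auto
      also have "\<dots> = (\<Sum>k<2 * t. a k * j ^ k)" by (intro sum.cong) auto
      finally show ?thesis
        unfolding part_of_def hash_acc_eq L_def[symmetric] m_def[symmetric] d0(1) h_def hash_def by simp
    qed
    have curve_eq: "curve_acc R e d' j (1 + L + h j * L) L = proj R (curve L (D (h j)) (E j))" for j
    proof -
      have "inject R (e (d' (1 + L + h j * L + k))) = D (h j) k" if k: "k < L" for k
      proof -
        have "Suc (h j) * L \<le> m * L" using hm[of j] by (intro mult_le_mono1) simp
        then have lt: "h j * L + k < m * L" using k by simp
        then have "d' (1 + L + h j * L + k) = d (1 + L + h j * L + k)" 
          by (intro d') (use lt in \<open>simp add: ps mult.commute[of L m]\<close>)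
        also have "\<dots> = c ((h j * L + k) div L) ((h j * L + k) mod L)" using lt by (simp add: d_def ps)
        also have "\<dots> = c (h j) k" using k by simp
        finally show ?thesis using c(2)[OF hm k] by (simp add: E_def)
      qed
      then have "curve L (\<lambda>k. inject R (e (d' (1 + L + h j * L + k)))) (E j) = curve L (D (h j)) (E j)"
        by (intro curve_cong)
      then show ?thesis unfolding curve_acc_eq[of e, OF e] by (simp add: E_def)
    qed
    define y where "y = shift (\<lambda>j. curve L (D (h j)) (E j)) B"
    have co: "coord R e n K d' j = proj R (y j)" if j: "j < n" for j
    proof -
      have dk: "d' (ps + k) = (if k < length bl then bl ! k else n)" if "k < 2 * (m * L)" for k
      proof -
        have "d' (ps + k) = d (ps + k)" using that by (intro d') linarith
        moreover have "1 + L \<le> ps" using ps by simp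
        ultimately show ?thesis by (simp add: d_def)
      qed
      have ex: "(\<exists>k<2 * (m * L). d' (ps + k) = j) \<longleftrightarrow> j \<in> B"
      proof
        assume "\<exists>k<2 * (m * L). d' (ps + k) = j"
        then show "j \<in> B" using dk j bl(1) by (auto split: if_splits)
      next
        assume "j \<in> B"
        then obtain k where k: "k < length bl" "bl ! k = j" using bl(1) by (metis in_set_conv_nth)
        then have "k < 2 * (m * L)" using bl(3) B(2) by simp
        then show "\<exists>k<2 * (m * L). d' (ps + k) = j" using dk[of k] k by auto
      qed
      have "pos_acc R d' j ps v (2 * (m * L)) = (if j \<in> B then v \<oplus> \<one> else v)" for v
        unfolding ex[symmetric]
      proof (rule pos_acc_eq)
        fix k k' assume k: "k < 2 * (m * L)" "k' < 2 * (m * L)" "d' (ps + k) = j" "d' (ps + k') = j"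
        then have "k < length bl" "k' < length bl" "bl ! k = bl ! k'"
          using dk[OF k(1)] dk[OF k(2)] j by (auto split: if_splits)
        then show "k = k'" using bl(2) nth_eq_iff_index_eq by blast
      qed
      moreover have "width n K - pos_start n K = 2 * (m * L)" using wid by (simp add: ps_def)
      ultimately have "coord R e n K d' j = (if j \<in> B then proj R (curve L (D (h j)) (E j)) \<oplus> \<one> else proj R (curve L (D (h j)) (E j)))"
        unfolding coord_def using d0(2) part curve_eq by (simp add: ps_def L_def[symmetric])
      then show ?thesis using proj_closed[OF field_R] by (simp add: y_def proj_ops field_R)
    qed
    have "map (coord R e n K d') [0..<n] \<in> points R e n K"
      unfolding points_def d'_def using i(1) by blast
    then show ?thesis
      by (rule hit[of _ y]) (use co nzg in \<open>simp_all add: y_def h_def\<close>)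
  qed
qed

end

section \<open>Size and time bounds\<close>

text \<open>The number of distinct field elements the argument draws on: \<open>base n\<close> for
  the digits, the rest for the existence of the curves in \<open>part_shift\<close>.\<close>

definition num_elems :: "nat \<Rightarrow> nat \<Rightarrow> nat" where
  "num_elems n K = base n + curve_len n K * (n ^ curve_len n K + 2 * n) + 1"

lemma num_elems_pos: "0 < num_elems n K"
  by (simp add: num_elems_def)

lemma width_pos: "0 < width n K"
  by (simp add: width_def full_width_def pos_start_def)

lemma round_bound_le:
  assumes "K \<le> base n ^ D"
  shows "Suc (round_bound n K) \<le> 60 * (base n ^ width n K) ^ (D + 2)"
proof -
  define N where "N = base n"
  define Y where "Y = N ^ (D + 2)"
  have N: "1 \<le> N" "n + parts n + 2 \<le> N" using le_base[of n] by (simp_all add: N_def)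
  have le: "N ^ i \<le> Y" if "i \<le> D + 2" for i
    unfolding Y_def using that N(1) by (intro power_increasing) auto
  have "N \<le> Y" "N * N \<le> Y" "N ^ D \<le> Y" using le[of 1] le[of 2] le[of D] by (simp_all add: power2_eq_square)
  have c2: "(cbrt n)\<^sup>2 \<le> parts n" by (simp add: parts_def)
  have L: "curve_len n K \<le> 10 * N ^ (D + 1)"
  proof -
    have "N ^ D \<le> N ^ (D + 1)" "N ^ 1 \<le> N ^ (D + 1)" using N(1) by (intro power_increasing; simp)+
    then have "K + lg n \<le> N ^ (D + 1) + N ^ (D + 1)"
      using assms lg_le[of n] N unfolding N_def[symmetric] power_one_right
      by (intro add_mono; linarith)
    then show ?thesis by (simp add: curve_len_def)
  qed
  have "parts n * curve_len n K \<le> N * (10 * N ^ (D + 1))" using L N by (intro mult_le_mono) auto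
  then have PL: "parts n * curve_len n K \<le> 10 * Y" by (simp add: Y_def)
  have LY: "curve_len n K \<le> 10 * Y" using L le[of "D + 1"] by simp
  have W: "full_width n K \<le> 41 * Y"
    using PL LY \<open>N \<le> Y\<close> N(1) unfolding full_width_def pos_start_def by linarith
  have X: "N ^ 1 \<le> N ^ width n K" using width_pos[of n K] N(1) by (intro power_increasing) auto
  then have YX: "Y \<le> (N ^ width n K) ^ (D + 2)" unfolding Y_def by (intro power_mono) auto
  have X1: "N ^ width n K \<le> (N ^ width n K) ^ (D + 2)"
    using X N(1) by (intro self_le_power) auto
  have "Suc (round_bound n K) \<le> 59 * Y + N ^ width n K"
    using c2 cbrt_le[of n] lg_le[of n] N LY W \<open>N \<le> Y\<close> \<open>N * N \<le> Y\<close> \<open>N ^ D \<le> Y\<close> assms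
    unfolding round_bound_def N_def[symmetric] by linarith
  then show ?thesis using YX X1 unfolding N_def by linarith
qed

text \<open>Squaring makes up for the digit missing in the lower bound once the width is at least 2.
  For \<open>n = 0\<close> the width is 1, and the factor 16 is \<open>base 0\<close>.\<close>

lemma points_le_square:
  assumes "base n ^ (width n K - 1) \<le> c"
  shows "base n ^ width n K \<le> 16 * c ^ 2"
proof (cases "n = 0")
  case True
  have "cbrt 0 = 0" using cbrt_le[of 0] by simp
  then have "parts 0 = 0" by (simp add: parts_def)
  then have "base n ^ width n K = 16" using True by (simp add: base_def width_def full_width_def pos_start_def power2_eq_square)
  moreover have "1 \<le> c" using assms base_pos[of n] by (metis One_nat_def Suc_leI le_trans zero_less_power)
  ultimately show ?thesis by simp
next
  case False
  then have "1 \<le> width n K - 1"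
    using curve_len_pos[of n K] by (auto simp: width_def full_width_def pos_start_def)
  then have "base n ^ width n K \<le> base n ^ ((width n K - 1) + (width n K - 1))"
    using base_pos[of n] by (intro power_increasing) auto
  also have "\<dots> \<le> c * c" unfolding power_add using assms by (intro mult_le_mono)
  also have "\<dots> \<le> 16 * c ^ 2" by (simp add: power2_eq_square)
  finally show ?thesis .
qed

text \<open>The input \<open>K\<close> itself is among the loop bounds, hence the assumption that it
  is polynomial in the base; \<open>c\<close> stands for the number of points.\<close>

lemma time_polynomial:
  "\<exists>a b. \<forall>n K c. K \<le> base n ^ D \<longrightarrow> base n ^ (width n K - 1) \<le> c \<longrightarrow>
     run_time (round_bound n K) p \<le> a * c ^ b"
proof -
  obtain a b where ab: "\<And>B. run_time B p \<le> a * Suc B ^ b" using run_time_polynomial by blast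
  have "run_time (round_bound n K) p \<le> a * (60 * 16 ^ (D + 2)) ^ b * c ^ (2 * (D + 2) * b)"
    if K: "K \<le> base n ^ D" and c: "base n ^ (width n K - 1) \<le> c" for n K c
  proof -
    have "Suc (round_bound n K) \<le> 60 * (base n ^ width n K) ^ (D + 2)" using K by (rule round_bound_le)
    also have "\<dots> \<le> 60 * (16 * c ^ 2) ^ (D + 2)"
      using points_le_square[OF c] by (intro mult_le_mono2 power_mono) auto
    finally have "a * Suc (round_bound n K) ^ b \<le> a * (60 * (16 * c ^ 2) ^ (D + 2)) ^ b"
      by (intro mult_le_mono2 power_mono) auto
    also have "\<dots> = a * (60 * 16 ^ (D + 2)) ^ b * c ^ (2 * (D + 2) * b)"
      by (simp only: power_mult_distrib power_mult mult.assoc)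
    finally show ?thesis using ab order_trans by blast
  qed
  then show ?thesis by blast
qed

section \<open>Asymptotic estimates, with \<open>ln n\<close> at least 1\<close>

context
  fixes n :: nat
  assumes n: "3 \<le> n"
begin

lemma ln_ge_1: "1 \<le> ln (real n)"
proof -
  have "exp 1 \<le> real n" using exp_le n by linarith
  then show ?thesis using n by (simp add: ln_ge_iff)
qed

lemma log2_le: "log 2 (real n) \<le> 2 * ln (real n)"
proof -
  have "1 \<le> ln (4::real)" using exp_le by (simp add: ln_ge_iff)
  also have "ln (4::real) = 2 * ln 2" using ln_realpow[of "2::real" 2] by simp
  finally have "1 \<le> 2 * ln (2::real)" .
  then have "ln (real n) * 1 \<le> ln (real n) * (2 * ln 2)" using ln_ge_1 by (intro mult_left_mono) auto
  then show ?thesis by (simp add: log_def divide_le_eq mult_ac)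
qed

lemma log2_power_le: "0 < m \<Longrightarrow> m \<le> n ^ k \<Longrightarrow> log 2 (real m) \<le> 2 * real k * ln (real n)"
proof -
  assume m: "0 < m" "m \<le> n ^ k"
  have "real m \<le> real n ^ k" using m(2) by (metis of_nat_le_iff of_nat_power)
  then have "log 2 (real m) \<le> log 2 (real n ^ k)" using m(1) n by simp
  also have "\<dots> = real k * log 2 (real n)" using n by (simp add: log_nat_power)
  also have "\<dots> \<le> real k * (2 * ln (real n))" using log2_le by (intro mult_left_mono) auto
  finally show ?thesis by (simp add: mult_ac)
qed

lemma parts_le_cube: "parts n \<le> n ^ 3"
proof -
  have "parts n \<le> 3 * n\<^sup>2" using cbrt_le[of n] by (simp add: parts_def)
  also have "\<dots> \<le> n * n\<^sup>2" using n by (intro mult_le_mono1)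
  finally show ?thesis by (simp add: power3_eq_cube power2_eq_square)
qed

lemma parts_le: "real (parts n) \<le> 12 * real n powr (2/3)"
proof -
  define x where "x = real n powr (1/3)"
  have x: "1 \<le> x" unfolding x_def using n by (intro ge_one_powr_ge_zero) auto
  have x3: "x ^ 3 = real n" using n by (simp add: x_def powr_power)
  have x2: "x\<^sup>2 = real n powr (2/3)" using n by (simp add: x_def powr_power)
  have "real (cbrt n) \<le> x + 1"
  proof -
    have "cbrt n - 1 < cbrt n" using cbrt_pos[of n] n by simp
    then have "(cbrt n - 1) ^ 3 < n" by (rule cbrt(2))
    then have "real (cbrt n - 1) ^ 3 < x ^ 3" unfolding x3 by (metis of_nat_less_iff of_nat_power)
    then have "real (cbrt n - 1) < x" using x by (intro power_less_imp_less_base[of _ 3 x]) auto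
    then show ?thesis using cbrt_pos[of n] n by simp
  qed
  then have "real (cbrt n) \<le> 2 * x" using x by linarith
  then have "(real (cbrt n))\<^sup>2 \<le> (2 * x)\<^sup>2" by (intro power_mono) auto
  then show ?thesis by (simp add: parts_def power_mult_distrib x2)
qed

lemma lg_bound: "real (lg n) \<le> 7 * ln (real n)"
proof -
  have n0: "0 < n" using n by simp
  have "lg n - 1 < lg n" using lg_pos[OF n0] by simp
  then have "2 ^ (lg n - 1) \<le> parts n" by (rule lg(2))
  also have "\<dots> \<le> n ^ 3" by (rule parts_le_cube)
  finally have "log 2 (real (2 ^ (lg n - 1))) \<le> 2 * real 3 * ln (real n)"
    by (intro log2_power_le) auto
  then have "real (lg n - 1) \<le> 6 * ln (real n)" by (simp add: log_nat_power)
  then show ?thesis using ln_ge_1 lg_pos[OF n0] by linarith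
qed

lemma base_le: "base n + 1 \<le> 2 * n ^ 8" "base n \<le> n ^ 8"
proof -
  have "n + 2 \<le> n * n" using n mult_le_mono1[of 3 n n] by linarith
  moreover have "parts n \<le> 3 * n\<^sup>2" using cbrt_le[of n] by (simp add: parts_def)
  ultimately have "n + parts n + 2 \<le> 4 * n\<^sup>2" by (simp add: power2_eq_square)
  then have "(n + parts n + 2)\<^sup>2 \<le> (4 * n\<^sup>2)\<^sup>2" by (intro power_mono) auto
  then have "base n \<le> 64 * n ^ 4" by (simp add: base_def power_mult_distrib flip: power_mult)
  also have "\<dots> \<le> 3 ^ 4 * n ^ 4" by simp
  also have "\<dots> \<le> n ^ 4 * n ^ 4" using n by (intro mult_le_mono1 power_mono) auto
  finally show "base n \<le> n ^ 8" by (simp flip: power_add)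
  moreover have "1 \<le> n ^ 8" using n by simp
  ultimately show "base n + 1 \<le> 2 * n ^ 8" by linarith
qed

context
  fixes \<delta> :: real and K :: nat
  assumes \<delta>: "0 < \<delta>" and K: "real K \<le> real n powr \<delta> + 1"
begin

lemma curve_len_le: "real (curve_len n K) \<le> 45 * (real n powr \<delta> * ln (real n))"
proof -
  have p: "1 \<le> real n powr \<delta>" using n \<delta> by (intro ge_one_powr_ge_zero) auto
  have "real K \<le> real n powr \<delta> + 1" by (rule K)
  also have "\<dots> \<le> 2 * real n powr \<delta>" using p by simp
  also have "\<dots> \<le> 2 * (real n powr \<delta> * ln (real n))"
    using mult_left_mono[OF ln_ge_1, of "real n powr \<delta>"] p by simp
  finally have "real K \<le> 2 * (real n powr \<delta> * ln (real n))" .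
  moreover have "ln (real n) \<le> real n powr \<delta> * ln (real n)"
    using mult_right_mono[OF p, of "ln (real n)"] ln_ge_1 by simp
  ultimately show ?thesis using lg_bound by (simp add: curve_len_def)
qed

lemma full_width_le:
  "real (full_width n K) \<le> 2700 * (real n powr (2/3 + \<delta>) * ln (real n))"
proof -
  let ?L = "curve_len n K"
  have n0: "0 < n" using n by simp
  have "1 \<le> ?L" "1 \<le> parts n"
    using curve_len_pos[OF n0, of K] cbrt_pos[OF n0] by (auto simp: parts_def)
  then have "1 \<le> parts n * ?L" "?L \<le> parts n * ?L" by auto
  then have "full_width n K \<le> 5 * (parts n * ?L)"
    unfolding full_width_def pos_start_def by linarith
  then have "real (full_width n K) \<le> 5 * (real (parts n) * real ?L)"
    by (metis of_nat_le_iff of_nat_mult of_nat_numeral)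
  also have "\<dots> \<le> 5 * ((12 * real n powr (2/3)) * (45 * (real n powr \<delta> * ln (real n))))"
    using parts_le curve_len_le by (intro mult_left_mono mult_mono) auto
  also have "\<dots> = 2700 * (real n powr (2/3 + \<delta>) * ln (real n))" by (simp add: powr_add)
  finally show ?thesis .
qed

lemma log_card_le:
  "real (width n K) * log 2 (real (base n)) \<le> 43200 * (real n powr (2/3 + 4 * \<delta> / 3) * ln (real n) ^ 2)"
proof -
  have "log 2 (real (base n)) \<le> 16 * ln (real n)"
    using log2_power_le[of "base n" 8] base_le(2) base_pos[of n] by simp
  moreover have "real (width n K) \<le> 2700 * (real n powr (2/3 + \<delta>) * ln (real n))"
    using full_width_le by (simp add: width_def)
  ultimately have "real (width n K) * log 2 (real (base n)) \<le>
      (2700 * (real n powr (2/3 + \<delta>) * ln (real n))) * (16 * ln (real n))"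
    using base_pos[of n] ln_ge_1 by (intro mult_mono) auto
  also have "\<dots> = 43200 * (real n powr (2/3 + \<delta>) * ln (real n) ^ 2)" by (simp add: power2_eq_square)
  \<comment> \<open>The construction gives the exponent \<open>2/3 + \<delta>\<close>, which is
    weakened to the one claimed.\<close>
  also have "\<dots> \<le> 43200 * (real n powr (2/3 + 4 * \<delta> / 3) * ln (real n) ^ 2)"
    using n \<delta> by (intro mult_left_mono mult_right_mono powr_mono) auto
  finally show ?thesis .
qed

lemma log_num_elems_le:
  "log 2 (real (num_elems n K)) \<le> 990 * (real n powr (2 * \<delta>) * ln (real n) ^ 2)"
proof -
  define L where "L = curve_len n K"
  have n0: "0 < n" using n by simp
  have L: "1 \<le> L" using curve_len_pos[OF n0, of K] by (simp add: L_def)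
  \<comment> \<open>The estimate below is \<open>n ^ (2 * L + 9)\<close>:
    \<open>base n \<le> n ^ 8\<close> accounts for 8, and one more factor \<open>n\<close> absorbs
    the constant 3. Then \<open>1 \<le> L\<close> is used.\<close>
  have "num_elems n K \<le> n ^ (11 * L)"
  proof -
    have "L \<le> n ^ L"
    proof -
      have "L < 2 ^ L" by (rule less_exp)
      also have "2 ^ L \<le> n ^ L" using n by (intro power_mono) auto
      finally show ?thesis by simp
    qed
    moreover have "n ^ L + 2 * n \<le> 3 * n ^ L" using self_le_power[of n L] n L by simp
    ultimately have "L * (n ^ L + 2 * n) \<le> n ^ L * (3 * n ^ L)" by (rule mult_le_mono)
    also have "\<dots> = 3 * n ^ (2 * L)" by (simp add: mult_2 power_add)
    also have "\<dots> \<le> n * n ^ (2 * L)" using n by (intro mult_le_mono1)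
    also have "\<dots> = n ^ (2 * L + 1)" by simp
    also have "\<dots> \<le> n ^ (2 * L + 8)" using n by (intro power_increasing) auto
    finally have "L * (n ^ L + 2 * n) \<le> n ^ (2 * L + 8)" .
    moreover have "n ^ 8 \<le> n ^ (2 * L + 8)" using n by (intro power_increasing) auto
    ultimately have "num_elems n K \<le> 3 * n ^ (2 * L + 8)"
      using base_le(1) by (simp add: num_elems_def L_def)
    also have "\<dots> \<le> n * n ^ (2 * L + 8)" using n by (intro mult_le_mono1)
    also have "\<dots> = n ^ (2 * L + 9)" by (simp add: add.commute flip: power_Suc)
    also have "\<dots> \<le> n ^ (11 * L)" using n L by (intro power_increasing) auto
    finally show ?thesis .
  qed
  then have "log 2 (real (num_elems n K)) \<le> 2 * real (11 * L) * ln (real n)"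
    by (intro log2_power_le) (simp_all add: num_elems_def)
  also have "\<dots> = 22 * (real L * ln (real n))" by simp
  also have "\<dots> \<le> 22 * ((45 * (real n powr \<delta> * ln (real n))) * ln (real n))"
    using curve_len_le ln_ge_1 by (intro mult_left_mono mult_right_mono) (auto simp: L_def)
  also have "\<dots> = 990 * (real n powr \<delta> * ln (real n) ^ 2)" by (simp add: power2_eq_square)
  also have "\<dots> \<le> 990 * (real n powr (2 * \<delta>) * ln (real n) ^ 2)"
    using n \<delta> by (intro mult_left_mono mult_right_mono powr_mono) auto
  finally show ?thesis .
qed

end

end

lemma soft_O_I:
  assumes "\<And>n. 3 \<le> n \<Longrightarrow> 0 \<le> g n \<and> g n \<le> c * (f n * ln (real n) ^ k)" "\<And>n. 0 \<le> f n"
  shows "g \<in> soft_O f"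
proof -
  have "norm (g n) \<le> c * norm (f n * ln (real n) ^ k)" if "3 \<le> n" for n
    using assms(1)[OF that] assms(2)[of n] ln_ge_1[OF that] by simp
  then have "eventually (\<lambda>n. norm (g n) \<le> c * norm (f n * ln (real n) ^ k)) at_top"
    unfolding eventually_at_top_linorder by blast
  then show ?thesis unfolding soft_O_def using bigoI by blast
qed

theorem theorem1p3:
  fixes \<delta> :: real
  assumes "0 < \<delta>"
  shows "\<exists>h \<in> soft_O (\<lambda>n. real n powr (2/3 + 4 * \<delta> / 3)).
         \<exists>q \<in> soft_O (\<lambda>n. real n powr (2 * \<delta>)).
         \<exists>(p :: prog) (a :: nat) (b :: nat).
           \<forall>(n :: nat) (F :: 'a ring) (K :: 'a set) (e :: nat \<Rightarrow> 'a).
             field F \<longrightarrow> subfield K F \<longrightarrow>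
             infinite (carrier F) \<or> 2 powr q n \<le> real (card (carrier F)) \<longrightarrow>
             field_enum F e \<longrightarrow>
             (\<exists>H t. ring.hitting_set F n (ring.multilinear_spsp_class F K n (2 powr (real n powr \<delta>))) H \<and>
                    finite H \<and> real (card H) \<le> 2 powr h n \<and>
                    constructs F e p n (nat \<lceil>real n powr \<delta>\<rceil>) H t \<and>
                    t \<le> a * card H ^ b)"
proof -
  \<comment> \<open>\<open>2 ^ k n\<close> bounds the size of the formulas, and \<open>k n\<close>
    is the second input of the program. \<open>2 powr h n\<close> counts the digit strings, and
    \<open>2 powr q n\<close> the elements on which the enumeration must be injective.\<close>
  define k where "k n = nat \<lceil>real n powr \<delta>\<rceil>" for n
  define h where "h n = real (width n (k n)) * log 2 (real (base n))" for n
  define q where "q n = log 2 (real (num_elems n (k n)))" for n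
  obtain a b where ab: "\<And>n K c. K \<le> base n ^ nat \<lceil>\<delta>\<rceil> \<Longrightarrow> base n ^ (width n K - 1) \<le> c \<Longrightarrow>
      run_time (round_bound n K) prog_main \<le> a * c ^ b"
    using time_polynomial by blast
  have k: "real (k n) \<le> real n powr \<delta> + 1" for n
  proof -
    have "0 \<le> real n powr \<delta>" by simp
    then have "real (k n) = of_int \<lceil>real n powr \<delta>\<rceil>" unfolding k_def by (intro of_nat_nat) linarith
    then show ?thesis by linarith
  qed
  have "0 \<le> h n" for n
    using base_pos[of n] by (simp add: h_def)
  then have h: "h \<in> soft_O (\<lambda>n. real n powr (2/3 + 4 * \<delta> / 3))"
    using log_card_le[OF _ assms k] by (intro soft_O_I[of h 43200 _ 2]) (auto simp: h_def)
  have "0 \<le> q n" for n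
    using num_elems_pos[of n "k n"] by (simp add: q_def)
  then have q: "q \<in> soft_O (\<lambda>n. real n powr (2 * \<delta>))"
    using log_num_elems_le[OF _ assms k] by (intro soft_O_I[of q 990 _ 2]) (auto simp: q_def)
  have "\<exists>H t. ring.hitting_set F n (ring.multilinear_spsp_class F K n (2 powr (real n powr \<delta>))) H \<and>
      finite H \<and> real (card H) \<le> 2 powr h n \<and> constructs F e prog_main n (k n) H t \<and> t \<le> a * card H ^ b"
    if F: "field F" and K: "subfield K F"
      and big: "infinite (carrier F) \<or> 2 powr q n \<le> real (card (carrier F))" and e: "field_enum F e"
    for n and F :: "'a ring" and K :: "'a set" and e :: "nat \<Rightarrow> 'a"
  proof -
    interpret projected_field F using F by (rule projected_field.intro)
    define H where "H = points F e n (k n)"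
    have K': "K \<subseteq> carrier F" using K subfieldE(3) by blast
    have e': "e i \<in> carrier F" for i using e by (auto simp: field_enum_def)
    have inj: "inj_on e {..<num_elems n (k n)}"
    proof (cases "finite (carrier F)")
      case True
      then have "bij_betw e {..<card (carrier F)} (carrier F)" using e by (simp add: field_enum_def)
      moreover have "real (num_elems n (k n)) \<le> real (card (carrier F))"
        using big True num_elems_pos[of n "k n"] by (simp add: q_def)
      ultimately show ?thesis by (auto simp: bij_betw_def intro: inj_on_subset)
    next
      case False
      then show ?thesis using e by (auto simp: field_enum_def intro: inj_on_subset)
    qed
    have "2 powr (real n powr \<delta>) \<le> 2 powr real (k n)"
      by (intro powr_mono) (simp_all add: k_def)
    also have "\<dots> = 2 ^ k n" by (simp add: powr_realpow)
    finally have "hitting_set n (multilinear_spsp_class K n (2 powr (real n powr \<delta>))) H"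
      unfolding H_def using K' e' inj by (intro hitting_set_points) (simp_all add: num_elems_def)
    moreover have fin: "finite H" unfolding H_def by (rule finite_points)
    moreover have "real (card H) \<le> 2 powr h n"
    proof -
      have "real (card H) \<le> real (base n) ^ width n (k n)"
        using card_points_le[of e n "k n"] unfolding H_def by (metis of_nat_le_iff of_nat_power)
      also have "\<dots> = (2 powr log 2 (real (base n))) ^ width n (k n)" using base_pos[of n] by simp
      also have "\<dots> = 2 powr h n" by (simp add: powr_power h_def mult.commute)
      finally show ?thesis .
    qed
    moreover obtain t where t: "t \<le> run_time (round_bound n (k n)) prog_main" "constructs F e prog_main n (k n) H t"
      using constructs_main[of n "k n" F e] unfolding H_def points_def by blast
    moreover have "t \<le> a * card H ^ b"
    proof -
      \<comment> \<open>\<open>base n\<close> exceeds \<open>n\<close>, so a constant power of it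
        bounds \<open>k n\<close>; the exponent depends on \<open>\<delta>\<close> only, which keeps
        \<open>a\<close> and \<open>b\<close> independent of \<open>n\<close>.\<close>
      have "k n \<le> base n ^ nat \<lceil>\<delta>\<rceil>"
      proof -
        have "real n powr \<delta> \<le> real (base n) powr \<delta>"
          using le_base[of n] assms by (intro powr_mono2) auto
        also have "\<dots> \<le> real (base n) powr real (nat \<lceil>\<delta>\<rceil>)"
          using base_pos[of n] by (intro powr_mono) (linarith, simp)
        also have "\<dots> = real (base n ^ nat \<lceil>\<delta>\<rceil>)" using base_pos[of n] by (simp add: powr_realpow)
        finally show ?thesis unfolding k_def by linarith
      qed
      moreover have "base n ^ (width n (k n) - 1) \<le> card H"
        unfolding H_def by (intro card_points_ge inj_on_subset[OF inj]) (auto simp: num_elems_def)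
      ultimately show ?thesis using ab t(1) order_trans by blast
    qed
    ultimately show ?thesis by blast
  qed
  then show ?thesis using h q unfolding k_def by (intro bexI[of _ h] bexI[of _ q] exI[of _ prog_main] exI[of _ a] exI[of _ b]) simp_all
qed

end
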